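(* Let $B_1$ be the Blaschke product in $\mathbb{C}^+$ with simple zeros $z_n=n+i$, $n\in\mathbb{N}$. Let $w$ be a nonnegative function on $[0,\infty)$ and let $\Omega=-\log w$. 1. If $w\in \mathrm{Adm}_+(B_1)$, then $$\int_1^\infty t^{-3/2}\,\Omega(t)\,dt<\infty$$ (the positive part $\max(\Omega,0)$ is integrable against $t^{-3/2}dt$ on $[1,\infty)$). 2. If $w$ is positive and nonincreasing on $[0,\infty)$ and $\int_1^\infty t^{-3/2}\Omega(t)\,dt<\infty$, then $w\in\mathrm{Adm}_+(B_1)$ and the even function $x\mapsto w(|x|)$, $x\in\mathbb{R}$, belongs to $\mathrm{Adm}(B_1)$.
   Context: $H^2$ denotes the Hardy space of the upper half-plane $\mathbb{C}^+$. For an inner function $\Theta$ in $\mathbb{C}^+$, the model subspace is $K_\Theta=H^2\ominus\Theta H^2$. A Blaschke product with zeros $z_n\in\mathbb{C}^+$ (with multiplicities $m_n$) is $B(z)=\prod_n e^{i\alpha_n}\big(\frac{z-z_n}{z-\overline z_n}\big)^{m_n}$ with convergence-ensuring unimodular factors. A nonnegative function $w$ on $\mathbb{R}$ is an admissible majorant for $K_\Theta$, written $w\in\mathrm{Adm}(\Theta)$, if there is a nonzero $f\in K_\Theta$ with $|f(x)|\le w(x)$ for a.e. $x\in\mathbb{R}$. One writes $w\in\mathrm{Adm}_+(\Theta)$ (resp. $w\in\mathrm{Adm}_-(\Theta)$) if there is a nonzero $f\in K_\Theta$ with $|f(x)|\le w(x)$ for a.e. $x>0$ (resp. a.e. $x<0$);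 here $w$ need only be defined on the corresponding half-line. *)

theory Defs
  imports "HOL-Analysis.Analysis"
begin

definition upper_half :: "complex set" where
  "upper_half = {z. Im z > 0}"

definition H2 :: "(complex \<Rightarrow> complex) set" where
  "H2 = {f. f holomorphic_on upper_half \<and>
           (\<exists>C::real. \<forall>y>0. (\<integral>\<^sup>+ x. ennreal ((cmod (f (Complex x y)))\<^sup>2) \<partial>lborel) \<le> ennreal C)}"

text \<open>Boundary values on the real line (vertical limits, which exist a.e. for
  H^2 and bounded analytic functions).\<close>
definition bv :: "(complex \<Rightarrow> complex) \<Rightarrow> real \<Rightarrow> complex" where
  "bv f x = Lim (at_right 0) (\<lambda>y::real. f (Complex x y))"

definition model_space :: "(complex \<Rightarrow> complex) \<Rightarrow> (complex \<Rightarrow> complex) set" where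
  "model_space \<Theta> = {f \<in> H2. \<forall>g \<in> H2.
      (LINT x|lebesgue. bv f x * cnj (bv (\<lambda>z. \<Theta> z * g z) x)) = 0}"

definition nonzero_on_upper :: "(complex \<Rightarrow> complex) \<Rightarrow> bool" where
  "nonzero_on_upper f \<longleftrightarrow> (\<exists>z \<in> upper_half. f z \<noteq> 0)"

definition Adm :: "(complex \<Rightarrow> complex) \<Rightarrow> (real \<Rightarrow> real) set" where
  "Adm \<Theta> = {w. (\<forall>x. 0 \<le> w x) \<and> (\<exists>f \<in> model_space \<Theta>. nonzero_on_upper f \<and>
       (AE x in lebesgue. cmod (bv f x) \<le> w x))}"

definition Adm_plus :: "(complex \<Rightarrow> complex) \<Rightarrow> (real \<Rightarrow> real) set" where
  "Adm_plus \<Theta> = {w. (\<forall>x\<ge>0. 0 \<le> w x) \<and> (\<exists>f \<in> model_space \<Theta>. nonzero_on_upper f \<and>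
       (AE x in lebesgue. x > 0 \<longrightarrow> cmod (bv f x) \<le> w x))}"

text \<open>Blaschke factor with Garnett's convergence normalisation.\<close>
definition blaschke_factor :: "complex \<Rightarrow> complex \<Rightarrow> complex" where
  "blaschke_factor a z = (of_real (cmod (a\<^sup>2 + 1)) / (a\<^sup>2 + 1)) * ((z - a) / (z - cnj a))"

definition B1 :: "complex \<Rightarrow> complex" where
  "B1 z = lim (\<lambda>N. \<Prod>n\<in>{1..N}. blaschke_factor (of_nat n + \<i>) z)"

definition log_integrand :: "(real \<Rightarrow> real) \<Rightarrow> real \<Rightarrow> ennreal" where
  "log_integrand w t = (if w t \<le> 0 then \<infinity>
      else ennreal (t powr (-3/2) * max 0 (- ln (w t))))"

end

theory Submission
  imports Defs "HOL-Complex_Analysis.Complex_Analysis" "HOL-Real_Asymp.Real_Asymp" "HOL-Probability.Sinc_Integral"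
begin

text \<open>
  A function \<open>f\<close> in the model space equals
  \<open>(1 / (2 \<pi> \<i>)) \<integral> f\<^sup>*(x) cnj (B\<^sub>1 x) (B\<^sub>1 x - B\<^sub>1 z) / (x - z) dx\<close>, hence it continues analytically across the
  real line and is bounded away from the poles \<open>n - \<i>\<close> of \<open>B\<^sub>1\<close>. Composed with a map of a quadrant
  that sends one side to the positive half-line and the other one below all the poles, it becomes a bounded
  function for which Jensen's inequality holds; the harmonic measure of that map has density
  comparable to \<open>t\<^bsup>-3/2\<^esup>\<close>, which is the first claim.

  Conversely, \<open>f = c / P\<close> with \<open>P(z) = \<Prod> (1 - z / (k\<^sup>2 - \<i>))\<close> over a set of integers \<open>k\<close> belongs to
  the model space as soon as it decays, because \<open>cnj f \<cdot> B\<^sub>1\<close> is on the real line a constant times \<open>f\<close> times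
  the Blaschke product of the remaining zeros. The full product over all \<open>k\<close> is the quotient of
  \<open>sin (\<pi> \<zeta>) / (\<pi> \<zeta>)\<close> at \<open>\<zeta>\<^sup>2 = z + \<i>\<close> and at \<open>\<zeta>\<^sup>2 = \<i>\<close>, which on the positive half-line is at most polynomially
  small; therefore each initial segment \<open>k \<le> K\<close> contributes at least \<open>x / (4 (K + 1)) - O(log x)\<close> to \<open>log \<bar>P x\<bar>\<close>
  when \<open>x \<le> K\<^sup>2\<close>, and at least \<open>- O(log x)\<close> otherwise. Superposing initial segments with weights comparable
  to \<open>\<Omega>(K\<^sup>2) / K\<^sup>2\<close>, whose sum converges exactly when \<open>\<integral> t\<^bsup>-3/2\<^esup> \<Omega> dt\<close> does, and rounding the resulting
  multiplicities to \<open>0\<close> and \<open>1\<close> gives \<open>log \<bar>P x\<bar> \<ge> \<Omega>(\<bar>x\<bar>)\<close> up to harmless terms.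
\<close>

section \<open>Contour shifts in strips\<close>

text \<open>\<open>H2\<close> is defined by bounds on horizontal lines alone, and \<open>bv\<close>
  is a \<open>Lim\<close>, which carries information only where the vertical limit exists. So a.e.
  boundary values, convergence to them in L^2 and Cauchy's formula have to be established before
  \<open>model_space\<close> can be used in either direction.

  Why zeros at squares: they give a function of order 1/2, which matches the weight t^(-3/2). The
  tail k > K of the full product lowers log |P x| by about x / K, so a cut at K of size sqrt x gains
  about sqrt x. About sqrt x values of K lie between sqrt x and 2 sqrt x; with weight Omega(x) / x
  each, their gains add up to Omega(x). Rounding costs only O(log x): the partial sums of the
  rounding error stay bounded by 1, and as a function of k the logarithm of the factor falls once
  and rises once, so its variation is O(log x). All logarithmic losses are repaid by adding a
  multiple of log x to Omega, which keeps the series convergent.\<close>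

lemma exists_small_of_nn_integral_finite:
  fixes D :: "real \<Rightarrow> complex"
  assumes fin: "(\<integral>\<^sup>+ x. ennreal (norm (D x)) \<partial>lborel) < \<infinity>" and e: "e > 0"
  shows "\<exists>x\<ge>n. norm (D x) < e" "\<exists>x\<le>n. norm (D x) < e"
proof -
  have inf: False if A: "\<And>x. x \<in> A \<Longrightarrow> e \<le> norm (D x)" and m: "emeasure lborel A = \<infinity>" "A \<in> sets borel" for A
  proof -
    have "\<infinity> = (\<integral>\<^sup>+ x. ennreal e * indicator A x \<partial>lborel)"
      using e m by (subst nn_integral_cmult_indicator) (auto simp: ennreal_mult_eq_top_iff ennreal_mult_top)
    also have "\<dots> \<le> (\<integral>\<^sup>+ x. ennreal (norm (D x)) \<partial>lborel)"
      by (intro nn_integral_mono) (auto split: split_indicator intro: ennreal_leI A)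
    finally show False using fin by simp
  qed
  have 1: "emeasure lborel {n..} = \<infinity>"
  proof (rule ccontr)
    assume "emeasure lborel {n..} \<noteq> \<infinity>"
    then obtain r where r: "emeasure lborel {n..} = ennreal r" "r \<ge> 0" by (cases "emeasure lborel {n..}") auto
    have "emeasure lborel {n..n+(r+1)} \<le> emeasure lborel {n..}" by (intro emeasure_mono) auto
    then show False using r by simp
  qed
  have 2: "emeasure lborel {..n} = \<infinity>"
  proof (rule ccontr)
    assume "emeasure lborel {..n} \<noteq> \<infinity>"
    then obtain r where r: "emeasure lborel {..n} = ennreal r" "r \<ge> 0" by (cases "emeasure lborel {..n}") auto
    have "emeasure lborel {n-(r+1)..n} \<le> emeasure lborel {..n}" by (intro emeasure_mono) auto
    then show False using r by simp
  qed
  show "\<exists>x\<ge>n. norm (D x) < e" using inf[of "{n..}"] 1 by (force simp: not_less)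
  show "\<exists>x\<le>n. norm (D x) < e" using inf[of "{..n}"] 2 by (force simp: not_less)
qed

lemma has_vector_derivative_horizontal:
  assumes "(\<Phi> has_field_derivative c) (at (Complex x y))"
  shows "((\<lambda>x. \<Phi> (Complex x y)) has_vector_derivative c) (at x within A)"
proof -
  have "((\<lambda>x. of_real x + \<i> * of_real y) has_vector_derivative 1) (at x within A)"
    by (auto intro!: derivative_eq_intros)
  then have "((\<lambda>x. Complex x y) has_vector_derivative 1) (at x within A)"
    by (simp add: Complex_eq)
  from field_vector_diff_chain_within[OF this, of \<Phi> c] assms show ?thesis
    by (auto simp: o_def intro: has_field_derivative_at_within)
qed

lemma has_vector_derivative_vertical:
  assumes "(\<Phi> has_field_derivative c) (at (Complex x y))"
  shows "((\<lambda>y. \<Phi> (Complex x y)) has_vector_derivative \<i> * c) (at y within A)"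
proof -
  have "((\<lambda>y. of_real x + \<i> * of_real y) has_vector_derivative \<i>) (at y within A)"
    by (auto intro!: derivative_eq_intros)
  then have "((\<lambda>y. Complex x y) has_vector_derivative \<i>) (at y within A)"
    by (simp add: Complex_eq)
  from field_vector_diff_chain_within[OF this, of \<Phi> c] assms show ?thesis
    by (auto simp: o_def intro: has_field_derivative_at_within)
qed

text \<open>There is no pointwise decay of \<open>h\<close>, only integrability on each line. A
  primitive on the convex set \<open>S\<close> turns the difference of the truncated line integrals
  into \<open>D X - D Y\<close>, with \<open>D X\<close> the contribution of the vertical side at
  \<open>X\<close>. By Tonelli \<open>D\<close> is integrable in \<open>X\<close>, hence small along
  sequences tending to both infinities.\<close>

lemma strip_shift:
  fixes h :: "complex \<Rightarrow> complex"
  assumes hol: "h holomorphic_on S" and S: "open S" "convex S" "\<And>x y. y \<in> {a..b} \<Longrightarrow> Complex x y \<in> S"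
    and ab: "a \<le> b"
    and bnd: "\<And>y. y \<in> {a..b} \<Longrightarrow> (\<integral>\<^sup>+ x. ennreal (norm (h (Complex x y))) \<partial>lborel) \<le> ennreal C"
  shows "(LBINT x. h (Complex x a)) = (LBINT x. h (Complex x b))"
proof -
  obtain \<Phi> where \<Phi>: "\<And>z. z \<in> S \<Longrightarrow> (\<Phi> has_field_derivative h z) (at z)"
    using holomorphic_convex_primitive'[OF S(2,1) hol] S(1) by (metis at_within_open)
  have conth: "continuous_on S h" using hol by (rule holomorphic_on_imp_continuous_on)
  have cont_y: "continuous_on UNIV (\<lambda>x. h (Complex x y))" if "y \<in> {a..b}" for y
    by (rule continuous_on_compose2[OF conth]) (auto intro!: continuous_intros S that)
  have int: "integrable lborel (\<lambda>x. h (Complex x y))" if "y \<in> {a..b}" for y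
  proof (rule integrableI_bounded)
    show "(\<lambda>x. h (Complex x y)) \<in> borel_measurable lborel"
      using borel_measurable_continuous_onI[OF cont_y[OF that]] by simp
    show "(\<integral>\<^sup>+ x. ennreal (norm (h (Complex x y))) \<partial>lborel) < \<infinity>"
      using bnd[OF that] by (auto simp: less_top[symmetric] top_unique)
  qed
  define D where "D X = \<Phi> (Complex X b) - \<Phi> (Complex X a)" for X
  have Dle: "ennreal (norm (D X)) \<le> (\<integral>\<^sup>+ y. ennreal (norm (indicator {a..b} y *\<^sub>R h (Complex X y))) \<partial>lborel)" for X
  proof -
    have "has_bochner_integral lborel (\<lambda>y. indicator {a..b} y *\<^sub>R (\<i> * h (Complex X y))) (D X)"
      unfolding D_def
    proof (rule has_bochner_integral_FTC_Icc[OF ab])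
      show "continuous_on {a..b} (\<lambda>y. \<i> * h (Complex X y))"
        by (intro continuous_intros continuous_on_compose2[OF conth]) (auto intro!: S)
    qed (auto intro!: has_vector_derivative_vertical \<Phi> S)
    then have "ennreal (norm (D X)) \<le> (\<integral>\<^sup>+ y. ennreal (norm (indicator {a..b} y *\<^sub>R (\<i> * h (Complex X y)))) \<partial>lborel)"
      using integral_norm_bound_ennreal by (metis has_bochner_integral_iff)
    then show ?thesis by (simp add: norm_mult)
  qed
  have meas: "(\<lambda>(X,y). ennreal (norm (indicator {a..b} y *\<^sub>R h (Complex X y)))) \<in> borel_measurable (lborel \<Otimes>\<^sub>M lborel)"
  proof -
    have "continuous_on (UNIV \<times> {a..b}) (\<lambda>p. h (Complex (fst p) (snd p)))"
      by (rule continuous_on_compose2[OF conth]) (auto intro!: continuous_intros S)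
    then have "(\<lambda>p. indicator (UNIV \<times> {a..b}) p *\<^sub>R h (Complex (fst p) (snd p))) \<in> borel_measurable borel"
      by (intro borel_measurable_continuous_on_indicator) (auto intro!: borel_closed closed_Times)
    then have "(\<lambda>p. ennreal (norm (indicator (UNIV \<times> {a..b}) p *\<^sub>R h (Complex (fst p) (snd p))))) \<in> borel_measurable borel"
      by measurable
    also have "(\<lambda>p. ennreal (norm (indicator (UNIV \<times> {a..b}) p *\<^sub>R h (Complex (fst p) (snd p))))) = (\<lambda>(X,y). ennreal (norm (indicator {a..b} y *\<^sub>R h (Complex X y))))"
      by (auto simp: fun_eq_iff indicator_def)
    finally show ?thesis by (simp add: lborel_prod)
  qed
  have "(\<integral>\<^sup>+ X. ennreal (norm (D X)) \<partial>lborel) \<le> (\<integral>\<^sup>+ X. (\<integral>\<^sup>+ y. ennreal (norm (indicator {a..b} y *\<^sub>R h (Complex X y))) \<partial>lborel) \<partial>lborel)"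
    by (intro nn_integral_mono Dle)
  also have "\<dots> = (\<integral>\<^sup>+ y. (\<integral>\<^sup>+ X. ennreal (norm (indicator {a..b} y *\<^sub>R h (Complex X y))) \<partial>lborel) \<partial>lborel)"
    using lborel_pair.Fubini'[OF meas] by simp
  also have "\<dots> \<le> (\<integral>\<^sup>+ y. ennreal C * indicator {a..b} y \<partial>lborel)"
    by (intro nn_integral_mono) (auto split: split_indicator intro: bnd)
  also have "\<dots> < \<infinity>" using ab
    by (subst nn_integral_cmult_indicator) (auto simp: ennreal_mult_less_top)
  finally have fin: "(\<integral>\<^sup>+ X. ennreal (norm (D X)) \<partial>lborel) < \<infinity>" .
  have "\<exists>x\<ge>real n. norm (D x) < 1 / real (Suc n)" for n
    by (rule exists_small_of_nn_integral_finite(1)[OF fin]) simp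
  then obtain X where X: "\<And>n. X n \<ge> real n" "\<And>n. norm (D (X n)) < 1 / real (Suc n)" by metis
  have "\<exists>x\<le>- real n. norm (D x) < 1 / real (Suc n)" for n
    by (rule exists_small_of_nn_integral_finite(2)[OF fin]) simp
  then obtain Y where Y: "\<And>n. Y n \<le> - real n" "\<And>n. norm (D (Y n)) < 1 / real (Suc n)" by metis
  define g where "g x = h (Complex x b) - h (Complex x a)" for x
  have intg: "integrable lborel g" unfolding g_def using int ab by auto
  have FTC: "(LBINT x. indicator {Y n..X n} x *\<^sub>R g x) = D (X n) - D (Y n)" for n
  proof (rule integral_FTC_Icc)
    show "Y n \<le> X n" using X(1)[of n] Y(1)[of n] by linarith
    show "continuous_on {Y n..X n} g" unfolding g_def
      by (intro continuous_intros continuous_on_subset[OF cont_y]) (use ab in auto)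
    show "(D has_vector_derivative g x) (at x within {Y n..X n})" for x
      unfolding D_def g_def using ab
      by (intro has_vector_derivative_diff has_vector_derivative_horizontal \<Phi> S) auto
  qed
  \<comment> \<open>As \<open>g\<close> is already known to be integrable, any windows that exhaust
    the line give its integral, so two sequences without further control are enough.\<close>
  have "(\<lambda>n. (LBINT x. indicator {Y n..X n} x *\<^sub>R g x)) \<longlonglongrightarrow> (LBINT x. g x)"
  proof (rule integral_dominated_convergence[where w="\<lambda>x. norm (g x)"])
    show "AE x in lborel. (\<lambda>n. indicator {Y n..X n} x *\<^sub>R g x) \<longlonglongrightarrow> g x"
    proof (rule AE_I2)
      fix x
      have "eventually (\<lambda>n. real n \<ge> \<bar>x\<bar>) sequentially"
        by real_asymp
      then have "eventually (\<lambda>n. indicator {Y n..X n} x *\<^sub>R g x = g x) sequentially"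
      proof eventually_elim
        case (elim n)
        then show ?case using X(1)[of n] Y(1)[of n] by (auto simp: indicator_def)
      qed
      then show "(\<lambda>n. indicator {Y n..X n} x *\<^sub>R g x) \<longlonglongrightarrow> g x"
        by (rule tendsto_eventually)
    qed
  qed (use intg in \<open>auto split: split_indicator\<close>)
  moreover have "(\<lambda>n. D (X n) - D (Y n)) \<longlonglongrightarrow> 0 - 0"
  proof (intro tendsto_diff)
    show "(\<lambda>n. D (X n)) \<longlonglongrightarrow> 0"
      by (rule Lim_null_comparison[OF always_eventually LIMSEQ_inverse_real_of_nat])
        (use X(2) in \<open>auto simp: inverse_eq_divide intro: less_imp_le\<close>)
    show "(\<lambda>n. D (Y n)) \<longlonglongrightarrow> 0"
      by (rule Lim_null_comparison[OF always_eventually LIMSEQ_inverse_real_of_nat])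
        (use Y(2) in \<open>auto simp: inverse_eq_divide intro: less_imp_le\<close>)
  qed
  ultimately have "(LBINT x. g x) = 0"
    unfolding FTC using LIMSEQ_unique by fastforce
  then show ?thesis unfolding g_def using int ab by (subst (asm) Bochner_Integration.integral_diff) auto
qed

section \<open>The Poisson kernel and the Poisson formula\<close>

definition poisson_kernel :: "real \<Rightarrow> real \<Rightarrow> real" where
  "poisson_kernel y t = y / (pi * (t\<^sup>2 + y\<^sup>2))"

lemma poisson_kernel_nonneg [simp]: "0 < y \<Longrightarrow> 0 \<le> poisson_kernel y t"
  by (auto simp: poisson_kernel_def)

lemma poisson_kernel_measurable [measurable]: "(\<lambda>t. poisson_kernel y (g t)) \<in> borel_measurable M" if [measurable]: "g \<in> borel_measurable M"
  unfolding poisson_kernel_def by measurable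

lemma has_bochner_integral_inverse_quadratic:
  assumes d: "d > 0"
  shows "has_bochner_integral lborel (\<lambda>t. 1 / ((t - x)\<^sup>2 + d\<^sup>2)) (pi / d)"
proof -
  have 1: "has_bochner_integral lborel (\<lambda>t. inverse (1 + t\<^sup>2)) pi"
    using integrable_inverse_1_plus_square LBINT_inverse_1_plus_square
    by (simp add: has_bochner_integral_iff set_integrable_def interval_lebesgue_integral_def set_lebesgue_integral_def)
  have "has_bochner_integral lborel (\<lambda>t. inverse (1 + (- (x/d) + (1/d) * t)\<^sup>2)) (pi /\<^sub>R \<bar>1/d\<bar>)"
    using lborel_has_bochner_integral_real_affine_iff[of "1/d" "\<lambda>t. inverse (1 + t\<^sup>2)" pi "- (x/d)"] d 1 by simp
  then have "has_bochner_integral lborel (\<lambda>t. (1/d\<^sup>2) * inverse (1 + (- (x/d) + (1/d) * t)\<^sup>2)) ((1/d\<^sup>2) * (pi /\<^sub>R \<bar>1/d\<bar>))"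
    by (rule has_bochner_integral_mult_right)
  also have "(\<lambda>t. (1/d\<^sup>2) * inverse (1 + (- (x/d) + (1/d) * t)\<^sup>2)) = (\<lambda>t. 1 / ((t - x)\<^sup>2 + d\<^sup>2))"
  proof
    fix t
    have "d\<^sup>2 * (1 + (- (x/d) + (1/d) * t)\<^sup>2) = (t - x)\<^sup>2 + d\<^sup>2"
      using d by (simp add: power2_eq_square field_simps)
    then show "(1/d\<^sup>2) * inverse (1 + (- (x/d) + (1/d) * t)\<^sup>2) = 1 / ((t - x)\<^sup>2 + d\<^sup>2)"
      by (metis (no_types, opaque_lifting) inverse_eq_divide mult_1 nonzero_inverse_mult_distrib inverse_mult_distrib)
  qed
  also have "(1/d\<^sup>2) * (pi /\<^sub>R \<bar>1/d\<bar>) = pi / d"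
    using d by (simp add: power2_eq_square field_simps)
  finally show ?thesis .
qed

lemma nn_integral_inverse_quadratic:
  assumes d: "d > 0"
  shows "(\<integral>\<^sup>+ t. ennreal (1 / ((t - x)\<^sup>2 + d\<^sup>2)) \<partial>lborel) = ennreal (pi / d)"
  using has_bochner_integral_inverse_quadratic[OF d, of x]
  by (subst nn_integral_eq_integral) (auto simp: has_bochner_integral_iff)

lemma has_bochner_integral_poisson_kernel:
  assumes "y > 0" shows "has_bochner_integral lborel (\<lambda>t. poisson_kernel y (x - t)) 1"
proof -
  have "has_bochner_integral lborel (\<lambda>t. (y / pi) * (1 / ((t - x)\<^sup>2 + y\<^sup>2))) ((y / pi) * (pi / y))"
    using has_bochner_integral_inverse_quadratic[OF assms] by (rule has_bochner_integral_mult_right)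
  then show ?thesis using assms by (simp add: poisson_kernel_def power2_commute)
qed

lemma nn_integral_poisson_kernel:
  assumes "y > 0" shows "(\<integral>\<^sup>+ t. ennreal (poisson_kernel y (x - t)) \<partial>lborel) = 1"
  using has_bochner_integral_poisson_kernel[OF assms, of x] assms
  by (subst nn_integral_eq_integral) (auto simp: has_bochner_integral_iff)

lemma nn_integral_poisson_kernel':
  assumes "y > 0" shows "(\<integral>\<^sup>+ t. ennreal (poisson_kernel y (t - x)) \<partial>lborel) = 1"
  using nn_integral_poisson_kernel[OF assms, of x] by (simp add: poisson_kernel_def power2_commute)

text \<open>With \<open>K(w) = 1 / (w - z) - 1 / (w - cnj z)\<close>, which is \<open>2 \<pi> \<i>\<close> times the Poisson kernel on the real line, the
  function \<open>(F w - F z) K w\<close> is holomorphic and its integrals over the lines \<open>Im w = Y\<close> tend to \<open>0\<close>.\<close>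

lemma poisson_formula:
  fixes F :: "complex \<Rightarrow> complex"
  assumes hol: "F holomorphic_on {z. Im z > -e}" and e: "e > 0"
    and bnd: "\<And>y. y \<ge> 0 \<Longrightarrow> (\<integral>\<^sup>+ x. ennreal ((cmod (F (Complex x y)))\<^sup>2) \<partial>lborel) \<le> ennreal C"
    and C: "C \<ge> 0" and z: "Im z > 0"
  shows "has_bochner_integral lborel (\<lambda>t. of_real (poisson_kernel (Im z) (Re z - t)) * F (Complex t 0)) (F z)"
proof -
  define x0 y0 where "x0 = Re z" and "y0 = Im z"
  have zc: "z = Complex x0 y0" by (simp add: x0_def y0_def)
  have y0: "y0 > 0" using z by (simp add: y0_def)
  define q where "q w = (if w = z then deriv F z else (F w - F z) / (w - z))" for w
  \<comment> \<open>\<open>2 * \<i> * y0\<close> is \<open>z - cnj z\<close>, so away from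
    \<open>z\<close> this is \<open>(F w - F z) K w\<close>; \<open>q\<close> fills in the removable
    singularity.\<close>
  define h where "h w = 2 * \<i> * of_real y0 * q w / (w - cnj z)" for w
  define S where "S = {w. Im w > - min e y0}"
  have oS: "open S" unfolding S_def by (rule open_halfspace_Im_gt)
  have cS: "convex S" unfolding S_def by (rule convex_halfspace_Im_gt)
  have q_hol: "q holomorphic_on {z. Im z > -e}"
    unfolding q_def by (rule pole_lemma_open[OF hol open_halfspace_Im_gt])
  have "q holomorphic_on S"
    by (rule holomorphic_on_subset[OF q_hol]) (auto simp: S_def)
  then have hS: "h holomorphic_on S"
    unfolding h_def by (intro holomorphic_intros) (auto simp: S_def y0_def min_def split: if_splits)
  have F_cont: "continuous_on {z. Im z > -e} F" using hol by (rule holomorphic_on_imp_continuous_on)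
  have F_meas [measurable]: "(\<lambda>t. F (Complex t Y)) \<in> borel_measurable borel" if "Y \<ge> 0" for Y
    by (intro borel_measurable_continuous_onI continuous_on_compose2[OF F_cont])
       (use that e in \<open>auto intro!: continuous_intros\<close>)
  have h_eq: "norm (h (Complex t Y)) = 2 * y0 * norm (F (Complex t Y) - F z) / (norm (Complex t Y - z) * norm (Complex t Y - cnj z))"
    if "Complex t Y \<noteq> z" for t Y
    using that y0 by (simp add: h_def q_def norm_mult norm_divide)
  have prod_ge: "norm (Complex t Y - z) * norm (Complex t Y - cnj z) \<ge> (t - x0)\<^sup>2 + (Y - y0)\<^sup>2" if "Y \<ge> 0" for t Y
  proof -
    have n1: "norm (Complex t Y - z) = sqrt ((t - x0)\<^sup>2 + (Y - y0)\<^sup>2)"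
      by (simp add: zc cmod_def)
    have n2: "norm (Complex t Y - cnj z) = sqrt ((t - x0)\<^sup>2 + (Y + y0)\<^sup>2)"
      by (simp add: zc cmod_def)
    have "(Y - y0)\<^sup>2 \<le> (Y + y0)\<^sup>2" using that y0 by (simp add: power2_eq_square algebra_simps)
    then have "norm (Complex t Y - z) \<le> norm (Complex t Y - cnj z)" unfolding n1 n2 by simp
    then have "norm (Complex t Y - z) * norm (Complex t Y - z) \<le> norm (Complex t Y - z) * norm (Complex t Y - cnj z)"
      by (intro mult_left_mono) auto
    then show ?thesis unfolding n1 by simp
  qed
  have far: "norm (h (Complex t Y)) \<le> 2 * y0 * ((norm (F (Complex t Y)) + norm (F z)) * (1 / ((t - x0)\<^sup>2 + (Y - y0)\<^sup>2)))"
    if "Y \<ge> 0" "(t - x0)\<^sup>2 + (Y - y0)\<^sup>2 > 0" for t Y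
  proof -
    have ne: "Complex t Y \<noteq> z" using that(2) by (auto simp: zc)
    have "norm (h (Complex t Y)) \<le> 2 * y0 * norm (F (Complex t Y) - F z) / ((t - x0)\<^sup>2 + (Y - y0)\<^sup>2)"
      unfolding h_eq[OF ne] using that y0 prod_ge[OF that(1), of t]
      by (intro divide_left_mono mult_pos_pos) (auto simp: ne intro!: mult_pos_pos order.strict_trans2[OF that(2)])
    also have "\<dots> \<le> 2 * y0 * (norm (F (Complex t Y)) + norm (F z)) / ((t - x0)\<^sup>2 + (Y - y0)\<^sup>2)"
      using y0 that by (intro divide_right_mono mult_left_mono norm_triangle_ineq4) auto
    finally show ?thesis by simp
  qed
  \<comment> \<open>Only the square of \<open>F\<close> is integrable on lines, so a product of
    \<open>F\<close> with the kernel is split by the weighted mean inequality. The weight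
    \<open>d\<close> makes both parts O(1/d) after integration over the line at height
    \<open>d\<close> above \<open>z\<close>.\<close>
  have amgm: "u * k \<le> (u\<^sup>2 / d + k / d) / 2" if "d > 0" "0 \<le> k" "k \<le> 1 / d\<^sup>2" for u k d :: real
  proof -
    have "0 \<le> (u - k * d)\<^sup>2 / d" using that by simp
    then have "2 * (u * k) \<le> u\<^sup>2 / d + k\<^sup>2 * d"
      using that by (simp add: power2_eq_square field_simps)
    moreover have "k\<^sup>2 * d \<le> k / d"
    proof -
      have "k * (k * d) \<le> k * (1 / d)"
        using that by (intro mult_left_mono) (auto simp: field_simps power2_eq_square)
      then show ?thesis by (simp add: power2_eq_square algebra_simps)
    qed
    ultimately show ?thesis by simp
  qed
  have intq: "(\<integral>\<^sup>+ t. ennreal (a * (cmod (F (Complex t Y)))\<^sup>2 + b * (1 / ((t - x0)\<^sup>2 + d\<^sup>2))) \<partial>lborel) \<le> ennreal (a * C + b * (pi / d))"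
    if "a \<ge> 0" "b \<ge> 0" "d > 0" "Y \<ge> 0" for a b d Y
  proof -
    note [measurable] = F_meas[OF that(4)]
    have "(\<integral>\<^sup>+ t. ennreal (a * (cmod (F (Complex t Y)))\<^sup>2 + b * (1 / ((t - x0)\<^sup>2 + d\<^sup>2))) \<partial>lborel)
       = (\<integral>\<^sup>+ t. ennreal a * ennreal ((cmod (F (Complex t Y)))\<^sup>2) + ennreal b * ennreal (1 / ((t - x0)\<^sup>2 + d\<^sup>2)) \<partial>lborel)"
      using that by (intro nn_integral_cong) (subst ennreal_plus, auto simp: ennreal_mult simp flip: times_divide_eq_right)
    also have "\<dots> = ennreal a * (\<integral>\<^sup>+ t. ennreal ((cmod (F (Complex t Y)))\<^sup>2) \<partial>lborel) + ennreal b * (\<integral>\<^sup>+ t. ennreal (1 / ((t - x0)\<^sup>2 + d\<^sup>2)) \<partial>lborel)"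
      by (subst nn_integral_add) (simp_all add: nn_integral_cmult)
    also have "\<dots> \<le> ennreal a * ennreal C + ennreal b * ennreal (pi / d)"
      unfolding nn_integral_inverse_quadratic[OF that(3)] by (intro add_mono mult_left_mono bnd) (use that in auto)
    also have "\<dots> = ennreal (a * C + b * (pi / d))" using that C
      by (subst ennreal_plus) (auto simp: ennreal_mult simp flip: times_divide_eq_right)
    finally show ?thesis .
  qed
  \<comment> \<open>\<open>strip_shift\<close> needs one L^1 bound for all lines up to height
    \<open>Y\<close>, possibly passing through \<open>z\<close>: compactness bounds \<open>h\<close>
    above the interval of radius 1 about \<open>x0\<close>, and outside it the kernel decays
    quadratically.\<close>
  have bound_low: "\<exists>B. \<forall>y\<in>{0..Y}. (\<integral>\<^sup>+ t. ennreal (norm (h (Complex t y))) \<partial>lborel) \<le> ennreal B" for Y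
  proof -
    have "continuous_on ({x0-1..x0+1} \<times> {0..Y}) (\<lambda>p. h (Complex (fst p) (snd p)))"
      by (rule continuous_on_compose2[OF holomorphic_on_imp_continuous_on[OF hS]])
         (use e y0 in \<open>auto intro!: continuous_intros simp: S_def min_def\<close>)
    then have "compact ((\<lambda>p. h (Complex (fst p) (snd p))) ` ({x0-1..x0+1} \<times> {0..Y}))"
      by (rule compact_continuous_image) (auto intro: compact_Times)
    then obtain M where M: "M > 0" "\<And>p. p \<in> {x0-1..x0+1} \<times> {0..Y} \<Longrightarrow> norm (h (Complex (fst p) (snd p))) \<le> M"
      using compact_imp_bounded bounded_pos by (metis (no_types, lifting) imageI)
    have le: "norm (h (Complex t y)) \<le> (2*y0) * (cmod (F (Complex t y)))\<^sup>2 + (2*M + 2*y0 + 4*y0*norm (F z)) * (1 / ((t - x0)\<^sup>2 + 1\<^sup>2))"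
      if y: "y \<in> {0..Y}" for t y
    proof (cases "\<bar>t - x0\<bar> \<le> 1")
      case True
      then have sq: "(t-x0)\<^sup>2 \<le> 1" by (simp add: abs_square_le_1)
      have "norm (h (Complex t y)) \<le> M" using M(2)[of "(t,y)"] True y by (auto simp: abs_le_iff)
      also have "\<dots> \<le> (2*M) * (1 / ((t - x0)\<^sup>2 + 1\<^sup>2))"
        using sq M(1) by (simp add: field_simps add_pos_nonneg)
      also have "\<dots> \<le> (2*M + 2*y0 + 4*y0*norm (F z)) * (1 / ((t - x0)\<^sup>2 + 1\<^sup>2))"
        using y0 by (intro mult_right_mono) auto
      finally show ?thesis using y0 by (smt (verit) mult_nonneg_nonneg zero_le_power2)
    next
      case False
      define r where "r = 1 / ((t - x0)\<^sup>2 + 1\<^sup>2)"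
      have sq: "(t-x0)\<^sup>2 > 1" using False abs_square_le_1[of "t - x0"] by linarith
      have r: "r \<ge> 0" "r \<le> 1 / 1\<^sup>2" using sq by (auto simp: r_def field_simps)
      have "1 / ((t - x0)\<^sup>2 + (y - y0)\<^sup>2) \<le> 1 / (t-x0)\<^sup>2"
        using sq by (intro divide_left_mono) (auto intro!: mult_pos_pos add_pos_nonneg)
      also have "\<dots> \<le> 2 * r" using sq by (simp add: r_def divide_simps)
      finally have k: "1 / ((t - x0)\<^sup>2 + (y - y0)\<^sup>2) \<le> 2 * r" .
      have "norm (h (Complex t y)) \<le> 2 * y0 * ((norm (F (Complex t y)) + norm (F z)) * (1 / ((t - x0)\<^sup>2 + (y - y0)\<^sup>2)))"
        using sq y by (intro far add_pos_nonneg) auto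
      also have "\<dots> \<le> 2 * y0 * ((norm (F (Complex t y)) + norm (F z)) * (2 * r))"
        using y0 by (intro mult_left_mono k) auto
      also have "\<dots> = 4 * y0 * (norm (F (Complex t y)) * r) + 4 * y0 * norm (F z) * r" by (simp add: algebra_simps)
      also have "\<dots> \<le> 4 * y0 * (((norm (F (Complex t y)))\<^sup>2 / 1 + r / 1) / 2) + 4 * y0 * norm (F z) * r"
        using y0 by (intro add_right_mono mult_left_mono amgm r) auto
      also have "\<dots> = (2*y0) * (cmod (F (Complex t y)))\<^sup>2 + (2*y0 + 4*y0*norm (F z)) * r" by (simp add: algebra_simps)
      also have "\<dots> \<le> (2*y0) * (cmod (F (Complex t y)))\<^sup>2 + (2*M + 2*y0 + 4*y0*norm (F z)) * r"
        using M(1) r by (intro add_left_mono mult_right_mono) auto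
      finally show ?thesis by (simp add: r_def)
    qed
    show ?thesis
    proof (intro exI ballI)
      fix y assume y: "y \<in> {0..Y}"
      have "(\<integral>\<^sup>+ t. ennreal (norm (h (Complex t y))) \<partial>lborel) \<le> (\<integral>\<^sup>+ t. ennreal ((2*y0) * (cmod (F (Complex t y)))\<^sup>2 + (2*M + 2*y0 + 4*y0*norm (F z)) * (1 / ((t - x0)\<^sup>2 + 1\<^sup>2))) \<partial>lborel)"
        by (intro nn_integral_mono ennreal_leI le y)
      also have "\<dots> \<le> ennreal ((2*y0) * C + (2*M + 2*y0 + 4*y0*norm (F z)) * (pi / 1))"
        using y0 M(1) y by (intro intq) auto
      finally show "(\<integral>\<^sup>+ t. ennreal (norm (h (Complex t y))) \<partial>lborel) \<le> ennreal ((2*y0) * C + (2*M + 2*y0 + 4*y0*norm (F z)) * (pi / 1))" .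
    qed
  qed
  have bound_high: "norm (LBINT t. h (Complex t 0)) \<le> y0 * C / d + (y0 / d + 2*y0*norm (F z)) * (pi / d)" if d: "d > 0" for d
  proof -
    define Y where "Y = y0 + d"
    have Y: "Y \<ge> 0" "Y - y0 = d" using d y0 by (auto simp: Y_def)
    obtain B where B: "\<And>y. y \<in> {0..Y} \<Longrightarrow> (\<integral>\<^sup>+ t. ennreal (norm (h (Complex t y))) \<partial>lborel) \<le> ennreal B"
      using bound_low[of Y] by blast
    have "(LBINT t. h (Complex t 0)) = (LBINT t. h (Complex t Y))"
      by (rule strip_shift[OF hS oS cS _ Y(1) B]) (use e y0 in \<open>auto simp: S_def min_def\<close>)
    have le: "norm (h (Complex t Y)) \<le> (y0/d) * (cmod (F (Complex t Y)))\<^sup>2 + (y0/d + 2*y0*norm (F z)) * (1 / ((t - x0)\<^sup>2 + d\<^sup>2))" for t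
    proof -
      define k where "k = 1 / ((t - x0)\<^sup>2 + d\<^sup>2)"
      have k: "0 \<le> k" "k \<le> 1 / d\<^sup>2" using d by (auto simp: k_def intro!: divide_left_mono mult_pos_pos add_nonneg_pos)
      have "norm (h (Complex t Y)) \<le> 2 * y0 * ((norm (F (Complex t Y)) + norm (F z)) * k)"
        using far[of Y t] Y d by (auto simp: k_def add_nonneg_pos)
      also have "\<dots> = 2 * y0 * (norm (F (Complex t Y)) * k) + 2 * y0 * norm (F z) * k" by (simp add: algebra_simps)
      also have "\<dots> \<le> 2 * y0 * (((norm (F (Complex t Y)))\<^sup>2 / d + k / d) / 2) + 2 * y0 * norm (F z) * k"
        using y0 by (intro add_right_mono mult_left_mono amgm k d) auto
      also have "\<dots> = (y0/d) * (norm (F (Complex t Y)))\<^sup>2 + (y0/d + 2*y0*norm (F z)) * k"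
        using d by (simp add: field_simps)
      finally show ?thesis by (simp add: k_def)
    qed
    have cY: "continuous_on UNIV (\<lambda>t. h (Complex t Y))"
      by (rule continuous_on_compose2[OF holomorphic_on_imp_continuous_on[OF hS]])
         (use e y0 Y in \<open>auto intro!: continuous_intros simp: S_def min_def\<close>)
    have "integrable lborel (\<lambda>t. h (Complex t Y))"
    proof (rule integrableI_bounded)
      show "(\<lambda>t. h (Complex t Y)) \<in> borel_measurable lborel"
        using borel_measurable_continuous_onI[OF cY] by simp
      show "(\<integral>\<^sup>+ t. ennreal (norm (h (Complex t Y))) \<partial>lborel) < \<infinity>"
        using B[of Y] Y by (auto simp: less_top[symmetric] top_unique)
    qed
    then have "ennreal (norm (LBINT t. h (Complex t Y))) \<le> (\<integral>\<^sup>+ t. ennreal (norm (h (Complex t Y))) \<partial>lborel)"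
      by (rule integral_norm_bound_ennreal)
    also have "\<dots> \<le> (\<integral>\<^sup>+ t. ennreal ((y0/d) * (cmod (F (Complex t Y)))\<^sup>2 + (y0/d + 2*y0*norm (F z)) * (1 / ((t - x0)\<^sup>2 + d\<^sup>2))) \<partial>lborel)"
      by (intro nn_integral_mono ennreal_leI le)
    also have "\<dots> \<le> ennreal ((y0/d) * C + (y0/d + 2*y0*norm (F z)) * (pi / d))"
      using y0 d Y by (intro intq) auto
    finally have "norm (LBINT t. h (Complex t Y)) \<le> (y0/d) * C + (y0/d + 2*y0*norm (F z)) * (pi / d)"
      using y0 d C by (subst (asm) ennreal_le_iff) auto
    with \<open>(LBINT t. h (Complex t 0)) = _\<close> show ?thesis by simp
  qed
  have int0: "(LBINT t. h (Complex t 0)) = 0"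
  proof -
    have "((\<lambda>d. y0 * C / d + (y0 / d + 2*y0*norm (F z)) * (pi / d)) \<longlongrightarrow> 0) at_top"
      by real_asymp
    moreover have "eventually (\<lambda>d. norm (LBINT t. h (Complex t 0)) \<le> y0 * C / d + (y0 / d + 2*y0*norm (F z)) * (pi / d)) at_top"
      using eventually_gt_at_top[of 0] by eventually_elim (rule bound_high)
    ultimately have "norm (LBINT t. h (Complex t 0)) \<le> 0"
      by (rule tendsto_lowerbound) simp
    then show ?thesis by simp
  qed
  define K where "K t = 2 * \<i> * of_real pi * of_real (poisson_kernel y0 (x0 - t))" for t
  have h0: "h (Complex t 0) = K t * F (Complex t 0) - K t * F z" for t
  proof -
    have ne: "Complex t 0 \<noteq> z" using y0 by (auto simp: zc)
    have sq: "(Complex t 0 - z) * (Complex t 0 - cnj z) = of_real ((t - x0)\<^sup>2 + y0\<^sup>2)"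
      by (simp add: zc complex_eq_iff power2_eq_square algebra_simps)
    have "h (Complex t 0) = 2 * \<i> * of_real y0 * (F (Complex t 0) - F z) / ((Complex t 0 - z) * (Complex t 0 - cnj z))"
      using ne by (simp add: h_def q_def)
    also have "\<dots> = K t * (F (Complex t 0) - F z)"
      unfolding sq K_def poisson_kernel_def by (simp add: power2_commute)
    finally show ?thesis by (simp add: algebra_simps)
  qed
  have intK: "has_bochner_integral lborel K (2 * \<i> * of_real pi)"
  proof -
    have "has_bochner_integral lborel (\<lambda>t. complex_of_real (poisson_kernel y0 (x0 - t))) (of_real 1)"
      by (rule has_bochner_integral_of_real[OF has_bochner_integral_poisson_kernel[OF y0]])
    from has_bochner_integral_mult_right[OF this, of "2 * \<i> * of_real pi"] show ?thesis
      by (simp add: K_def[abs_def])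
  qed
  have intH: "integrable lborel (\<lambda>t. h (Complex t 0))"
  proof (rule integrableI_bounded)
    have "continuous_on UNIV (\<lambda>t. h (Complex t 0))"
      by (rule continuous_on_compose2[OF holomorphic_on_imp_continuous_on[OF hS]])
         (use e y0 in \<open>auto intro!: continuous_intros simp: S_def min_def\<close>)
    then show "(\<lambda>t. h (Complex t 0)) \<in> borel_measurable lborel"
      using borel_measurable_continuous_onI by simp
    show "(\<integral>\<^sup>+ t. ennreal (norm (h (Complex t 0))) \<partial>lborel) < \<infinity>"
      using bound_low[of 0] by (auto simp: less_top[symmetric] top_unique)
  qed
  have "has_bochner_integral lborel (\<lambda>t. h (Complex t 0) + K t * F z) (0 + 2 * \<i> * of_real pi * F z)"
    using intH int0 by (intro has_bochner_integral_add has_bochner_integral_mult_left intK) (auto simp: has_bochner_integral_iff)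
  then have "has_bochner_integral lborel (\<lambda>t. K t * F (Complex t 0)) (2 * \<i> * of_real pi * F z)"
    by (simp add: h0)
  from has_bochner_integral_mult_right[OF this, of "1 / (2 * \<i> * of_real pi)"]
  show ?thesis by (simp add: K_def x0_def y0_def mult.assoc)
qed

section \<open>Hardy space functions on horizontal lines\<close>

lemma borel_measurable_cnj [measurable (raw)]:
  "g \<in> borel_measurable M \<Longrightarrow> (\<lambda>x. cnj (g x)) \<in> borel_measurable M"
  by (rule measurable_compose[OF _ borel_measurable_continuous_onI]) (auto intro: continuous_intros)

definition l2sq :: "(real \<Rightarrow> complex) \<Rightarrow> ennreal" where
  "l2sq u = (\<integral>\<^sup>+ x. ennreal ((cmod (u x))\<^sup>2) \<partial>lborel)"

lemma l2sq_add_le: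
  assumes [measurable]: "u \<in> borel_measurable borel" "v \<in> borel_measurable borel"
  shows "l2sq (\<lambda>x. u x + v x) \<le> 2 * l2sq u + 2 * l2sq v"
proof -
  have "(cmod (a + b))\<^sup>2 \<le> 2 * (cmod a)\<^sup>2 + 2 * (cmod b)\<^sup>2" for a b
  proof -
    have "(cmod (a + b))\<^sup>2 \<le> (cmod a + cmod b)\<^sup>2" by (intro power_mono norm_triangle_ineq) auto
    also have "\<dots> \<le> 2 * (cmod a)\<^sup>2 + 2 * (cmod b)\<^sup>2"
      using zero_le_power2[of "cmod a - cmod b"] by (simp add: power2_eq_square algebra_simps)
    finally show ?thesis .
  qed
  then have "l2sq (\<lambda>x. u x + v x) \<le> (\<integral>\<^sup>+ x. 2 * ennreal ((cmod (u x))\<^sup>2) + 2 * ennreal ((cmod (v x))\<^sup>2) \<partial>lborel)"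
    unfolding l2sq_def
    by (intro nn_integral_mono) (auto simp flip: ennreal_numeral ennreal_mult ennreal_plus intro!: ennreal_leI)
  also have "\<dots> = 2 * l2sq u + 2 * l2sq v"
    unfolding l2sq_def by (simp add: nn_integral_add nn_integral_cmult)
  finally show ?thesis .
qed

lemma l2sq_diff_le:
  assumes [measurable]: "u \<in> borel_measurable borel" "v \<in> borel_measurable borel"
  shows "l2sq (\<lambda>x. u x - v x) \<le> 2 * l2sq u + 2 * l2sq v"
proof -
  have "l2sq (\<lambda>x. u x + - v x) \<le> 2 * l2sq u + 2 * l2sq (\<lambda>x. - v x)"
    by (rule l2sq_add_le) auto
  then show ?thesis by (simp add: l2sq_def)
qed

lemma l2_Cauchy_Schwarz:
  assumes [measurable]: "u \<in> borel_measurable borel" "v \<in> borel_measurable borel"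
  shows "(\<integral>\<^sup>+ x. ennreal (cmod (u x * v x)) \<partial>lborel)\<^sup>2 \<le> l2sq u * l2sq v"
  using Cauchy_Schwarz_nn_integral[of "\<lambda>x. ennreal (cmod (u x))" lborel "\<lambda>x. ennreal (cmod (v x))"]
  by (simp add: l2sq_def ennreal_power norm_mult ennreal_mult)

lemma l2_product_le:
  assumes [measurable]: "u \<in> borel_measurable borel" "v \<in> borel_measurable borel"
    and "l2sq u \<le> ennreal a" "l2sq v \<le> ennreal b" "a \<ge> 0" "b \<ge> 0"
  shows "(\<integral>\<^sup>+ x. ennreal (cmod (u x * v x)) \<partial>lborel) \<le> ennreal (sqrt (a * b))"
proof -
  have "(\<integral>\<^sup>+ x. ennreal (cmod (u x * v x)) \<partial>lborel)\<^sup>2 \<le> l2sq u * l2sq v"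
    by (rule l2_Cauchy_Schwarz) auto
  also have "\<dots> \<le> ennreal a * ennreal b" by (intro mult_mono assms) auto
  also have "\<dots> = (ennreal (sqrt (a * b)))\<^sup>2" using assms by (simp add: ennreal_power ennreal_mult)
  finally have le: "(\<integral>\<^sup>+ x. ennreal (cmod (u x * v x)) \<partial>lborel)\<^sup>2 \<le> (ennreal (sqrt (a * b)))\<^sup>2" .
  show ?thesis
  proof (cases "\<integral>\<^sup>+ x. ennreal (cmod (u x * v x)) \<partial>lborel")
    case (real r)
    then show ?thesis using le assms
      by (simp add: ennreal_power power2_le_iff_abs_le real_le_rsqrt)
  next
    case top
    have "(top::ennreal) \<le> ennreal ((sqrt (a * b))\<^sup>2)"
      using le unfolding top by (subst (asm) ennreal_power) (use assms in \<open>auto simp: power2_eq_square\<close>)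
    then show ?thesis by (simp add: top_unique)
  qed
qed

lemma H2_I:
  assumes "f holomorphic_on upper_half" "\<And>y. y > 0 \<Longrightarrow> l2sq (\<lambda>x. f (Complex x y)) \<le> ennreal C"
  shows "f \<in> H2"
  using assms unfolding H2_def l2sq_def by blast

lemma H2_holomorphic: "f \<in> H2 \<Longrightarrow> f holomorphic_on upper_half"
  by (simp add: H2_def)

lemma H2_bound:
  assumes "f \<in> H2"
  obtains C where "C \<ge> 0" "\<And>y. y > 0 \<Longrightarrow> l2sq (\<lambda>x. f (Complex x y)) \<le> ennreal C"
proof -
  obtain C where C: "\<And>y. y > 0 \<Longrightarrow> l2sq (\<lambda>x. f (Complex x y)) \<le> ennreal C"
    using assms unfolding H2_def l2sq_def by auto
  show ?thesis
    by (rule that[of "max C 0"]) (auto intro: order.trans[OF C] ennreal_leI)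
qed

lemma H2_continuous_line: "f \<in> H2 \<Longrightarrow> y > 0 \<Longrightarrow> continuous_on UNIV (\<lambda>x. f (Complex x y))"
  by (rule continuous_on_compose2[OF holomorphic_on_imp_continuous_on[OF H2_holomorphic]])
     (auto simp: upper_half_def intro!: continuous_intros)

lemma H2_measurable_line: "f \<in> H2 \<Longrightarrow> y > 0 \<Longrightarrow> (\<lambda>x. f (Complex x y)) \<in> borel_measurable borel"
  by (intro borel_measurable_continuous_onI H2_continuous_line)

lemma holomorphic_on_upper_shift:
  assumes "f holomorphic_on upper_half" "e \<ge> 0"
  shows "(\<lambda>z. f (z + \<i> * of_real e)) holomorphic_on {z. Im z > -e}"
proof -
  have "f \<circ> (\<lambda>z. z + \<i> * of_real e) holomorphic_on {z. Im z > -e}"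
    by (rule holomorphic_on_compose_gen[OF _ assms(1)])
       (use assms(2) in \<open>auto simp: upper_half_def intro!: holomorphic_intros\<close>)
  then show ?thesis by (simp add: o_def)
qed

lemma Complex_add_imag: "Complex x y + \<i> * of_real e = Complex x (y + e)"
  by (simp add: complex_eq_iff)

text \<open>\<open>poisson_formula\<close> asks for analyticity past the real line; the shift by
  \<open>e\<close> provides it.\<close>

lemma H2_poisson:
  assumes f: "f \<in> H2" and e: "e > 0" and y: "y > 0"
  shows "has_bochner_integral lborel (\<lambda>t. of_real (poisson_kernel y (x - t)) * f (Complex t e)) (f (Complex x (y + e)))"
proof -
  obtain C where C: "C \<ge> 0" "\<And>y. y > 0 \<Longrightarrow> l2sq (\<lambda>x. f (Complex x y)) \<le> ennreal C" using H2_bound[OF f] by blast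
  have "has_bochner_integral lborel (\<lambda>t. of_real (poisson_kernel (Im (Complex x y)) (Re (Complex x y) - t)) * f (Complex t 0 + \<i> * of_real e)) (f (Complex x y + \<i> * of_real e))"
    by (rule poisson_formula[OF holomorphic_on_upper_shift[OF H2_holomorphic[OF f]] e _ C(1)])
       (use C(2) e y in \<open>auto simp: Complex_add_imag l2sq_def\<close>)
  then show ?thesis by (simp only: Complex_add_imag complex.sel add_0)
qed

text \<open>Jensen's inequality for the square, the Poisson kernel being a probability density. It
  follows by integrating \<open>2 * m * u \<le> m\<^sup>2 + u\<^sup>2\<close> with \<open>m\<close>
  the modulus of the average, after which one \<open>m\<^sup>2\<close> cancels.\<close>

lemma H2_poisson_sq:
  assumes f: "f \<in> H2" and e: "e > 0" and y: "y > 0"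
  shows "ennreal ((cmod (f (Complex x (y + e))))\<^sup>2) \<le> (\<integral>\<^sup>+ t. ennreal (poisson_kernel y (x - t)) * ennreal ((cmod (f (Complex t e)))\<^sup>2) \<partial>lborel)"
    (is "_ \<le> ?I")
proof -
  note [measurable] = H2_measurable_line[OF f e]
  define m where "m = cmod (f (Complex x (y + e)))"
  have m: "m \<ge> 0" by (simp add: m_def)
  have P: "has_bochner_integral lborel (\<lambda>t. of_real (poisson_kernel y (x - t)) * f (Complex t e)) (f (Complex x (y + e)))"
    by (rule H2_poisson[OF f e y])
  have "ennreal (2 * m * m) = ennreal (2 * m) * ennreal m" using m by (simp add: ennreal_mult)
  also have "ennreal m \<le> (\<integral>\<^sup>+ t. ennreal (norm (of_real (poisson_kernel y (x - t)) * f (Complex t e))) \<partial>lborel)"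
    using integral_norm_bound_ennreal[of lborel "\<lambda>t. of_real (poisson_kernel y (x - t)) * f (Complex t e)"] P
    by (simp add: m_def has_bochner_integral_iff)
  also have "ennreal (2 * m) * \<dots> = (\<integral>\<^sup>+ t. ennreal (2 * m) * ennreal (norm (of_real (poisson_kernel y (x - t)) * f (Complex t e))) \<partial>lborel)"
    by (rule nn_integral_cmult[symmetric]) simp
  also have "\<dots> \<le> (\<integral>\<^sup>+ t. ennreal (m\<^sup>2) * ennreal (poisson_kernel y (x - t)) + ennreal (poisson_kernel y (x - t)) * ennreal ((cmod (f (Complex t e)))\<^sup>2) \<partial>lborel)"
  proof (intro nn_integral_mono)
    fix t
    define p u where "p = poisson_kernel y (x - t)" and "u = cmod (f (Complex t e))"
    have p: "p \<ge> 0" using y by (simp add: p_def)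
    have "p * (2 * m * u) \<le> p * (m\<^sup>2 + u\<^sup>2)"
      using zero_le_power2[of "m - u"] p by (intro mult_left_mono) (auto simp: power2_eq_square algebra_simps)
    then have "ennreal (2 * m * (p * u)) \<le> ennreal (m\<^sup>2 * p + p * u\<^sup>2)"
      by (intro ennreal_leI) (simp add: algebra_simps)
    then show "ennreal (2 * m) * ennreal (norm (of_real (poisson_kernel y (x - t)) * f (Complex t e))) \<le> ennreal (m\<^sup>2) * ennreal (poisson_kernel y (x - t)) + ennreal (poisson_kernel y (x - t)) * ennreal ((cmod (f (Complex t e)))\<^sup>2)"
      using p m by (simp add: norm_mult ennreal_mult' flip: p_def u_def)
  qed
  also have "\<dots> = ennreal (m\<^sup>2) + ?I"
    by (subst nn_integral_add) (simp_all add: nn_integral_cmult nn_integral_poisson_kernel[OF y])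
  finally have le: "ennreal (2 * m * m) \<le> ennreal (m\<^sup>2) + ?I" by (simp add: mult_left_mono)
  show ?thesis
  proof (cases ?I)
    case (real r)
    then have "ennreal (2 * m * m) \<le> ennreal (m\<^sup>2 + r)" using le by simp
    then have "2 * m * m \<le> m\<^sup>2 + r" using real by (subst (asm) ennreal_le_iff) auto
    then have "m\<^sup>2 \<le> r" by (simp add: power2_eq_square)
    then show ?thesis using real by (simp add: m_def)
  qed simp
qed

text \<open>Integrating \<open>H2_poisson_sq\<close> in \<open>x\<close> and exchanging the
  integrals leaves the mass of the kernel, which is 1.\<close>

lemma H2_l2sq_mono:
  assumes f: "f \<in> H2" and e: "e > 0" and y: "e \<le> y"
  shows "l2sq (\<lambda>x. f (Complex x y)) \<le> l2sq (\<lambda>x. f (Complex x e))"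
proof (cases "e = y")
  case False
  then have y': "y - e > 0" using y by simp
  note [measurable] = H2_measurable_line[OF f e]
  have "l2sq (\<lambda>x. f (Complex x y)) \<le> (\<integral>\<^sup>+ x. \<integral>\<^sup>+ t. ennreal (poisson_kernel (y - e) (x - t)) * ennreal ((cmod (f (Complex t e)))\<^sup>2) \<partial>lborel \<partial>lborel)"
    unfolding l2sq_def using H2_poisson_sq[OF f e y'] by (intro nn_integral_mono) simp
  also have "\<dots> = (\<integral>\<^sup>+ t. \<integral>\<^sup>+ x. ennreal (poisson_kernel (y - e) (x - t)) * ennreal ((cmod (f (Complex t e)))\<^sup>2) \<partial>lborel \<partial>lborel)"
    by (rule lborel_pair.Fubini') measurable
  also have "\<dots> = l2sq (\<lambda>x. f (Complex x e))"
    unfolding l2sq_def by (simp add: nn_integral_multc nn_integral_poisson_kernel'[OF y'])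
  finally show ?thesis .
qed simp

text \<open>Shifting the contour for \<open>f(w + \<i> y) cnj (f(cnj w + \<i> s))\<close> shows that the inner product of two lines depends
  only on \<open>y + s\<close>; this makes the lines a Cauchy family in \<open>L\<^sup>2\<close>.\<close>

lemma H2_inner_product_lines_aux:
  assumes f: "f \<in> H2" and y: "0 < y" "y \<le> s"
  shows "(LBINT x. f (Complex x y) * cnj (f (Complex x s))) =
         of_real (LBINT x. (cmod (f (Complex x ((y + s) / 2))))\<^sup>2)"
proof -
  obtain C where C: "C \<ge> 0" "\<And>y. y > 0 \<Longrightarrow> l2sq (\<lambda>x. f (Complex x y)) \<le> ennreal C" using H2_bound[OF f] by blast
  define S where "S = {w. Im w > - y} \<inter> {w. Im w < s}"
  define h where "h w = f (w + \<i> * of_real y) * cnj (f (cnj w + \<i> * of_real s))" for w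
  have S: "open S" "convex S" unfolding S_def
    by (auto intro: open_Int open_halfspace_Im_gt open_halfspace_Im_lt convex_Int convex_halfspace_Im_gt convex_halfspace_Im_lt)
  have "(\<lambda>w. f (w + \<i> * of_real s)) holomorphic_on cnj ` S"
    by (rule holomorphic_on_subset[OF holomorphic_on_upper_shift[OF H2_holomorphic[OF f]]]) (use y in \<open>auto simp: S_def\<close>)
  from holomorphic_on_compose_cnj_cnj[OF this S(1)]
  have "(\<lambda>w. cnj (f (cnj w + \<i> * of_real s))) holomorphic_on S" by (simp add: o_def)
  moreover have "(\<lambda>w. f (w + \<i> * of_real y)) holomorphic_on S"
    by (rule holomorphic_on_subset[OF holomorphic_on_upper_shift[OF H2_holomorphic[OF f]]]) (use y in \<open>auto simp: S_def\<close>)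
  ultimately have hol: "h holomorphic_on S" unfolding h_def by (intro holomorphic_intros)
  have h: "h (Complex x v) = f (Complex x (v + y)) * cnj (f (Complex x (s - v)))" for x v
  proof -
    have "cnj (Complex x v) + \<i> * of_real s = Complex x (s - v)" by (simp add: complex_eq_iff)
    then show ?thesis by (simp add: h_def Complex_add_imag)
  qed
  \<comment> \<open>At this height the lines \<open>v + y\<close> and \<open>s - v\<close> meet at
    \<open>(y + s) / 2\<close>, and the product becomes a squared modulus.\<close>
  have "(LBINT x. h (Complex x 0)) = (LBINT x. h (Complex x ((s - y) / 2)))"
  proof (rule strip_shift[OF hol S, where C="sqrt (C * C)"])
    fix v assume v: "v \<in> {0..(s - y) / 2}"
    then have v': "v + y > 0" "s - v > 0" using y by (auto simp: field_simps)
    note [measurable] = H2_measurable_line[OF f v'(1)] H2_measurable_line[OF f v'(2)]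
    show "(\<integral>\<^sup>+ x. ennreal (norm (h (Complex x v))) \<partial>lborel) \<le> ennreal (sqrt (C * C))"
      unfolding h using C v' l2_product_le[of "\<lambda>x. f (Complex x (v + y))" "\<lambda>x. cnj (f (Complex x (s - v)))" C C]
      by (simp add: l2sq_def)
  qed (use y in \<open>auto simp: S_def field_simps\<close>)
  also have "\<dots> = (LBINT x. of_real ((cmod (f (Complex x ((y + s) / 2))))\<^sup>2))"
  proof (rule Bochner_Integration.integral_cong[OF refl])
    fix x
    have "(s - y) / 2 + y = (y + s) / 2" "s - (s - y) / 2 = (y + s) / 2" by (auto simp: field_simps)
    then show "h (Complex x ((s - y) / 2)) = of_real ((cmod (f (Complex x ((y + s) / 2))))\<^sup>2)"
      unfolding h by (simp only: complex_norm_square)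
  qed
  also have "\<dots> = of_real (LBINT x. (cmod (f (Complex x ((y + s) / 2))))\<^sup>2)"
    by (rule integral_complex_of_real)
  finally show ?thesis by (simp only: h add_0 diff_zero)
qed

lemma H2_sq_integrable:
  assumes f: "f \<in> H2" and y: "0 < y"
  shows "integrable lborel (\<lambda>x. (cmod (f (Complex x y)))\<^sup>2)"
proof (rule integrableI_bounded)
  note [measurable] = H2_measurable_line[OF f y]
  show "(\<lambda>x. (cmod (f (Complex x y)))\<^sup>2) \<in> borel_measurable lborel" by measurable
  obtain C where "C \<ge> 0" "\<And>y. y > 0 \<Longrightarrow> l2sq (\<lambda>x. f (Complex x y)) \<le> ennreal C" using H2_bound[OF f] by blast
  then have "l2sq (\<lambda>x. f (Complex x y)) < \<infinity>" using y by (auto intro: order.strict_trans1[of _ "ennreal C"])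
  then show "(\<integral>\<^sup>+ x. ennreal (norm ((cmod (f (Complex x y)))\<^sup>2)) \<partial>lborel) < \<infinity>"
    by (simp add: l2sq_def)
qed

lemma l2_product_integrable:
  assumes [measurable]: "u \<in> borel_measurable borel" "v \<in> borel_measurable borel"
    and "l2sq u < \<infinity>" "l2sq v < \<infinity>"
  shows "integrable lborel (\<lambda>x. u x * v x)"
proof (rule integrableI_bounded)
  obtain a where a: "l2sq u = ennreal a" "a \<ge> 0" using assms(3) by (cases "l2sq u") auto
  obtain b where b: "l2sq v = ennreal b" "b \<ge> 0" using assms(4) by (cases "l2sq v") auto
  have "(\<integral>\<^sup>+ x. ennreal (cmod (u x * v x)) \<partial>lborel) \<le> ennreal (sqrt (a * b))"
    using a b by (intro l2_product_le) auto
  then show "(\<integral>\<^sup>+ x. ennreal (norm (u x * v x)) \<partial>lborel) < \<infinity>"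
    by (auto simp: less_top[symmetric] top_unique)
qed measurable

lemma H2_l2sq_finite: "f \<in> H2 \<Longrightarrow> y > 0 \<Longrightarrow> l2sq (\<lambda>x. f (Complex x y)) < \<infinity>"
  by (erule H2_bound) (auto intro: order.strict_trans1[OF _ ennreal_less_top])

text \<open>The cross term of the expanded square is an inner product of two lines, hence itself a
  value of \<open>N\<close>.\<close>

lemma H2_l2sq_diff_lines:
  assumes f: "f \<in> H2" and y: "0 < y" "0 < s"
  defines "N \<equiv> \<lambda>y. (LBINT x. (cmod (f (Complex x y)))\<^sup>2)"
  shows "l2sq (\<lambda>x. f (Complex x y) - f (Complex x s)) = ennreal (N y + N s - 2 * N ((y + s) / 2))"
proof -
  have ip: "(LBINT x. f (Complex x y) * cnj (f (Complex x s))) = of_real (N ((y + s) / 2))"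
  proof (cases "y \<le> s")
    case True
    then show ?thesis unfolding N_def by (rule H2_inner_product_lines_aux[OF f y(1)])
  next
    case False
    have "(LBINT x. f (Complex x y) * cnj (f (Complex x s))) = (LBINT x. cnj (f (Complex x s) * cnj (f (Complex x y))))"
      by (simp add: mult.commute)
    also have "\<dots> = cnj (LBINT x. f (Complex x s) * cnj (f (Complex x y)))"
      by (rule Bochner_Integration.integral_cnj)
    also have "\<dots> = cnj (of_real (N ((s + y) / 2)))"
      unfolding N_def using False y by (subst H2_inner_product_lines_aux[OF f y(2)]) auto
    finally show ?thesis by (simp add: add.commute)
  qed
  note [measurable] = H2_measurable_line[OF f y(1)] H2_measurable_line[OF f y(2)]
  have int: "integrable lborel (\<lambda>x. f (Complex x y) * cnj (f (Complex x s)))"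
    using H2_l2sq_finite[OF f] y by (intro l2_product_integrable) (auto simp: l2sq_def)
  have eq: "(cmod (a - b))\<^sup>2 = (cmod a)\<^sup>2 + (cmod b)\<^sup>2 - 2 * Re (a * cnj b)" for a b
    unfolding cmod_power2 by (simp add: power2_eq_square algebra_simps)
  have i: "integrable lborel (\<lambda>x. (cmod (f (Complex x y) - f (Complex x s)))\<^sup>2)"
    unfolding eq
    by (intro Bochner_Integration.integrable_diff Bochner_Integration.integrable_add integrable_mult_right integrable_Re int H2_sq_integrable f y)
  have "l2sq (\<lambda>x. f (Complex x y) - f (Complex x s)) = ennreal (LBINT x. (cmod (f (Complex x y) - f (Complex x s)))\<^sup>2)"
    unfolding l2sq_def using i by (intro nn_integral_eq_integral) auto
  also have "(LBINT x. (cmod (f (Complex x y) - f (Complex x s)))\<^sup>2) = N y + N s - 2 * Re (LBINT x. f (Complex x y) * cnj (f (Complex x s)))"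
    unfolding eq N_def
    using H2_sq_integrable[OF f y(1)] H2_sq_integrable[OF f y(2)] integrable_Re[OF int] integral_Re[OF int]
    by (simp only: Bochner_Integration.integral_diff Bochner_Integration.integral_add integrable_mult_right
        Bochner_Integration.integrable_add integral_mult_right_zero)
  finally show ?thesis unfolding ip by simp
qed

text \<open>\<open>N\<close> is bounded and decreases with the height, so below some
  \<open>r\<close> it lies within \<open>e / 2\<close> of its supremum; there
  \<open>N y + N s - 2 * N ((y + s) / 2)\<close> is at most \<open>e\<close>.\<close>

lemma H2_l2_Cauchy:
  assumes f: "f \<in> H2" and e: "(e::real) > 0"
  obtains \<delta> where "\<delta> > 0" "\<And>y s. 0 < y \<Longrightarrow> y < \<delta> \<Longrightarrow> 0 < s \<Longrightarrow> s < \<delta> \<Longrightarrow> l2sq (\<lambda>x. f (Complex x y) - f (Complex x s)) \<le> ennreal e"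
proof -
  obtain C where C: "C \<ge> 0" "\<And>y. y > 0 \<Longrightarrow> l2sq (\<lambda>x. f (Complex x y)) \<le> ennreal C" using H2_bound[OF f] by blast
  define N where "N y = (LBINT x. (cmod (f (Complex x y)))\<^sup>2)" for y
  have N: "l2sq (\<lambda>x. f (Complex x y)) = ennreal (N y)" if "y > 0" for y
    unfolding l2sq_def N_def using H2_sq_integrable[OF f that] by (intro nn_integral_eq_integral) auto
  have N0: "N y \<ge> 0" for y unfolding N_def by (intro Bochner_Integration.integral_nonneg) auto
  have NC: "N y \<le> C" if "y > 0" for y using C(2)[OF that] C(1) unfolding N[OF that] by simp
  have mono: "N s \<le> N y" if "0 < y" "y \<le> s" for y s
    using H2_l2sq_mono[OF f that] that N0 by (simp add: N)
  define L where "L = Sup (N ` {0<..})"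
  have bdd: "bdd_above (N ` {0<..})" using NC by (auto intro!: bdd_aboveI[of _ C])
  have up: "N y \<le> L" if "y > 0" for y unfolding L_def using that bdd by (intro cSup_upper) auto
  obtain r where r: "r > 0" "N r > L - e / 2"
    using less_cSupD[of "N ` {0<..}" "L - e/2"] e unfolding L_def by auto
  show ?thesis
  proof (rule that[OF r(1)])
    fix y s assume y: "0 < y" "y < r" "0 < s" "s < r"
    then have "N r \<le> N ((y + s) / 2)" by (intro mono) auto
    then have "N y + N s - 2 * N ((y + s) / 2) \<le> e" using up[of y] up[of s] y r by simp
    then show "l2sq (\<lambda>x. f (Complex x y) - f (Complex x s)) \<le> ennreal e"
      using H2_l2sq_diff_lines[OF f y(1,3)] by (simp add: N_def ennreal_leI)
  qed
qed

section \<open>Boundary values\<close>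

lemma poisson_kernel_dyadic_bound:
  assumes y: "y > 0"
  shows "ennreal (poisson_kernel y s) \<le> (\<Sum>k. ennreal ((4 / (pi * y)) * (1/4)^k) * indicator {- (2^k * y)..2^k * y} s)"
proof -
  have "\<exists>k. \<bar>s\<bar> \<le> 2^k * y"
  proof -
    obtain k where "\<bar>s\<bar> / y < 2^k" using real_arch_pow[of 2 "\<bar>s\<bar> / y"] by auto
    then show ?thesis using y by (intro exI[of _ k]) (simp add: field_simps)
  qed
  define k where "k = (LEAST k. \<bar>s\<bar> \<le> 2^k * y)"
  have k: "\<bar>s\<bar> \<le> 2^k * y" unfolding k_def by (rule LeastI_ex) fact
  have "poisson_kernel y s \<le> (4 / (pi * y)) * (1/4)^k"
  proof (cases k)
    case 0
    have "poisson_kernel y s \<le> y / (pi * y\<^sup>2)" unfolding poisson_kernel_def using y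
      by (intro divide_left_mono mult_left_mono mult_pos_pos) (auto intro: add_nonneg_pos)
    also have "\<dots> \<le> 4 / (pi * y)" using y by (simp add: power2_eq_square divide_simps)
    finally show ?thesis using 0 by simp
  next
    \<comment> \<open>Minimality of \<open>k\<close> gives \<open>\<bar>s\<bar> > 2^j * y\<close>
      with \<open>j = k - 1\<close>; the 4 in the constant makes up for this shift of the
      index.\<close>
    case (Suc j)
    have "\<not> \<bar>s\<bar> \<le> 2^j * y" using not_less_Least[of j "\<lambda>k. \<bar>s\<bar> \<le> 2^k * y"] Suc by (simp add: k_def)
    then have "(2^j * y)\<^sup>2 \<le> \<bar>s\<bar>\<^sup>2" using y by (intro power_mono) auto
    then have le: "4^j * y\<^sup>2 \<le> s\<^sup>2 + y\<^sup>2" by (simp add: power_mult_distrib power_mult[symmetric] mult.commute[of j] power_mult add_increasing2)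
    have "poisson_kernel y s \<le> y / (pi * (4^j * y\<^sup>2))" unfolding poisson_kernel_def using y le
      by (intro divide_left_mono mult_left_mono mult_pos_pos) (auto intro: add_nonneg_pos)
    also have "\<dots> = (4 / (pi * y)) * (1/4)^k" using y Suc by (simp add: power2_eq_square field_simps)
    finally show ?thesis .
  qed
  then have 1: "ennreal (poisson_kernel y s) \<le> ennreal ((4 / (pi * y)) * (1/4)^k) * indicator {- (2^k * y)..2^k * y} s"
    using k by (auto simp: indicator_def abs_le_iff intro!: ennreal_leI)
  define T :: "nat \<Rightarrow> ennreal" where "T k = ennreal ((4 / (pi * y)) * (1/4)^k) * indicator {- (2^k * y)..2^k * y} s" for k
  have "T k \<le> suminf T" using sum_le_suminf[OF summableI, of "{k}" T] by simp
  with 1 show ?thesis unfolding T_def by (rule order.trans)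
qed

text \<open>The kernel falls by a factor 4 whenever the interval doubles: layer \<open>k\<close>
  contributes at most \<open>(8 * A / pi) * (1/2)^k\<close>, in all \<open>16 * A / pi\<close>,
  which is below \<open>6 * A\<close>. So averages over centred intervals control Poisson
  integrals.\<close>

lemma poisson_le_of_averages:
  fixes \<phi> :: "real \<Rightarrow> ennreal"
  assumes [measurable]: "\<phi> \<in> borel_measurable borel" and y: "y > 0" and A: "A \<ge> 0"
    and avg: "\<And>R. R > 0 \<Longrightarrow> (\<integral>\<^sup>+ t. \<phi> t * indicator {x-R..x+R} t \<partial>lborel) \<le> ennreal (2 * R * A)"
  shows "(\<integral>\<^sup>+ t. ennreal (poisson_kernel y (x - t)) * \<phi> t \<partial>lborel) \<le> ennreal (6 * A)"
proof -
  define c where "c k = (4 / (pi * y)) * (1/4)^k" for k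
  have c: "c k \<ge> 0" for k using y by (simp add: c_def)
  have ind: "indicator {- (2^k * y)..2^k * y} (x - t) = (indicator {x - 2^k * y..x + 2^k*y} t :: ennreal)" for k t
    by (auto simp: indicator_def)
  have "(\<integral>\<^sup>+ t. ennreal (poisson_kernel y (x - t)) * \<phi> t \<partial>lborel) \<le> (\<integral>\<^sup>+ t. (\<Sum>k. ennreal (c k) * (\<phi> t * indicator {x - 2^k * y..x + 2^k*y} t)) \<partial>lborel)"
  proof (intro nn_integral_mono)
    fix t
    have "ennreal (poisson_kernel y (x - t)) * \<phi> t \<le> (\<Sum>k. ennreal (c k) * indicator {x - 2^k * y..x + 2^k*y} t) * \<phi> t"
      unfolding c_def using poisson_kernel_dyadic_bound[OF y, of "x - t"] by (intro mult_right_mono) (auto simp: ind)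
    also have "\<dots> = (\<Sum>k. ennreal (c k) * indicator {x - 2^k * y..x + 2^k*y} t * \<phi> t)"
      by (rule ennreal_suminf_multc[symmetric])
    finally show "ennreal (poisson_kernel y (x - t)) * \<phi> t \<le> (\<Sum>k. ennreal (c k) * (\<phi> t * indicator {x - 2^k * y..x + 2^k*y} t))"
      by (simp add: mult_ac)
  qed
  also have "\<dots> = (\<Sum>k. ennreal (c k) * (\<integral>\<^sup>+ t. \<phi> t * indicator {x - 2^k * y..x + 2^k*y} t \<partial>lborel))"
    by (subst nn_integral_suminf) (simp_all add: nn_integral_cmult)
  also have "\<dots> \<le> (\<Sum>k. ennreal (c k) * ennreal (2 * (2^k * y) * A))"
    using y by (intro suminf_le mult_left_mono avg) auto
  also have "\<dots> = (\<Sum>k. ennreal ((8 * A / pi) * (1/2)^k))"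
  proof (intro suminf_cong)
    fix k :: nat
    have "(2::real)^k * (1/4)^k = (1/2)^k" by (simp flip: power_mult_distrib)
    then have "c k * (2 * (2^k * y) * A) = (8 * A / pi) * (1/2)^k"
      unfolding c_def using y by (simp add: field_simps)
    then show "ennreal (c k) * ennreal (2 * (2^k * y) * A) = ennreal ((8 * A / pi) * (1/2)^k)"
      using c by (metis ennreal_mult')
  qed
  also have "\<dots> = ennreal (8 * A / pi * 2)"
  proof (rule suminf_ennreal_eq)
    show "(\<lambda>k. (8 * A / pi) * (1/2)^k) sums (8 * A / pi * 2)"
      using geometric_sums[of "1/2::real"] by (intro sums_mult) simp
  qed (use A in auto)
  also have "\<dots> \<le> ennreal (6 * A)"
  proof (intro ennreal_leI)
    have "16 * A \<le> 6 * pi * A" using pi_ge_two pi_gt3 A by (intro mult_right_mono) auto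
    then show "8 * A / pi * 2 \<le> 6 * A" by (simp add: field_simps)
  qed
  finally show ?thesis .
qed

text \<open>The Hardy-Littlewood weak type estimate. The intervals have half-length at most
  \<open>D / (2 * A)\<close> because the total mass is at most \<open>D\<close>, so Vitali's lemma
  picks disjoint ones whose fivefold enlargements cover \<open>E\<close>; an enlargement of length
  \<open>10 * R\<close> costs at most \<open>5 / A\<close> times the mass of its interval.\<close>

lemma averages_weak_type:
  fixes \<phi> :: "real \<Rightarrow> ennreal"
  assumes [measurable]: "\<phi> \<in> borel_measurable borel" and D: "(\<integral>\<^sup>+ t. \<phi> t \<partial>lborel) \<le> ennreal D" "D \<ge> 0"
    and A: "A > 0" and E[measurable]: "E \<in> sets borel"
    and avg: "\<And>x. x \<in> E \<Longrightarrow> \<exists>R>0. ennreal (2 * R * A) < (\<integral>\<^sup>+ t. \<phi> t * indicator {x-R..x+R} t \<partial>lborel)"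
  shows "emeasure lborel E \<le> ennreal (5 * D / A)"
proof -
  obtain R where R: "\<And>x. x \<in> E \<Longrightarrow> R x > 0" "\<And>x. x \<in> E \<Longrightarrow> ennreal (2 * R x * A) < (\<integral>\<^sup>+ t. \<phi> t * indicator {x-R x..x+R x} t \<partial>lborel)"
    using avg by metis
  have cb: "cball x r = {x-r..x+r}" for x r :: real by (auto simp: dist_real_def)
  have RD: "R x \<le> D / (2 * A)" if "x \<in> E" for x
  proof -
    have "ennreal (2 * R x * A) \<le> (\<integral>\<^sup>+ t. \<phi> t * indicator {x-R x..x+R x} t \<partial>lborel)" using R(2)[OF that] by simp
    also have "\<dots> \<le> (\<integral>\<^sup>+ t. \<phi> t \<partial>lborel)" by (intro nn_integral_mono) (auto simp: indicator_def)
    also have "\<dots> \<le> ennreal D" by fact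
    finally have "2 * R x * A \<le> D" using D by (subst (asm) ennreal_le_iff) auto
    then show ?thesis using A by (simp add: field_simps)
  qed
  obtain C where C: "countable C" "C \<subseteq> E" "pairwise (\<lambda>i j. disjnt (cball i (R i)) (cball j (R j))) C"
    "E \<subseteq> (\<Union>i\<in>C. cball i (5 * R i))"
    using Vitali_covering_lemma_cballs[where S=E and K=E and a="\<lambda>i. i" and r=R and B="D / (2 * A)"] R(1) RD
    by (metis (no_types, lifting) UN_I centre_in_cball order_less_imp_le subsetI)
  have Cpos: "R i > 0" if "i \<in> C" for i using that C(2) R(1) by auto
  \<comment> \<open>Disjointness is used through countable additivity of this measure.\<close>
  define M where "M = density lborel \<phi>"
  have "emeasure lborel E = (\<integral>\<^sup>+ x. indicator E x \<partial>lborel)" by simp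
  also have "\<dots> \<le> (\<integral>\<^sup>+ x. \<integral>\<^sup>+ i. indicator (cball i (5 * R i)) x \<partial>count_space C \<partial>lborel)"
  proof (intro nn_integral_mono)
    fix x
    show "indicator E x \<le> (\<integral>\<^sup>+ i. indicator (cball i (5 * R i)) x \<partial>count_space C :: ennreal)"
    proof (cases "x \<in> E")
      case True
      then obtain i where i: "i \<in> C" "x \<in> cball i (5 * R i)" using C(4) by auto
      have "indicator (cball i (5 * R i)) x \<le> (\<integral>\<^sup>+ i. indicator (cball i (5 * R i)) x \<partial>count_space C :: ennreal)"
        using i by (intro nn_integral_ge_point) auto
      then show ?thesis using i True by (auto simp: indicator_def)
    qed auto
  qed
  also have "\<dots> = (\<integral>\<^sup>+ i. \<integral>\<^sup>+ x. indicator (cball i (5 * R i)) x \<partial>lborel \<partial>count_space C)"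
    using C(1) by (rule nn_integral_count_space_nn_integral) (auto intro!: borel_measurable_indicator)
  also have "\<dots> \<le> (\<integral>\<^sup>+ i. ennreal (5 / A) * emeasure M (cball i (R i)) \<partial>count_space C)"
  proof (intro nn_integral_mono)
    fix i assume "i \<in> space (count_space C)"
    then have i: "i \<in> C" by simp
    have "(\<integral>\<^sup>+ x. indicator (cball i (5 * R i)) x \<partial>lborel) = ennreal (10 * R i)"
      using Cpos[OF i] by (simp add: cb)
    also have "\<dots> = ennreal (5 / A) * ennreal (2 * R i * A)"
      using A Cpos[OF i] by (subst ennreal_mult[symmetric]) (auto simp: field_simps)
    also have "\<dots> \<le> ennreal (5 / A) * emeasure M (cball i (R i))"
      using R(2)[of i] i C(2) by (intro mult_left_mono) (auto simp: M_def emeasure_density cb)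
    finally show "(\<integral>\<^sup>+ x. indicator (cball i (5 * R i)) x \<partial>lborel) \<le> ennreal (5 / A) * emeasure M (cball i (R i))" .
  qed
  also have "\<dots> = ennreal (5 / A) * (\<integral>\<^sup>+ i. emeasure M (cball i (R i)) \<partial>count_space C)"
    by (rule nn_integral_cmult) simp
  also have "(\<integral>\<^sup>+ i. emeasure M (cball i (R i)) \<partial>count_space C) = emeasure M (\<Union>i\<in>C. cball i (R i))"
    using C(1,3) by (intro emeasure_UN_countable[symmetric])
      (auto simp: M_def disjoint_family_on_def pairwise_def disjnt_def)
  also have "\<dots> \<le> emeasure M (space M)" by (rule emeasure_space)
  also have "\<dots> \<le> ennreal D" using D by (simp add: M_def emeasure_density)
  also have "ennreal (5 / A) * ennreal D = ennreal (5 * D / A)" using A D by (simp flip: ennreal_mult)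
  finally show ?thesis by (simp add: mult_left_mono)
qed

text \<open>Openness makes the maximal set measurable although the heights range over an uncountable
  set.\<close>

lemma H2_maximal_open:
  assumes "g \<in> H2" "\<eta> \<ge> 0"
  shows "open {x. \<exists>y>\<eta>. \<kappa> < cmod (g (Complex x y))}"
proof -
  have "{x. \<exists>y>\<eta>. \<kappa> < cmod (g (Complex x y))} = (\<Union>y\<in>{\<eta><..}. {x. \<kappa> < cmod (g (Complex x y))})" by auto
  moreover have "open {x. \<kappa> < cmod (g (Complex x y))}" if "y \<in> {\<eta><..}" for y
    using assms that by (intro open_Collect_less continuous_intros H2_continuous_line) auto
  ultimately show ?thesis by auto
qed

text \<open>Where all centred averages of the squared modulus are at most
  \<open>\<kappa>\<^sup>2 / 6\<close>, \<open>H2_poisson_sq\<close> and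
  \<open>poisson_le_of_averages\<close> bound the squared modulus by \<open>\<kappa>\<^sup>2\<close>
  at every height. The constant is \<open>5 * 6 = 30\<close>.\<close>

lemma H2_maximal_above:
  assumes g: "g \<in> H2" and \<eta>: "\<eta> > 0" and e: "l2sq (\<lambda>x. g (Complex x \<eta>)) \<le> ennreal e" "e \<ge> 0" and l: "\<kappa> > 0"
  shows "emeasure lborel {x. \<exists>y>\<eta>. \<kappa> < cmod (g (Complex x y))} \<le> ennreal (30 * e / \<kappa>\<^sup>2)"
proof -
  note [measurable] = H2_measurable_line[OF g \<eta>]
  have "emeasure lborel {x. \<exists>y>\<eta>. \<kappa> < cmod (g (Complex x y))} \<le> ennreal (5 * e / (\<kappa>\<^sup>2 / 6))"
  proof (rule averages_weak_type)
    show "(\<lambda>t. ennreal ((cmod (g (Complex t \<eta>)))\<^sup>2)) \<in> borel_measurable borel" by measurable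
    show "(\<integral>\<^sup>+ t. ennreal ((cmod (g (Complex t \<eta>)))\<^sup>2) \<partial>lborel) \<le> ennreal e" using e by (simp add: l2sq_def)
    show "{x. \<exists>y>\<eta>. \<kappa> < cmod (g (Complex x y))} \<in> sets borel"
      using H2_maximal_open[OF g, of \<eta>] \<eta> by auto
    fix x assume "x \<in> {x. \<exists>y>\<eta>. \<kappa> < cmod (g (Complex x y))}"
    then obtain y where y: "y > \<eta>" "\<kappa> < cmod (g (Complex x y))" by auto
    show "\<exists>R>0. ennreal (2 * R * (\<kappa>\<^sup>2 / 6)) < (\<integral>\<^sup>+ t. ennreal ((cmod (g (Complex t \<eta>)))\<^sup>2) * indicator {x-R..x+R} t \<partial>lborel)"
    proof (rule ccontr)
      assume neg: "\<not> ?thesis"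
      have avg: "(\<integral>\<^sup>+ t. ennreal ((cmod (g (Complex t \<eta>)))\<^sup>2) * indicator {x-R..x+R} t \<partial>lborel) \<le> ennreal (2 * R * (\<kappa>\<^sup>2 / 6))" if "R > 0" for R
        using neg that by (meson not_le)
      then have "(\<integral>\<^sup>+ t. ennreal (poisson_kernel (y - \<eta>) (x - t)) * ennreal ((cmod (g (Complex t \<eta>)))\<^sup>2) \<partial>lborel) \<le> ennreal (6 * (\<kappa>\<^sup>2 / 6))"
        using y l by (intro poisson_le_of_averages avg) auto
      moreover have "ennreal ((cmod (g (Complex x y)))\<^sup>2) \<le> (\<integral>\<^sup>+ t. ennreal (poisson_kernel (y - \<eta>) (x - t)) * ennreal ((cmod (g (Complex t \<eta>)))\<^sup>2) \<partial>lborel)"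
        using H2_poisson_sq[OF g \<eta>, of "y - \<eta>" x] y by simp
      ultimately have "ennreal ((cmod (g (Complex x y)))\<^sup>2) \<le> ennreal (6 * (\<kappa>\<^sup>2 / 6))"
        by (rule order.trans[rotated])
      then have "(cmod (g (Complex x y)))\<^sup>2 \<le> 6 * (\<kappa>\<^sup>2 / 6)" by (subst (asm) ennreal_le_iff) auto
      then have "(cmod (g (Complex x y)))\<^sup>2 \<le> \<kappa>\<^sup>2" by simp
      then have "cmod (g (Complex x y)) \<le> \<kappa>" by (rule power2_le_imp_le) (use l in simp)
      then show False using y(2) by simp
    qed
  qed (use e l in auto)
  then show ?thesis by (simp add: field_simps)
qed

lemma H2_maximal:
  assumes g: "g \<in> H2" and \<delta>: "\<delta> > 0" and e: "\<And>\<eta>. 0 < \<eta> \<Longrightarrow> \<eta> < \<delta> \<Longrightarrow> l2sq (\<lambda>x. g (Complex x \<eta>)) \<le> ennreal e" "e \<ge> 0" and l: "\<kappa> > 0"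
  shows "emeasure lborel {x. \<exists>y>0. \<kappa> < cmod (g (Complex x y))} \<le> ennreal (30 * e / \<kappa>\<^sup>2)"
proof -
  \<comment> \<open>The heights decrease to 0, and the offset 2 keeps them strictly below
    \<open>\<delta>\<close>, where the norm bound holds.\<close>
  define A where "A n = {x. \<exists>y>\<delta> / (real n + 2). \<kappa> < cmod (g (Complex x y))}" for n
  have eq: "{x. \<exists>y>0. \<kappa> < cmod (g (Complex x y))} = (\<Union>n. A n)"
  proof safe
    fix x y assume y: "y > 0" "\<kappa> < cmod (g (Complex x y))"
    obtain n where n: "\<delta> / y < real n" using reals_Archimedean2 by blast
    then have "\<delta> < y * (real n + 2)" using y(1) \<delta> by (simp add: field_simps)
    then have "\<delta> / (real n + 2) < y" by (simp add: pos_divide_less_eq)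
    then show "x \<in> (\<Union>n. A n)" using y by (auto simp: A_def)
  next
    fix x n assume "x \<in> A n"
    moreover have "\<delta> / (real n + 2) > 0" using \<delta> by simp
    ultimately show "\<exists>y>0. \<kappa> < cmod (g (Complex x y))" unfolding A_def using order_less_trans by blast
  qed
  have sets: "A n \<in> sets lborel" for n
    unfolding A_def using H2_maximal_open[OF g, of "\<delta> / (real n + 2)" \<kappa>] \<delta> by auto
  have "incseq A"
  proof (rule incseq_SucI, safe)
    fix n x assume "x \<in> A n"
    moreover have "\<delta> / (real (Suc n) + 2) \<le> \<delta> / (real n + 2)" using \<delta> by (intro divide_left_mono) auto
    ultimately show "x \<in> A (Suc n)" unfolding A_def by (auto intro: order_le_less_trans)
  qed
  then have "emeasure lborel (\<Union>n. A n) = (SUP n. emeasure lborel (A n))"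
    using sets by (intro SUP_emeasure_incseq[symmetric]) auto
  also have "\<dots> \<le> ennreal (30 * e / \<kappa>\<^sup>2)"
  proof (intro SUP_least)
    fix n
    have "\<delta> / (real n + 2) < \<delta> / 1" using \<delta> by (intro divide_strict_left_mono) auto
    moreover have "\<delta> / (real n + 2) > 0" using \<delta> by simp
    ultimately show "emeasure lborel (A n) \<le> ennreal (30 * e / \<kappa>\<^sup>2)"
      unfolding A_def by (intro H2_maximal_above g e l) auto
  qed
  finally show ?thesis unfolding eq .
qed

lemma H2_shift:
  assumes "f \<in> H2" "e \<ge> 0" shows "(\<lambda>z. f (z + \<i> * of_real e)) \<in> H2"
proof -
  obtain C where C: "C \<ge> 0" "\<And>y. y > 0 \<Longrightarrow> l2sq (\<lambda>x. f (Complex x y)) \<le> ennreal C" using H2_bound[OF assms(1)] by blast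
  show ?thesis
  proof (rule H2_I)
    show "(\<lambda>z. f (z + \<i> * of_real e)) holomorphic_on upper_half"
      by (rule holomorphic_on_subset[OF holomorphic_on_upper_shift[OF H2_holomorphic]])
         (use assms in \<open>auto simp: upper_half_def\<close>)
    show "l2sq (\<lambda>x. f (Complex x y + \<i> * of_real e)) \<le> ennreal C" if "y > 0" for y
      unfolding Complex_add_imag using C(2)[of "y + e"] assms that by simp
  qed
qed

lemma H2_diff:
  assumes f: "f \<in> H2" and g: "g \<in> H2" shows "(\<lambda>z. f z - g z) \<in> H2"
proof -
  obtain C where C: "C \<ge> 0" "\<And>y. y > 0 \<Longrightarrow> l2sq (\<lambda>x. f (Complex x y)) \<le> ennreal C" using H2_bound[OF f] by blast
  obtain D where D: "D \<ge> 0" "\<And>y. y > 0 \<Longrightarrow> l2sq (\<lambda>x. g (Complex x y)) \<le> ennreal D" using H2_bound[OF g] by blast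
  show ?thesis
  proof (rule H2_I)
    show "(\<lambda>z. f z - g z) holomorphic_on upper_half" using assms by (intro holomorphic_intros H2_holomorphic)
    fix y :: real assume y: "y > 0"
    have "l2sq (\<lambda>x. f (Complex x y) - g (Complex x y)) \<le> 2 * l2sq (\<lambda>x. f (Complex x y)) + 2 * l2sq (\<lambda>x. g (Complex x y))"
      using assms y by (intro l2sq_diff_le H2_measurable_line)
    also have "\<dots> \<le> 2 * ennreal C + 2 * ennreal D" by (intro add_mono mult_left_mono C D y) auto
    also have "\<dots> = ennreal (2 * C + 2 * D)" using C D by (simp add: ennreal_mult)
    finally show "l2sq (\<lambda>x. f (Complex x y) - g (Complex x y)) \<le> ennreal (2 * C + 2 * D)" .
  qed
qed

text \<open>The maximal inequality is applied to \<open>f(z) - f(z + \<i> \<delta>/2)\<close>, which is small in \<open>L\<^sup>2\<close> near the real line and has the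
  same oscillation there as \<open>f\<close>.\<close>

lemma H2_oscillation_null:
  assumes f: "f \<in> H2" and c: "(c::real) > 0"
  shows "AE x in lborel. \<exists>\<delta>>0. \<forall>y s. 0 < y \<longrightarrow> y < \<delta> \<longrightarrow> 0 < s \<longrightarrow> s < \<delta> \<longrightarrow> cmod (f (Complex x y) - f (Complex x s)) \<le> c"
proof -
  define bad where "bad = {x. \<not> (\<exists>\<delta>>0. \<forall>y s. 0 < y \<longrightarrow> y < \<delta> \<longrightarrow> 0 < s \<longrightarrow> s < \<delta> \<longrightarrow> cmod (f (Complex x y) - f (Complex x s)) \<le> c)}"
  have cover: "\<exists>G\<in>sets borel. bad \<subseteq> G \<and> emeasure lborel G \<le> ennreal (480 * e / c\<^sup>2)" if e: "e > 0" for e :: real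
  proof -
    obtain \<delta> where \<delta>: "\<delta> > 0" "\<And>y s. 0 < y \<Longrightarrow> y < \<delta> \<Longrightarrow> 0 < s \<Longrightarrow> s < \<delta> \<Longrightarrow> l2sq (\<lambda>x. f (Complex x y) - f (Complex x s)) \<le> ennreal e"
      using H2_l2_Cauchy[OF f e] by blast
    define g where "g z = f z - f (z + \<i> * of_real (\<delta>/2))" for z
    have g: "g \<in> H2" unfolding g_def using \<delta>(1) by (intro H2_diff H2_shift f) auto
    \<comment> \<open>The oscillation of \<open>f\<close> splits into four terms, hence the level
      \<open>c/4\<close> and \<open>480 = 30 * 16\<close>: two values of \<open>g\<close>, and two
      increments of the shifted function, which is continuous down to height 0.\<close>
    define G where "G = {x. \<exists>y>0. c/4 < cmod (g (Complex x y))}"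
    have "emeasure lborel G \<le> ennreal (30 * e / (c/4)\<^sup>2)"
      unfolding G_def
    proof (rule H2_maximal[OF g, of "\<delta>/2"])
      fix \<eta> assume "0 < \<eta>" "\<eta> < \<delta>/2"
      then show "l2sq (\<lambda>x. g (Complex x \<eta>)) \<le> ennreal e"
        unfolding g_def Complex_add_imag using \<delta>(1) by (intro \<delta>(2)) auto
    qed (use e c \<delta> in auto)
    moreover have "G \<in> sets borel" unfolding G_def by (intro borel_open H2_maximal_open[OF g]) simp
    moreover have "bad \<subseteq> G"
    proof
      fix x assume x: "x \<in> bad"
      have "isCont f (Complex x (\<delta>/2))"
        using H2_holomorphic[OF f] \<delta>(1)
        by (intro continuous_on_interior[OF holomorphic_on_imp_continuous_on])
           (auto simp: upper_half_def interior_open open_halfspace_Im_gt)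
      moreover have "isCont (\<lambda>y. Complex x (y + \<delta>/2)) 0" unfolding Complex_eq by (intro continuous_intros)
      ultimately have "isCont (\<lambda>y. f (Complex x (y + \<delta>/2))) 0"
        using isCont_o2[of 0 "\<lambda>y. Complex x (y + \<delta>/2)" f] by simp
      then have "\<exists>r>0. \<forall>y. dist y 0 < r \<longrightarrow> dist (f (Complex x (y + \<delta>/2))) (f (Complex x (0 + \<delta>/2))) < c/4"
        unfolding continuous_at_eps_delta by (rule allE[where x="c/4"]) (use c in simp)
      then obtain r where r: "r > 0" "\<And>y. \<bar>y\<bar> < r \<Longrightarrow> cmod (f (Complex x (y + \<delta>/2)) - f (Complex x (\<delta>/2))) < c/4"
        unfolding dist_norm by auto
      obtain y s where ys: "0 < y" "y < r" "0 < s" "s < r" "cmod (f (Complex x y) - f (Complex x s)) > c"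
        using x r(1) unfolding bad_def by (auto simp: not_le)
      have "f (Complex x y) - f (Complex x s) = g (Complex x y) - g (Complex x s) +
         ((f (Complex x (y + \<delta>/2)) - f (Complex x (\<delta>/2))) - (f (Complex x (s + \<delta>/2)) - f (Complex x (\<delta>/2))))"
        unfolding g_def Complex_add_imag by simp
      then have "cmod (f (Complex x y) - f (Complex x s)) \<le> cmod (g (Complex x y) - g (Complex x s)) +
         cmod ((f (Complex x (y + \<delta>/2)) - f (Complex x (\<delta>/2))) - (f (Complex x (s + \<delta>/2)) - f (Complex x (\<delta>/2))))"
        by (simp add: norm_triangle_ineq)
      also have "\<dots> \<le> (cmod (g (Complex x y)) + cmod (g (Complex x s))) + (cmod (f (Complex x (y + \<delta>/2)) - f (Complex x (\<delta>/2))) + cmod (f (Complex x (s + \<delta>/2)) - f (Complex x (\<delta>/2))))"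
        by (intro add_mono norm_triangle_ineq4)
      finally have "c/4 < cmod (g (Complex x y)) \<or> c/4 < cmod (g (Complex x s))"
        using ys r(2)[of y] r(2)[of s] by linarith
      then show "x \<in> G" using ys unfolding G_def by auto
    qed
    moreover have "30 * e / (c/4)\<^sup>2 = 480 * e / c\<^sup>2" by (simp add: power2_eq_square)
    ultimately show ?thesis by auto
  qed
  have "\<forall>n. \<exists>G\<in>sets borel. bad \<subseteq> G \<and> emeasure lborel G \<le> ennreal (480 * (1 / real (Suc n)) / c\<^sup>2)"
    by (intro allI cover) simp
  then obtain G where G: "\<And>n. G n \<in> sets borel" "\<And>n. bad \<subseteq> G n" "\<And>n. emeasure lborel (G n) \<le> ennreal (480 * (1 / real (Suc n)) / c\<^sup>2)"
    by metis
  have sets: "(\<Inter>n. G n) \<in> sets lborel" using G(1) by auto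
  have "emeasure lborel (\<Inter>n. G n) \<le> 0"
  proof (rule tendsto_lowerbound)
    show "(\<lambda>n. ennreal (480 * (1 / real (Suc n)) / c\<^sup>2)) \<longlonglongrightarrow> 0"
      unfolding ennreal_0[symmetric] by (intro tendsto_ennrealI) (use c in real_asymp)
    show "\<forall>\<^sub>F n in sequentially. emeasure lborel (\<Inter>n. G n) \<le> ennreal (480 * (1 / real (Suc n)) / c\<^sup>2)"
    proof (intro always_eventually allI)
      fix n
      have "emeasure lborel (\<Inter>n. G n) \<le> emeasure lborel (G n)" using G(1) by (intro emeasure_mono) auto
      then show "emeasure lborel (\<Inter>n. G n) \<le> ennreal (480 * (1 / real (Suc n)) / c\<^sup>2)" using G(3)[of n] by simp
    qed
  qed simp
  then have "(\<Inter>n. G n) \<in> null_sets lborel" using sets by (simp add: null_sets_def)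
  then show ?thesis by (rule AE_I') (use G(2) in \<open>auto simp: bad_def\<close>)
qed

lemma tendsto_at_right_of_oscillation:
  fixes u :: "real \<Rightarrow> complex"
  assumes osc: "\<And>c::real. c > 0 \<Longrightarrow> \<exists>\<delta>>0. \<forall>y s. 0 < y \<longrightarrow> y < \<delta> \<longrightarrow> 0 < s \<longrightarrow> s < \<delta> \<longrightarrow> cmod (u y - u s) \<le> c"
  shows "\<exists>l. (u \<longlongrightarrow> l) (at_right 0)"
proof -
  define X where "X n = u (1 / real (Suc n))" for n
  have small: "\<exists>N. \<forall>n\<ge>N. 1 / real (Suc n) < \<delta>" if "\<delta> > 0" for \<delta> :: real
  proof -
    have "(\<lambda>n. 1 / real (Suc n)) \<longlonglongrightarrow> 0" by real_asymp
    then have "\<forall>\<^sub>F n in sequentially. 1 / real (Suc n) < \<delta>" using that by (rule order_tendstoD(2))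
    then show ?thesis by (simp add: eventually_sequentially)
  qed
  have "Cauchy X"
  proof (rule metric_CauchyI)
    fix e :: real assume e: "e > 0"
    obtain \<delta> where \<delta>: "\<delta> > 0" "\<And>y s. 0 < y \<Longrightarrow> y < \<delta> \<Longrightarrow> 0 < s \<Longrightarrow> s < \<delta> \<Longrightarrow> cmod (u y - u s) \<le> e/2"
      using osc[of "e/2"] e by auto
    obtain N where "\<forall>n\<ge>N. 1 / real (Suc n) < \<delta>" using small[OF \<delta>(1)] by blast
    then have "\<forall>m\<ge>N. \<forall>n\<ge>N. dist (X m) (X n) \<le> e/2"
      unfolding X_def dist_norm by (intro allI impI \<delta>(2)) auto
    then show "\<exists>M. \<forall>m\<ge>M. \<forall>n\<ge>M. dist (X m) (X n) < e"
      using e by (intro exI[of _ N]) force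
  qed
  then obtain l where l: "X \<longlonglongrightarrow> l" using Cauchy_convergent convergent_def by blast
  have "(u \<longlongrightarrow> l) (at_right 0)"
  proof (rule tendstoI)
    fix e :: real assume e: "e > 0"
    obtain \<delta> where \<delta>: "\<delta> > 0" "\<And>y s. 0 < y \<Longrightarrow> y < \<delta> \<Longrightarrow> 0 < s \<Longrightarrow> s < \<delta> \<Longrightarrow> cmod (u y - u s) \<le> e/2"
      using osc[of "e/2"] e by auto
    obtain N where N: "\<forall>n\<ge>N. 1 / real (Suc n) < \<delta>" using small[OF \<delta>(1)] by blast
    have "dist (u y) l < e" if "0 < y" "y < \<delta>" for y
    proof -
      have "(\<lambda>n. cmod (u y - X n)) \<longlonglongrightarrow> cmod (u y - l)" by (intro tendsto_intros l)
      moreover have "\<forall>\<^sub>F n in sequentially. cmod (u y - X n) \<le> e/2"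
        unfolding eventually_sequentially X_def using N that by (intro exI[of _ N] allI impI \<delta>(2)) auto
      ultimately have "cmod (u y - l) \<le> e/2" by (rule tendsto_upperbound) simp
      then show ?thesis using e by (simp add: dist_norm)
    qed
    then show "\<forall>\<^sub>F y in at_right 0. dist (u y) l < e"
      using \<delta>(1) unfolding eventually_at_right_field by auto
  qed
  then show ?thesis ..
qed

text \<open>Oscillation at most \<open>1 / real (Suc n)\<close> for all \<open>n\<close> at once is
  a countable condition, so almost every point satisfies it. From here on \<open>bv\<close> is a
  true limit a.e. for functions of \<open>H2\<close>.\<close>

lemma H2_Fatou:
  assumes f: "f \<in> H2"
  shows "AE x in lborel. \<exists>l. ((\<lambda>y. f (Complex x y)) \<longlongrightarrow> l) (at_right 0)"
proof -
  have "AE x in lborel. \<forall>n::nat. \<exists>\<delta>>0. \<forall>y s. 0 < y \<longrightarrow> y < \<delta> \<longrightarrow> 0 < s \<longrightarrow> s < \<delta> \<longrightarrow> cmod (f (Complex x y) - f (Complex x s)) \<le> 1 / real (Suc n)"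
    unfolding AE_all_countable by (intro allI H2_oscillation_null f) simp
  then show ?thesis
  proof eventually_elim
    case (elim x)
    show ?case
    proof (rule tendsto_at_right_of_oscillation)
      fix c :: real assume "c > 0"
      then obtain n where "1 / real (Suc n) < c" using nat_approx_posE by metis
      then show "\<exists>\<delta>>0. \<forall>y s. 0 < y \<longrightarrow> y < \<delta> \<longrightarrow> 0 < s \<longrightarrow> s < \<delta> \<longrightarrow> cmod (f (Complex x y) - f (Complex x s)) \<le> c"
        using elim[rule_format, of n] by (meson order_less_imp_le order_trans)
    qed
  qed
qed

section \<open>Boundary functions\<close>

definition H2_trace :: "(complex \<Rightarrow> complex) \<Rightarrow> (real \<Rightarrow> complex) \<Rightarrow> bool" where
  "H2_trace f F \<longleftrightarrow> F \<in> borel_measurable borel \<and>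
     (AE x in lborel. ((\<lambda>y. f (Complex x y)) \<longlongrightarrow> F x) (at_right 0))"

text \<open>The limit along the heights \<open>1 / real (Suc n)\<close> is Borel measurable
  everywhere and agrees with the vertical limit wherever that exists.\<close>

lemma H2_trace_exists:
  assumes f: "f \<in> H2" shows "\<exists>F. H2_trace f F"
proof -
  define F where "F x = lim (\<lambda>n. f (Complex x (1 / real (Suc n))))" for x
  have "F \<in> borel_measurable borel"
    unfolding F_def by (intro borel_measurable_lim_metric H2_measurable_line f) auto
  moreover have "AE x in lborel. ((\<lambda>y. f (Complex x y)) \<longlongrightarrow> F x) (at_right 0)"
    using H2_Fatou[OF f]
  proof eventually_elim
    case (elim x)
    then obtain l where l: "((\<lambda>y. f (Complex x y)) \<longlongrightarrow> l) (at_right 0)" by auto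
    have "filterlim (\<lambda>n. 1 / real (Suc n)) (at_right 0) sequentially" by real_asymp
    from filterlim_compose[OF l this] have "F x = l" unfolding F_def by (rule limI)
    then show ?case using l by simp
  qed
  ultimately show ?thesis unfolding H2_trace_def by blast
qed

lemma H2_trace_bv:
  assumes "H2_trace f F" shows "AE x in lborel. bv f x = F x"
proof -
  have "AE x in lborel. ((\<lambda>y. f (Complex x y)) \<longlongrightarrow> F x) (at_right 0)" using assms by (simp add: H2_trace_def)
  then show ?thesis
    by eventually_elim (auto simp: bv_def intro!: tendsto_Lim)
qed

lemma H2_trace_measurable: "H2_trace f F \<Longrightarrow> F \<in> borel_measurable borel"
  by (simp add: H2_trace_def)

text \<open>Fatou's lemma lets the lower line in \<open>H2_l2_Cauchy\<close> descend to the
  boundary.\<close>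

lemma H2_trace_L2_conv:
  assumes f: "f \<in> H2" and F: "H2_trace f F" and e: "(e::real) > 0"
  obtains \<delta> where "\<delta> > 0" "\<And>y. 0 < y \<Longrightarrow> y < \<delta> \<Longrightarrow> l2sq (\<lambda>x. f (Complex x y) - F x) \<le> ennreal e"
proof -
  note [measurable] = H2_trace_measurable[OF F]
  obtain \<delta> where \<delta>: "\<delta> > 0" "\<And>y s. 0 < y \<Longrightarrow> y < \<delta> \<Longrightarrow> 0 < s \<Longrightarrow> s < \<delta> \<Longrightarrow> l2sq (\<lambda>x. f (Complex x y) - f (Complex x s)) \<le> ennreal e"
    using H2_l2_Cauchy[OF f e] by blast
  have "l2sq (\<lambda>x. f (Complex x y) - F x) \<le> ennreal e" if y: "0 < y" "y < \<delta>" for y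
  proof -
    define u where "u n x = ennreal ((cmod (f (Complex x y) - f (Complex x (1 / real (Suc n)))))\<^sup>2)" for n x
    have [measurable]: "(\<lambda>x. f (Complex x (1 / real (Suc n)))) \<in> borel_measurable borel" for n
      by (rule H2_measurable_line[OF f]) simp
    note [measurable] = H2_measurable_line[OF f y(1)]
    have "AE x in lborel. ((\<lambda>y. f (Complex x y)) \<longlongrightarrow> F x) (at_right 0)" using F by (simp add: H2_trace_def)
    then have "AE x in lborel. ennreal ((cmod (f (Complex x y) - F x))\<^sup>2) \<le> liminf (\<lambda>n. u n x)"
    proof eventually_elim
      case (elim x)
      have "filterlim (\<lambda>n. 1 / real (Suc n)) (at_right 0) sequentially" by real_asymp
      from filterlim_compose[OF elim this]
      have "(\<lambda>n. u n x) \<longlonglongrightarrow> ennreal ((cmod (f (Complex x y) - F x))\<^sup>2)"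
        unfolding u_def by (intro tendsto_ennrealI tendsto_intros)
      from lim_imp_Liminf[OF _ this] show ?case by simp
    qed
    then have "l2sq (\<lambda>x. f (Complex x y) - F x) \<le> (\<integral>\<^sup>+ x. liminf (\<lambda>n. u n x) \<partial>lborel)"
      unfolding l2sq_def by (rule nn_integral_mono_AE)
    also have "\<dots> \<le> liminf (\<lambda>n. \<integral>\<^sup>+ x. u n x \<partial>lborel)"
      by (rule nn_integral_liminf) (unfold u_def, measurable)
    also have "\<dots> \<le> limsup (\<lambda>n. \<integral>\<^sup>+ x. u n x \<partial>lborel)" by (rule Liminf_le_Limsup) simp
    also have "\<dots> \<le> ennreal e"
    proof (rule Limsup_bounded)
      have "(\<lambda>n. 1 / real (Suc n)) \<longlonglongrightarrow> 0" by real_asymp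
      then have "\<forall>\<^sub>F n in sequentially. 1 / real (Suc n) < \<delta>" using \<delta>(1) by (rule order_tendstoD(2))
      then show "\<forall>\<^sub>F n in sequentially. (\<integral>\<^sup>+ x. u n x \<partial>lborel) \<le> ennreal e"
        by eventually_elim (use \<delta>(2)[OF y] in \<open>auto simp: u_def l2sq_def\<close>)
    qed
    finally show ?thesis .
  qed
  then show ?thesis using that \<delta>(1) by blast
qed

lemma H2_trace_l2sq_finite:
  assumes f: "f \<in> H2" and F: "H2_trace f F" shows "l2sq F < \<infinity>"
proof -
  note [measurable] = H2_trace_measurable[OF F]
  obtain \<delta> where \<delta>: "\<delta> > 0" "\<And>y. 0 < y \<Longrightarrow> y < \<delta> \<Longrightarrow> l2sq (\<lambda>x. f (Complex x y) - F x) \<le> ennreal 1"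
    using H2_trace_L2_conv[OF f F zero_less_one] by blast
  define y where "y = \<delta> / 2"
  have y: "0 < y" "y < \<delta>" using \<delta>(1) by (auto simp: y_def)
  note [measurable] = H2_measurable_line[OF f y(1)]
  have "l2sq (\<lambda>x. f (Complex x y) - (f (Complex x y) - F x)) \<le> 2 * l2sq (\<lambda>x. f (Complex x y)) + 2 * l2sq (\<lambda>x. f (Complex x y) - F x)"
    by (rule l2sq_diff_le) auto
  also have "\<dots> < \<infinity>" using H2_l2sq_finite[OF f y(1)] \<delta>(2)[OF y] by (auto simp: ennreal_mult_less_top intro: order.strict_trans1)
  finally show ?thesis by simp
qed

text \<open>The factor \<open>\<i> R / (w + \<i> R)\<close> forces decay as \<open>Im w\<close> tends to infinity and tends to \<open>1\<close> with \<open>R\<close>.\<close>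

lemma H2_product_line_zero:
  assumes f: "f \<in> H2" and g: "g \<in> H2" and y: "y > 0"
  shows "(LBINT x. f (Complex x y) * g (Complex x y)) = 0"
proof -
  obtain C where C: "C \<ge> 0" "\<And>y. y > 0 \<Longrightarrow> l2sq (\<lambda>x. f (Complex x y)) \<le> ennreal C" using H2_bound[OF f] by blast
  obtain D where D: "D \<ge> 0" "\<And>y. y > 0 \<Longrightarrow> l2sq (\<lambda>x. g (Complex x y)) \<le> ennreal D" using H2_bound[OF g] by blast
  define M where "M = sqrt (C * D)"
  have M: "M \<ge> 0" using C D by (simp add: M_def)
  have fgM: "(\<integral>\<^sup>+ x. ennreal (cmod (f (Complex x v) * g (Complex x v))) \<partial>lborel) \<le> ennreal M" if "v > 0" for v
    unfolding M_def using C D that by (intro l2_product_le H2_measurable_line f g) auto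
  define q where "q R w = \<i> * of_real R / (w + \<i> * of_real R)" for R :: real and w
  have qle: "cmod (q R (Complex x v)) \<le> R / (v + R)" if "R > 0" "v > 0" for R x v
  proof -
    have "v + R \<le> cmod (Complex x (v + R))" using abs_Im_le_cmod[of "Complex x (v + R)"] that by simp
    then show ?thesis using that unfolding q_def by (auto simp: norm_divide norm_mult Complex_add_imag intro!: frac_le)
  qed
  have fgq: "(\<integral>\<^sup>+ x. ennreal (cmod (f (Complex x v) * g (Complex x v) * q R (Complex x v))) \<partial>lborel) \<le> ennreal (M * (R / (v + R)))"
    if "R > 0" "v > 0" for R v
  proof -
    have [measurable]: "(\<lambda>x. f (Complex x v)) \<in> borel_measurable borel" "(\<lambda>x. g (Complex x v)) \<in> borel_measurable borel"
      using that by (auto intro: H2_measurable_line f g)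
    have "(\<integral>\<^sup>+ x. ennreal (cmod (f (Complex x v) * g (Complex x v) * q R (Complex x v))) \<partial>lborel)
      \<le> (\<integral>\<^sup>+ x. ennreal (cmod (f (Complex x v) * g (Complex x v))) * ennreal (R / (v + R)) \<partial>lborel)"
    proof (intro nn_integral_mono)
      fix x
      have "cmod (f (Complex x v) * g (Complex x v)) * cmod (q R (Complex x v)) \<le> cmod (f (Complex x v) * g (Complex x v)) * (R / (v + R))"
        by (intro mult_left_mono qle that) auto
      then show "ennreal (cmod (f (Complex x v) * g (Complex x v) * q R (Complex x v))) \<le> ennreal (cmod (f (Complex x v) * g (Complex x v))) * ennreal (R / (v + R))"
        using that unfolding norm_mult[of _ "q R (Complex x v)"] by (subst ennreal_mult[symmetric]) (auto intro: ennreal_leI)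
    qed
    also have "\<dots> = (\<integral>\<^sup>+ x. ennreal (cmod (f (Complex x v) * g (Complex x v))) \<partial>lborel) * ennreal (R / (v + R))"
      by (rule nn_integral_multc) measurable
    also have "\<dots> \<le> ennreal M * ennreal (R / (v + R))" by (intro mult_right_mono fgM that) auto
    also have "\<dots> = ennreal (M * (R / (v + R)))" using M that by (intro ennreal_mult[symmetric]) auto
    finally show ?thesis .
  qed
  have zero: "(LBINT x. f (Complex x y) * g (Complex x y) * q R (Complex x y)) = 0" if R: "R > 0" for R
  proof -
    define h where "h w = f w * g w * q R w" for w
    have h: "h holomorphic_on upper_half"
      unfolding h_def q_def using R
      by (intro holomorphic_intros H2_holomorphic f g) (auto simp: upper_half_def complex_eq_iff)
    have up: "open upper_half" "convex upper_half"
      by (auto simp: upper_half_def open_halfspace_Im_gt convex_halfspace_Im_gt)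
    have eq: "(LBINT x. h (Complex x y)) = (LBINT x. h (Complex x Y))" if "Y \<ge> y" for Y
    proof (rule strip_shift[OF h up, where C=M])
      fix v assume "v \<in> {y..Y}"
      then have v: "v > 0" using y by auto
      have "(\<integral>\<^sup>+ x. ennreal (norm (h (Complex x v))) \<partial>lborel) \<le> ennreal (M * (R / (v + R)))"
        unfolding h_def by (rule fgq[OF R v])
      also have "\<dots> \<le> ennreal (M * 1)" using M R v by (intro ennreal_leI mult_left_mono) auto
      finally show "(\<integral>\<^sup>+ x. ennreal (norm (h (Complex x v))) \<partial>lborel) \<le> ennreal M" by simp
    qed (use that y in \<open>auto simp: upper_half_def\<close>)
    have le: "cmod (LBINT x. h (Complex x y)) \<le> M * (R / (Y + R))" if "Y \<ge> y" for Y
    proof -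
      have Y: "Y > 0" using that y by simp
      have "continuous_on UNIV (\<lambda>x. h (Complex x Y))"
        by (rule continuous_on_compose2[OF holomorphic_on_imp_continuous_on[OF h]])
           (use Y in \<open>auto intro!: continuous_intros simp: upper_half_def\<close>)
      then have m: "(\<lambda>x. h (Complex x Y)) \<in> borel_measurable borel" by (rule borel_measurable_continuous_onI)
      have b: "(\<integral>\<^sup>+ x. ennreal (norm (h (Complex x Y))) \<partial>lborel) \<le> ennreal (M * (R / (Y + R)))"
        unfolding h_def by (rule fgq[OF R Y])
      have "integrable lborel (\<lambda>x. h (Complex x Y))"
        using m b by (intro integrableI_bounded) (auto intro: order.strict_trans1)
      from integral_norm_bound_ennreal[OF this] have "ennreal (cmod (LBINT x. h (Complex x Y))) \<le> ennreal (M * (R / (Y + R)))"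
        using b by (rule order.trans)
      then show ?thesis using M R Y eq[OF that] by (subst (asm) ennreal_le_iff) auto
    qed
    have "((\<lambda>Y. M * (R / (Y + R))) \<longlongrightarrow> 0) at_top" by real_asymp
    moreover have "\<forall>\<^sub>F Y in at_top. cmod (LBINT x. h (Complex x y)) \<le> M * (R / (Y + R))"
      using eventually_ge_at_top[of y] by eventually_elim (rule le)
    ultimately have "cmod (LBINT x. h (Complex x y)) \<le> 0" by (rule tendsto_lowerbound) simp
    then show ?thesis by (simp add: h_def)
  qed
  have [measurable]: "(\<lambda>x. f (Complex x y)) \<in> borel_measurable borel" "(\<lambda>x. g (Complex x y)) \<in> borel_measurable borel"
    using y by (auto intro: H2_measurable_line f g)
  have int: "integrable lborel (\<lambda>x. f (Complex x y) * g (Complex x y))"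
    using y f g by (intro l2_product_integrable H2_l2sq_finite H2_measurable_line)
  have "(\<lambda>n. LBINT x. f (Complex x y) * g (Complex x y) * q (real (Suc n)) (Complex x y)) \<longlonglongrightarrow> (LBINT x. f (Complex x y) * g (Complex x y))"
  proof (rule integral_dominated_convergence[where w="\<lambda>x. cmod (f (Complex x y) * g (Complex x y))"])
    have [measurable]: "(\<lambda>x. q R (Complex x y)) \<in> borel_measurable borel" if "R > 0" for R
      unfolding q_def using that y
      by (intro borel_measurable_continuous_onI continuous_intros) (auto simp: complex_eq_iff)
    show "(\<lambda>x. f (Complex x y) * g (Complex x y) * q (real (Suc n)) (Complex x y)) \<in> borel_measurable lborel" for n
      by measurable
    show "AE x in lborel. (\<lambda>n. f (Complex x y) * g (Complex x y) * q (real (Suc n)) (Complex x y)) \<longlonglongrightarrow> f (Complex x y) * g (Complex x y)"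
    proof (rule AE_I2)
      fix x
      have "(\<lambda>n. inverse (real (Suc n))) \<longlonglongrightarrow> 0" by (rule LIMSEQ_inverse_real_of_nat)
      then have "(\<lambda>n. 1 / (of_real (inverse (real (Suc n))) * Complex x y / \<i> + 1)) \<longlonglongrightarrow> 1 / (of_real 0 * Complex x y / \<i> + 1)"
        by (intro tendsto_intros) auto
      moreover have "1 / (of_real (inverse (real (Suc n))) * Complex x y / \<i> + 1) = q (real (Suc n)) (Complex x y)" for n
      proof -
        have nz: "Complex x y + \<i> * of_real (real (Suc n)) \<noteq> 0"
          unfolding Complex_add_imag using y by (simp add: complex_eq_iff)
        have "of_real (inverse (real (Suc n))) * Complex x y / \<i> + 1 = (Complex x y + \<i> * of_real (real (Suc n))) / (\<i> * of_real (real (Suc n)))"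
          by (simp add: divide_simps algebra_simps del: of_nat_Suc)
        then show ?thesis unfolding q_def by simp
      qed
      ultimately have "(\<lambda>n. q (real (Suc n)) (Complex x y)) \<longlonglongrightarrow> 1" by simp
      then have "(\<lambda>n. f (Complex x y) * g (Complex x y) * q (real (Suc n)) (Complex x y)) \<longlonglongrightarrow> f (Complex x y) * g (Complex x y) * 1"
        by (intro tendsto_intros)
      then show "(\<lambda>n. f (Complex x y) * g (Complex x y) * q (real (Suc n)) (Complex x y)) \<longlonglongrightarrow> f (Complex x y) * g (Complex x y)" by simp
    qed
    show "AE x in lborel. cmod (f (Complex x y) * g (Complex x y) * q (real (Suc n)) (Complex x y)) \<le> cmod (f (Complex x y) * g (Complex x y))" for n
    proof (rule AE_I2)
      fix x
      have "cmod (q (real (Suc n)) (Complex x y)) \<le> real (Suc n) / (y + real (Suc n))" using y by (intro qle) auto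
      also have "\<dots> \<le> 1" using y by simp
      finally show "cmod (f (Complex x y) * g (Complex x y) * q (real (Suc n)) (Complex x y)) \<le> cmod (f (Complex x y) * g (Complex x y))"
        unfolding norm_mult[of _ "q (real (Suc n)) (Complex x y)"] by (intro mult_left_le) auto
    qed
  qed (use int in auto)
  moreover have "(LBINT x. f (Complex x y) * g (Complex x y) * q (real (Suc n)) (Complex x y)) = 0" for n
    by (rule zero) simp
  ultimately show ?thesis by (simp add: LIMSEQ_const_iff)
qed

text \<open>Cauchy's theorem carried to the boundary, by splitting \<open>F * G - f * g\<close> into
  \<open>(F - f) * G + f * (G - g)\<close> and Cauchy-Schwarz. It serves twice: it removes the
  conjugate kernel in \<open>H2_trace_Cauchy\<close>, and it gives the orthogonality in
  \<open>model_space_small_function\<close>.\<close>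

lemma H2_trace_product_zero:
  assumes f: "f \<in> H2" and g: "g \<in> H2" and F: "H2_trace f F" and G: "H2_trace g G"
  shows "(LBINT x. F x * G x) = 0"
proof -
  note [measurable] = H2_trace_measurable[OF F] H2_trace_measurable[OF G]
  obtain C where C: "C \<ge> 0" "\<And>y. y > 0 \<Longrightarrow> l2sq (\<lambda>x. f (Complex x y)) \<le> ennreal C" using H2_bound[OF f] by blast
  obtain K where K: "l2sq G = ennreal K" "K \<ge> 0"
    using H2_trace_l2sq_finite[OF g G] by (cases "l2sq G") auto
  have le: "cmod (LBINT x. F x * G x) \<le> sqrt (e * K) + sqrt (C * e)" if e: "e > 0" for e
  proof -
    obtain \<delta>1 where d1: "\<delta>1 > 0" "\<And>y. 0 < y \<Longrightarrow> y < \<delta>1 \<Longrightarrow> l2sq (\<lambda>x. f (Complex x y) - F x) \<le> ennreal e"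
      using H2_trace_L2_conv[OF f F e] by blast
    obtain \<delta>2 where d2: "\<delta>2 > 0" "\<And>y. 0 < y \<Longrightarrow> y < \<delta>2 \<Longrightarrow> l2sq (\<lambda>x. g (Complex x y) - G x) \<le> ennreal e"
      using H2_trace_L2_conv[OF g G e] by blast
    define y where "y = min \<delta>1 \<delta>2 / 2"
    have y: "0 < y" "y < \<delta>1" "y < \<delta>2" using d1 d2 by (auto simp: y_def)
    note [measurable] = H2_measurable_line[OF f y(1)] H2_measurable_line[OF g y(1)]
    have sw: "l2sq (\<lambda>x. u x - v x) = l2sq (\<lambda>x. v x - u x)" for u v by (simp add: l2sq_def norm_minus_commute)
    have 1: "(\<integral>\<^sup>+ x. ennreal (cmod ((F x - f (Complex x y)) * G x)) \<partial>lborel) \<le> ennreal (sqrt (e * K))"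
      using d1(2)[OF y(1,2)] K e by (intro l2_product_le) (auto simp: sw[of F])
    have 2: "(\<integral>\<^sup>+ x. ennreal (cmod (f (Complex x y) * (G x - g (Complex x y)))) \<partial>lborel) \<le> ennreal (sqrt (C * e))"
      using d2(2)[OF y(1,3)] C y e by (intro l2_product_le) (auto simp: sw[of G])
    have i: "integrable lborel (\<lambda>x. F x * G x)"
      using H2_trace_l2sq_finite[OF f F] H2_trace_l2sq_finite[OF g G] by (intro l2_product_integrable) auto
    have i2: "integrable lborel (\<lambda>x. f (Complex x y) * g (Complex x y))"
      using y f g by (intro l2_product_integrable H2_l2sq_finite H2_measurable_line)
    have "(LBINT x. F x * G x) = (LBINT x. F x * G x - f (Complex x y) * g (Complex x y))"
      using i i2 H2_product_line_zero[OF f g y(1)] by simp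
    then have "ennreal (cmod (LBINT x. F x * G x)) \<le> (\<integral>\<^sup>+ x. ennreal (cmod (F x * G x - f (Complex x y) * g (Complex x y))) \<partial>lborel)"
      using integral_norm_bound_ennreal[OF Bochner_Integration.integrable_diff[OF i i2]] by simp
    also have "\<dots> \<le> (\<integral>\<^sup>+ x. ennreal (cmod ((F x - f (Complex x y)) * G x)) + ennreal (cmod (f (Complex x y) * (G x - g (Complex x y)))) \<partial>lborel)"
    proof (intro nn_integral_mono)
      fix x
      have "F x * G x - f (Complex x y) * g (Complex x y) = (F x - f (Complex x y)) * G x + f (Complex x y) * (G x - g (Complex x y))"
        by (simp add: algebra_simps)
      then have "cmod (F x * G x - f (Complex x y) * g (Complex x y)) \<le> cmod ((F x - f (Complex x y)) * G x) + cmod (f (Complex x y) * (G x - g (Complex x y)))"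
        by (metis norm_triangle_ineq)
      then show "ennreal (cmod (F x * G x - f (Complex x y) * g (Complex x y))) \<le> ennreal (cmod ((F x - f (Complex x y)) * G x)) + ennreal (cmod (f (Complex x y) * (G x - g (Complex x y))))"
        by (metis ennreal_leI ennreal_plus norm_ge_zero)
    qed
    also have "\<dots> = (\<integral>\<^sup>+ x. ennreal (cmod ((F x - f (Complex x y)) * G x)) \<partial>lborel) + (\<integral>\<^sup>+ x. ennreal (cmod (f (Complex x y) * (G x - g (Complex x y)))) \<partial>lborel)"
      by (rule nn_integral_add) measurable
    also have "\<dots> \<le> ennreal (sqrt (e * K)) + ennreal (sqrt (C * e))" by (intro add_mono 1 2)
    also have "\<dots> = ennreal (sqrt (e * K) + sqrt (C * e))" using e K C by (subst ennreal_plus) auto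
    finally show ?thesis using e K C by (subst (asm) ennreal_le_iff) auto
  qed
  have "((\<lambda>e. sqrt (e * K) + sqrt (C * e)) \<longlongrightarrow> sqrt (0 * K) + sqrt (C * 0)) (at_right 0)"
    by (intro tendsto_intros)
  moreover have "\<forall>\<^sub>F e in at_right 0. cmod (LBINT x. F x * G x) \<le> sqrt (e * K) + sqrt (C * e)"
    using le unfolding eventually_at_right_field by (intro exI[of _ 1]) auto
  ultimately have "cmod (LBINT x. F x * G x) \<le> sqrt (0 * K) + sqrt (C * 0)"
    by (rule tendsto_lowerbound) simp
  then show ?thesis by simp
qed

text \<open>The kernel is bounded by \<open>1 / (pi * Im z)\<close> and has mass 1, so it is square
  integrable and the L^2 convergence of the lines passes through the integral.\<close>

lemma H2_trace_poisson:
  assumes f: "f \<in> H2" and F: "H2_trace f F" and z: "Im z > 0"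
  shows "f z = (LBINT t. of_real (poisson_kernel (Im z) (Re z - t)) * F t)"
proof -
  note [measurable] = H2_trace_measurable[OF F]
  define P where "P t = complex_of_real (poisson_kernel (Im z) (Re z - t))" for t
  have [measurable]: "P \<in> borel_measurable borel" unfolding P_def by measurable
  have Pb: "(poisson_kernel (Im z) s)\<^sup>2 \<le> (1 / (pi * Im z)) * poisson_kernel (Im z) s" for s
  proof -
    have "poisson_kernel (Im z) s \<le> Im z / (pi * (Im z)\<^sup>2)" unfolding poisson_kernel_def using z
      by (intro divide_left_mono mult_left_mono mult_pos_pos) (auto intro: add_nonneg_pos)
    also have "\<dots> = 1 / (pi * Im z)" using z by (simp add: power2_eq_square)
    finally show ?thesis unfolding power2_eq_square using z by (intro mult_right_mono) auto
  qed
  have "l2sq P \<le> (\<integral>\<^sup>+ t. ennreal (1 / (pi * Im z)) * ennreal (poisson_kernel (Im z) (Re z - t)) \<partial>lborel)"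
    unfolding l2sq_def P_def using Pb z
    by (intro nn_integral_mono) (auto simp flip: ennreal_mult intro!: ennreal_leI)
  also have "\<dots> = ennreal (1 / (pi * Im z))" by (simp add: nn_integral_cmult nn_integral_poisson_kernel[OF z])
  finally have P: "l2sq P \<le> ennreal (1 / (pi * Im z))" .
  define c where "c = 1 / (pi * Im z)"
  have c: "c > 0" using z by (simp add: c_def)
  have iF: "integrable lborel (\<lambda>t. P t * F t)"
    using P H2_trace_l2sq_finite[OF f F] by (intro l2_product_integrable) (auto intro: order.strict_trans1)
  have le: "\<exists>\<delta>>0. \<forall>y. 0 < y \<and> y < \<delta> \<longrightarrow> cmod (f (z + \<i> * of_real y) - (LBINT t. P t * F t)) \<le> sqrt (c * e)" if e: "e > 0" for e
  proof -
    obtain \<delta> where d: "\<delta> > 0" "\<And>y. 0 < y \<Longrightarrow> y < \<delta> \<Longrightarrow> l2sq (\<lambda>x. f (Complex x y) - F x) \<le> ennreal e"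
      using H2_trace_L2_conv[OF f F e] by blast
    have "cmod (f (z + \<i> * of_real y) - (LBINT t. P t * F t)) \<le> sqrt (c * e)" if y: "0 < y" "y < \<delta>" for y
    proof -
      note [measurable] = H2_measurable_line[OF f y(1)]
      have zc: "Complex (Re z) (Im z + y) = z + \<i> * of_real y" by (simp add: complex_eq_iff)
      have h: "has_bochner_integral lborel (\<lambda>t. P t * f (Complex t y)) (f (z + \<i> * of_real y))"
        using H2_poisson[OF f y(1) z, of "Re z"] by (simp add: zc P_def)
      have i: "has_bochner_integral lborel (\<lambda>t. P t * f (Complex t y) - P t * F t) (f (z + \<i> * of_real y) - (LBINT t. P t * F t))"
        by (intro has_bochner_integral_diff h has_bochner_integral_integrable iF)
      have "ennreal (cmod (f (z + \<i> * of_real y) - (LBINT t. P t * F t))) \<le> (\<integral>\<^sup>+ t. ennreal (cmod (P t * f (Complex t y) - P t * F t)) \<partial>lborel)"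
        using integral_norm_bound_ennreal[of lborel "\<lambda>t. P t * f (Complex t y) - P t * F t"] i
        by (simp only: has_bochner_integral_iff)
      also have "\<dots> = (\<integral>\<^sup>+ t. ennreal (cmod (P t * (f (Complex t y) - F t))) \<partial>lborel)"
        by (simp add: right_diff_distrib)
      also have "\<dots> \<le> ennreal (sqrt (c * e))"
        using d(2)[OF y] P c e by (intro l2_product_le) (auto simp: c_def)
      finally show ?thesis using c e by (subst (asm) ennreal_le_iff) auto
    qed
    then show ?thesis using d(1) by blast
  qed
  have "((\<lambda>y. f (z + \<i> * of_real y)) \<longlongrightarrow> (LBINT t. P t * F t)) (at_right 0)"
  proof (rule tendstoI)
    fix e :: real assume e: "e > 0"
    have "(e/2)\<^sup>2 / c > 0" using e c by simp
    from le[OF this] obtain \<delta> where d: "\<delta> > 0" "\<And>y. 0 < y \<Longrightarrow> y < \<delta> \<Longrightarrow> cmod (f (z + \<i> * of_real y) - (LBINT t. P t * F t)) \<le> sqrt (c * ((e/2)\<^sup>2 / c))" by blast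
    have "sqrt (c * ((e/2)\<^sup>2 / c)) < e" using e c by simp
    then show "\<forall>\<^sub>F y in at_right 0. dist (f (z + \<i> * of_real y)) (LBINT t. P t * F t) < e"
      using d unfolding eventually_at_right_field dist_norm by (meson order_le_less_trans)
  qed
  moreover have "((\<lambda>y. f (z + \<i> * of_real y)) \<longlongrightarrow> f (z + \<i> * of_real 0)) (at_right 0)"
  proof -
    have "isCont f z"
      using H2_holomorphic[OF f] z
      by (intro continuous_on_interior[OF holomorphic_on_imp_continuous_on])
         (auto simp: upper_half_def interior_open open_halfspace_Im_gt)
    then have "isCont (\<lambda>y. f (z + \<i> * of_real y)) 0"
      using isCont_o2[of 0 "\<lambda>y. z + \<i> * of_real y" f] by (auto intro!: continuous_intros)
    then show ?thesis unfolding isCont_def by (auto intro: tendsto_mono[OF at_le])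
  qed
  ultimately have "f z = (LBINT t. P t * F t)" using tendsto_unique[OF trivial_limit_at_right_real] by force
  then show ?thesis by (simp add: P_def)
qed

section \<open>Cauchy kernels and Cauchy's formula\<close>

lemma Cauchy_kernel_l2sq:
  assumes z: "Im z \<noteq> 0"
  shows "l2sq (\<lambda>t. 1 / (of_real t - z)) = ennreal (pi / \<bar>Im z\<bar>)"
proof -
  have "(cmod (1 / (of_real t - z)))\<^sup>2 = 1 / ((t - Re z)\<^sup>2 + \<bar>Im z\<bar>\<^sup>2)" for t
    by (simp add: norm_divide power_divide cmod_power2)
  then show ?thesis unfolding l2sq_def using nn_integral_inverse_quadratic[of "\<bar>Im z\<bar>" "Re z"] z by simp
qed

lemma Cauchy_kernel_measurable: "(\<lambda>t. 1 / (complex_of_real t - z)) \<in> borel_measurable borel"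
proof -
  have "continuous_on (UNIV - {t. of_real t = z}) (\<lambda>t. 1 / (complex_of_real t - z))"
    by (intro continuous_intros) auto
  moreover have "finite {t. of_real t = z}"
    by (rule finite_subset[of _ "{Re z}"]) (auto simp: complex_eq_iff)
  ultimately show ?thesis by measurable
qed

lemma Cauchy_kernel_H2:
  assumes z: "Im z > 0"
  shows "(\<lambda>w. 1 / (w - cnj z)) \<in> H2" "H2_trace (\<lambda>w. 1 / (w - cnj z)) (\<lambda>t. 1 / (of_real t - cnj z))"
proof -
  show "(\<lambda>w. 1 / (w - cnj z)) \<in> H2"
  proof (rule H2_I)
    show "(\<lambda>w. 1 / (w - cnj z)) holomorphic_on upper_half"
      using z by (intro holomorphic_intros) (auto simp: upper_half_def complex_eq_iff)
    fix y :: real assume y: "y > 0"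
    have "Complex x y - cnj z = of_real x - Complex (Re z) (- Im z - y)" for x
      by (simp add: complex_eq_iff)
    then have "l2sq (\<lambda>x. 1 / (Complex x y - cnj z)) = ennreal (pi / \<bar>Im (Complex (Re z) (- Im z - y))\<bar>)"
      using Cauchy_kernel_l2sq[of "Complex (Re z) (- Im z - y)"] z y by simp
    also have "\<dots> \<le> ennreal (pi / Im z)" using z y by (intro ennreal_leI divide_left_mono) auto
    finally show "l2sq (\<lambda>x. 1 / (Complex x y - cnj z)) \<le> ennreal (pi / Im z)" .
  qed
  have "((\<lambda>y. 1 / (Complex x y - cnj z)) \<longlongrightarrow> 1 / (of_real x - cnj z)) (at_right 0)" for x
  proof -
    have "((\<lambda>y. 1 / (of_real x + \<i> * of_real y - cnj z)) \<longlongrightarrow> 1 / (of_real x + \<i> * of_real 0 - cnj z)) (at_right 0)"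
      using z by (intro tendsto_intros) (auto simp: complex_eq_iff)
    then show ?thesis by (simp add: Complex_eq)
  qed
  then show "H2_trace (\<lambda>w. 1 / (w - cnj z)) (\<lambda>t. 1 / (of_real t - cnj z))"
    unfolding H2_trace_def using Cauchy_kernel_measurable by simp
qed

text \<open>On the real line \<open>2 * pi * \<i>\<close> times the Poisson kernel is the difference
  of the Cauchy kernels at \<open>z\<close> and \<open>cnj z\<close>. The second one belongs to
  \<open>H2\<close>, so it integrates to 0 against \<open>F\<close>.\<close>

lemma H2_trace_Cauchy:
  assumes f: "f \<in> H2" and F: "H2_trace f F" and z: "Im z > 0"
  shows "has_bochner_integral lborel (\<lambda>t. F t * (1 / (of_real t - z))) (2 * pi * \<i> * f z)"
proof -
  note [measurable] = H2_trace_measurable[OF F]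
  note Cauchy_kernel_measurable[measurable]
  have fin: "l2sq (\<lambda>t. 1 / (of_real t - w)) < \<infinity>" if "Im w \<noteq> 0" for w
    using Cauchy_kernel_l2sq[OF that] by simp
  have i1: "integrable lborel (\<lambda>t. F t * (1 / (of_real t - z)))"
    using fin[of z] z by (intro l2_product_integrable H2_trace_l2sq_finite[OF f F]) auto
  have i2: "integrable lborel (\<lambda>t. F t * (1 / (of_real t - cnj z)))"
    using fin[of "cnj z"] z by (intro l2_product_integrable H2_trace_l2sq_finite[OF f F]) auto
  have zero: "(LBINT t. F t * (1 / (of_real t - cnj z))) = 0"
    by (rule H2_trace_product_zero[OF f Cauchy_kernel_H2(1)[OF z] F Cauchy_kernel_H2(2)[OF z]])
  have "2 * pi * \<i> * f z = (LBINT t. 2 * pi * \<i> * (of_real (poisson_kernel (Im z) (Re z - t)) * F t))"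
    unfolding H2_trace_poisson[OF f F z] by (rule integral_mult_right_zero[symmetric])
  also have "\<dots> = (LBINT t. F t * (1 / (of_real t - z)) - F t * (1 / (of_real t - cnj z)))"
  proof (rule Bochner_Integration.integral_cong[OF refl])
    fix t
    have nz: "of_real t - z \<noteq> 0" "of_real t - cnj z \<noteq> 0" using z by (auto simp: complex_eq_iff)
    have prod: "(of_real t - z) * (of_real t - cnj z) = of_real ((Re z - t)\<^sup>2 + (Im z)\<^sup>2)"
      by (simp add: complex_eq_iff power2_eq_square algebra_simps)
    have "1 / (of_real t - z) - 1 / (of_real t - cnj z) = (z - cnj z) / ((of_real t - z) * (of_real t - cnj z))"
      using nz by (simp add: field_simps)
    also have "z - cnj z = 2 * \<i> * of_real (Im z)" by (simp add: complex_eq_iff)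
    also have "2 * \<i> * of_real (Im z) / ((of_real t - z) * (of_real t - cnj z)) = 2 * pi * \<i> * of_real (poisson_kernel (Im z) (Re z - t))"
    proof -
      define S where "S = (Re z - t)\<^sup>2 + (Im z)\<^sup>2"
      have "S > 0" unfolding S_def using z by (intro add_nonneg_pos) auto
      then have "2 * \<i> * of_real (Im z) / of_real S = 2 * pi * \<i> * of_real (Im z / (pi * S))"
        by (simp add: field_simps)
      then show ?thesis unfolding prod poisson_kernel_def S_def .
    qed
    finally have "1 / (of_real t - z) - 1 / (of_real t - cnj z) = 2 * pi * \<i> * of_real (poisson_kernel (Im z) (Re z - t))" .
    then have "F t * (2 * pi * \<i> * of_real (poisson_kernel (Im z) (Re z - t))) = F t * (1 / (of_real t - z) - 1 / (of_real t - cnj z))" by simp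
    then show "2 * pi * \<i> * (of_real (poisson_kernel (Im z) (Re z - t)) * F t) = F t * (1 / (of_real t - z)) - F t * (1 / (of_real t - cnj z))"
      by (simp add: algebra_simps)
  qed
  also have "\<dots> = (LBINT t. F t * (1 / (of_real t - z)))" using i1 i2 zero by simp
  finally show ?thesis using i1 by (simp add: has_bochner_integral_iff)
qed

text \<open>\<open>model_space\<close> integrates \<open>bv\<close> against \<open>lebesgue\<close>,
  while boundary functions are handled through Borel representatives; completeness of the measure
  allows the passage.\<close>

lemma lebesgue_integral_AE_borel:
  fixes \<phi> :: "real \<Rightarrow> complex"
  assumes \<psi>: "\<psi> \<in> borel_measurable borel" and ae: "AE x in lborel. \<phi> x = \<psi> x"
  shows "(LINT x|lebesgue. \<phi> x) = (LBINT x. \<psi> x)"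
proof -
  have \<psi>l: "\<psi> \<in> borel_measurable lebesgue" using \<psi> by (simp add: measurable_completion)
  have ae': "AE x in lebesgue. \<psi> x = \<phi> x" using ae by (auto simp: AE_completion_iff)
  have "\<phi> \<in> borel_measurable lebesgue" by (rule borel_measurable_AE[OF \<psi>l ae'])
  then have "(LINT x|lebesgue. \<phi> x) = (LINT x|lebesgue. \<psi> x)"
    using \<psi>l ae' by (intro integral_cong_AE) auto
  also have "\<dots> = (LBINT x. \<psi> x)" using \<psi> by (intro integral_completion) simp
  finally show ?thesis .
qed

section \<open>Jensen's inequality and integrals depending on a parameter\<close>

lemma integral_Icc_periodic:
  fixes \<psi> :: "real \<Rightarrow> real"
  assumes cont: "continuous_on UNIV \<psi>" and per: "\<And>x. \<psi> (x + p) = \<psi> x" and a: "0 \<le> a" "a \<le> p"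
  shows "integral {a..a+p} \<psi> = integral {0..p} \<psi>"
proof -
  have int: "\<psi> integrable_on {x..y}" for x y
    by (rule integrable_continuous_real) (rule continuous_on_subset[OF cont], simp)
  have "integral {a..a+p} \<psi> = integral {a..p} \<psi> + integral {p..a+p} \<psi>"
    using a by (intro Henstock_Kurzweil_Integration.integral_combine[symmetric] int) auto
  also have "integral {p..a+p} \<psi> = integral {0..a} (\<psi> \<circ> (\<lambda>x. x + p))"
    using integral_shift[of 0 p a \<psi>] continuous_on_subset[OF cont] by simp
  also have "\<psi> \<circ> (\<lambda>x. x + p) = \<psi>" using per by auto
  also have "integral {a..p} \<psi> + integral {0..a} \<psi> = integral {0..p} \<psi>"
    using Henstock_Kurzweil_Integration.integral_combine[OF a int] by simp
  finally show ?thesis .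
qed

lemma Riemann_sum_le_integral:
  fixes \<psi> :: "real \<Rightarrow> real"
  assumes cont: "continuous_on UNIV \<psi>" and h: "h > 0"
    and close: "\<And>x y. a \<le> x \<Longrightarrow> x \<le> y \<Longrightarrow> y \<le> x + h \<Longrightarrow> y \<le> a + real K * h \<Longrightarrow> \<psi> x \<le> \<psi> y + \<eta>"
  shows "(\<Sum>k<K. h * \<psi> (a + real k * h)) \<le> integral {a..a + real K * h} \<psi> + \<eta> * (real K * h)"
proof -
  have int: "\<psi> integrable_on {x..y}" for x y
    by (rule integrable_continuous_real) (rule continuous_on_subset[OF cont], simp)
  have "(\<Sum>k<m. h * \<psi> (a + real k * h)) \<le> integral {a..a + real m * h} \<psi> + \<eta> * (real m * h)" if "m \<le> K" for m
    using that
  proof (induction m)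
    case (Suc m)
    define x where "x = a + real m * h"
    have xx: "a + real (Suc m) * h = x + h" by (simp add: x_def algebra_simps)
    have ax: "a \<le> x" using h by (simp add: x_def)
    have "real (Suc m) * h \<le> real K * h" using Suc.prems h by (intro mult_right_mono) auto
    then have xK: "x + h \<le> a + real K * h" using xx by linarith
    have "h * (\<psi> x - \<eta>) = integral {x..x+h} (\<lambda>_. \<psi> x - \<eta>)" using h by simp
    also have "\<dots> \<le> integral {x..x+h} \<psi>"
      using close[of x] ax xK by (intro integral_le int) (auto simp: algebra_simps intro: integrable_continuous_real)
    finally have "h * \<psi> x \<le> integral {x..x+h} \<psi> + \<eta> * h" by (simp add: algebra_simps)
    moreover have "integral {a..x} \<psi> + integral {x..x+h} \<psi> = integral {a..x+h} \<psi>"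
      using ax h by (intro Henstock_Kurzweil_Integration.integral_combine int) auto
    moreover have "(\<Sum>k<m. h * \<psi> (a + real k * h)) \<le> integral {a..x} \<psi> + \<eta> * (real m * h)"
      unfolding x_def using Suc by simp
    moreover have "(\<Sum>k<Suc m. h * \<psi> (a + real k * h)) = (\<Sum>k<m. h * \<psi> (a + real k * h)) + h * \<psi> x"
      by (simp add: x_def)
    moreover have "\<eta> * (real (Suc m) * h) = \<eta> * (real m * h) + \<eta> * h" by (simp add: algebra_simps)
    ultimately show ?case unfolding xx by linarith
  qed simp
  then show ?thesis by simp
qed

text \<open>Jensen's inequality by averaging over roots of unity: the maximum principle for
  \<open>z \<mapsto> \<Prod>k<n. g (\<omega>\<^sup>k z)\<close> bounds \<open>n ln |g 0|\<close> by a Riemann sum of \<open>ln (|g| + e)\<close>.\<close>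

lemma Jensen_mean:
  fixes g :: "complex \<Rightarrow> complex"
  assumes hol: "g holomorphic_on ball 0 1" and r: "0 < r" "r < 1" and e: "e > 0" and g0: "g 0 \<noteq> 0"
  shows "2 * pi * ln (cmod (g 0)) \<le> integral {0..2*pi} (\<lambda>\<theta>. ln (cmod (g (of_real r * cis \<theta>)) + e))"
proof (rule field_le_epsilon)
  fix \<epsilon> :: real assume eps: "\<epsilon> > 0"
  define \<psi> where "\<psi> \<theta> = ln (cmod (g (of_real r * cis \<theta>)) + e)" for \<theta>
  define \<eta> where "\<eta> = \<epsilon> / (2 * pi)"
  have \<eta>: "\<eta> > 0" using eps by (simp add: \<eta>_def)
  have pos: "cmod w + e > 0" for w using e by (simp add: add_nonneg_pos)
  have nz: "cmod w + e \<noteq> 0" for w using pos[of w] by simp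
  have inb: "of_real r * cis \<theta> \<in> ball 0 1" for \<theta> using r by (simp add: norm_mult)
  have cont: "continuous_on UNIV \<psi>" unfolding \<psi>_def
    by (intro continuous_intros continuous_on_compose2[OF holomorphic_on_imp_continuous_on[OF hol]])
       (use inb nz in \<open>auto intro!: continuous_on_cis continuous_intros\<close>)
  have per: "\<psi> (x + 2*pi) = \<psi> x" for x by (simp add: \<psi>_def flip: cis_mult)
  have "uniformly_continuous_on {0..4*pi} \<psi>"
    by (rule compact_uniformly_continuous) (auto intro: continuous_on_subset[OF cont])
  then obtain \<delta> where \<delta>: "\<delta> > 0" "\<And>x y. x \<in> {0..4*pi} \<Longrightarrow> y \<in> {0..4*pi} \<Longrightarrow> dist y x < \<delta> \<Longrightarrow> dist (\<psi> y) (\<psi> x) < \<eta>"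
    using \<eta> unfolding uniformly_continuous_on_def by metis
  obtain n :: nat where n: "2 * pi / \<delta> < real n" using reals_Archimedean2 by blast
  then have n0: "n > 0" using \<delta>(1) by (metis divide_nonneg_pos gr0I less_le_not_le of_nat_0 pi_ge_zero mult_nonneg_nonneg zero_le_numeral)
  define h where "h = 2 * pi / real n"
  have h: "h > 0" "h < \<delta>" "real n * h = 2 * pi" using n n0 \<delta>(1) by (auto simp: h_def field_simps)
  define I where "I = integral {0..2*pi} \<psi>"
  have riemann: "(\<Sum>k<n. h * \<psi> (a + real k * h)) \<le> I + \<epsilon>" if a: "0 \<le> a" "a \<le> 2 * pi" for a
  proof -
    have "(\<Sum>k<n. h * \<psi> (a + real k * h)) \<le> integral {a..a + real n * h} \<psi> + \<eta> * (real n * h)"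
    proof (rule Riemann_sum_le_integral[OF cont h(1)])
      fix x y assume xy: "a \<le> x" "x \<le> y" "y \<le> x + h" "y \<le> a + real n * h"
      have "dist (\<psi> x) (\<psi> y) < \<eta>" using xy a h by (intro \<delta>(2)) (auto simp: dist_real_def)
      then show "\<psi> x \<le> \<psi> y + \<eta>" by (simp add: dist_real_def)
    qed
    also have "integral {a..a + real n * h} \<psi> = I"
      unfolding h(3) I_def using a by (intro integral_Icc_periodic cont per) auto
    also have "\<eta> * (real n * h) = \<epsilon>" unfolding h(3) \<eta>_def by simp
    finally show ?thesis by simp
  qed
  define H where "H u = (\<Prod>k<n. g (cis (real k * h) * u))" for u
  have H_hol: "H holomorphic_on ball 0 1"
  proof -
    have "g \<circ> (\<lambda>u. cis (real k * h) * u) holomorphic_on ball 0 1" for k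
      by (rule holomorphic_on_compose_gen[OF _ hol]) (auto intro!: holomorphic_intros simp: norm_mult)
    then show ?thesis unfolding H_def o_def by (intro holomorphic_intros)
  qed
  \<comment> \<open>By \<open>riemann\<close>, \<open>h\<close> times the sum of the logarithms over
    every rotated grid is at most \<open>I + \<epsilon>\<close>, so this bounds \<open>H\<close> on
    the whole circle.\<close>
  define B where "B = exp ((I + \<epsilon>) / h)"
  have "cmod (H 0) \<le> B"
  proof (rule maximum_modulus_frontier[of H "ball 0 r"])
    show "H holomorphic_on interior (ball 0 r)"
      by (rule holomorphic_on_subset[OF H_hol]) (use r in auto)
    show "continuous_on (closure (ball 0 r)) H"
      by (rule continuous_on_subset[OF holomorphic_on_imp_continuous_on[OF H_hol]]) (use r in auto)
    fix z assume "z \<in> frontier (ball (0::complex) r)"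
    then have z: "cmod z = r" using r by (simp add: frontier_ball)
    define a where "a = Arg2pi z"
    have a: "0 \<le> a" "a \<le> 2 * pi" using Arg2pi[of z] by (auto simp: a_def)
    have zr: "z = of_real r * cis a" using Arg2pi[of z] z by (simp add: a_def cis_conv_exp is_Arg_def)
    have "cmod (H z) = (\<Prod>k<n. cmod (g (cis (real k * h) * z)))" unfolding H_def by (rule prod_norm[symmetric])
    also have "\<dots> \<le> (\<Prod>k<n. exp (\<psi> (a + real k * h)))"
    proof (intro prod_mono conjI)
      fix k
      have "cis (real k * h) * z = of_real r * cis (a + real k * h)" by (simp add: zr mult_ac flip: cis_mult)
      then show "cmod (g (cis (real k * h) * z)) \<le> exp (\<psi> (a + real k * h))"
        using e by (simp add: \<psi>_def exp_ln[OF pos])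
    qed auto
    also have "\<dots> = exp (\<Sum>k<n. \<psi> (a + real k * h))" by (rule exp_sum[symmetric]) simp
    also have "\<dots> \<le> B"
    proof -
      have "(\<Sum>k<n. \<psi> (a + real k * h)) * h \<le> I + \<epsilon>" using riemann[OF a] by (simp add: sum_distrib_left mult.commute)
      then show ?thesis using h(1) by (simp add: B_def pos_le_divide_eq)
    qed
    finally show "cmod (H z) \<le> B" .
  qed (use r in auto)
  moreover have "H 0 = g 0 ^ n" by (simp add: H_def)
  ultimately have "cmod (g 0) ^ n \<le> exp ((I + \<epsilon>) / h)" by (simp add: norm_power B_def)
  then have "ln (cmod (g 0) ^ n) \<le> (I + \<epsilon>) / h" using g0 by (subst ln_le_cancel_iff[symmetric, of _ "exp ((I + \<epsilon>) / h)", simplified ln_exp, symmetric]) auto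
  then have "real n * ln (cmod (g 0)) \<le> (I + \<epsilon>) / h" using g0 by (simp add: ln_realpow)
  then have "real n * h * ln (cmod (g 0)) \<le> I + \<epsilon>" using h(1) by (simp add: pos_le_divide_eq mult_ac)
  then show "2 * pi * ln (cmod (g 0)) \<le> integral {0..2*pi} (\<lambda>\<theta>. ln (cmod (g (of_real r * cis \<theta>)) + e)) + \<epsilon>"
    unfolding h(3) I_def \<psi>_def[abs_def] .
qed

text \<open>Since \<open>\<psi> \<le> ln (1 + e) \<le> 1\<close>, the negative part of
  \<open>\<psi>\<close> is at most \<open>1 - \<psi>\<close>, whose integral
  \<open>Jensen_mean\<close> controls. The bound depends neither on \<open>r\<close> nor on
  \<open>e\<close>.\<close>

lemma Jensen_circle:
  fixes g :: "complex \<Rightarrow> complex"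
  assumes hol: "g holomorphic_on ball 0 1" and le1: "\<And>z. z \<in> ball 0 1 \<Longrightarrow> cmod (g z) \<le> 1"
    and r: "0 < r" "r < 1" and e: "0 < e" "e \<le> 1" and g0: "g 0 \<noteq> 0"
  shows "(\<integral>\<^sup>+ \<theta>. ennreal (max 0 (- ln (cmod (g (of_real r * cis \<theta>)) + e))) * indicator {0..2*pi} \<theta> \<partial>lborel)
          \<le> ennreal (2 * pi * (1 - ln (cmod (g 0))))"
proof -
  define \<psi> where "\<psi> \<theta> = ln (cmod (g (of_real r * cis \<theta>)) + e)" for \<theta>
  have pos: "cmod w + e > 0" for w using e by (simp add: add_nonneg_pos)
  have nz: "cmod w + e \<noteq> 0" for w using pos[of w] by simp
  have inb: "of_real r * cis \<theta> \<in> ball 0 1" for \<theta> using r by (simp add: norm_mult)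
  have cont: "continuous_on UNIV \<psi>" unfolding \<psi>_def
    by (intro continuous_intros continuous_on_compose2[OF holomorphic_on_imp_continuous_on[OF hol]])
       (use inb nz in \<open>auto intro!: continuous_on_cis continuous_intros\<close>)
  have \<psi>1: "\<psi> \<theta> \<le> 1" for \<theta>
  proof -
    have "\<psi> \<theta> \<le> ln (1 + e)" unfolding \<psi>_def using le1[OF inb[of \<theta>]] pos e by (subst ln_le_cancel_iff) auto
    also have "\<dots> \<le> e" using e by (intro ln_add_one_self_le_self) auto
    finally show ?thesis using e by simp
  qed
  have int: "\<psi> integrable_on {0..2*pi}"
    by (rule integrable_continuous_real) (rule continuous_on_subset[OF cont], simp)
  have hi: "((\<lambda>\<theta>. 1 - \<psi> \<theta>) has_integral (2*pi - integral {0..2*pi} \<psi>)) {0..2*pi}"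
    using has_integral_diff[OF has_integral_const_real[of "1::real" 0 "2*pi"] integrable_integral[OF int]] by simp
  have "(\<integral>\<^sup>+ \<theta>. ennreal (max 0 (- \<psi> \<theta>)) * indicator {0..2*pi} \<theta> \<partial>lborel) \<le> (\<integral>\<^sup>+ \<theta>. ennreal (1 - \<psi> \<theta>) * indicator {0..2*pi} \<theta> \<partial>lborel)"
    using \<psi>1 by (intro nn_integral_mono mult_right_mono ennreal_leI) (auto simp: max_def)
  also have "\<dots> = ennreal (2*pi - integral {0..2*pi} \<psi>)"
  proof (rule nn_integral_has_integral_lebesgue'[OF _ hi])
  qed (use \<psi>1 in auto)
  also have "\<dots> \<le> ennreal (2 * pi * (1 - ln (cmod (g 0))))"
    using Jensen_mean[OF hol r e(1) g0] unfolding \<psi>_def by (intro ennreal_leI) (simp add: algebra_simps)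
  finally show ?thesis by (simp add: \<psi>_def)
qed

text \<open>Fatou's lemma with \<open>r\<close> tending to 1 and \<open>e\<close> to 0 together.
  Where \<open>G\<close> vanishes the regularised logarithms diverge, in accordance with the value
  \<open>\<infinity>\<close>. Restricting the integral to \<open>A\<close> means that radial limits
  have to be known on \<open>A\<close> only.\<close>

lemma Jensen_boundary:
  fixes g :: "complex \<Rightarrow> complex"
  assumes hol: "g holomorphic_on ball 0 1" and le1: "\<And>z. z \<in> ball 0 1 \<Longrightarrow> cmod (g z) \<le> 1" and g0: "g 0 \<noteq> 0"
    and A: "A \<subseteq> {0..2*pi}"
    and lim: "\<And>\<theta>. \<theta> \<in> A \<Longrightarrow> ((\<lambda>r. g (of_real r * cis \<theta>)) \<longlongrightarrow> G \<theta>) (at_left 1)"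
  shows "(\<integral>\<^sup>+ \<theta>. (if G \<theta> = 0 then \<infinity> else ennreal (max 0 (- ln (cmod (G \<theta>))))) * indicator A \<theta> \<partial>lborel)
          \<le> ennreal (2 * pi * (1 - ln (cmod (g 0))))"
proof -
  define R where "R n = 1 - 1 / (real n + 2)" for n
  define E where "E n = 1 / (real n + 2)" for n
  have R: "0 < R n" "R n < 1" for n by (auto simp: R_def field_simps)
  have E: "0 < E n" "E n \<le> 1" for n by (auto simp: E_def field_simps)
  have Rlim: "filterlim R (at_left 1) sequentially" unfolding R_def by real_asymp
  have Elim: "E \<longlonglongrightarrow> 0" unfolding E_def by real_asymp
  define u where "u n \<theta> = ennreal (max 0 (- ln (cmod (g (of_real (R n) * cis \<theta>)) + E n))) * indicator {0..2*pi} \<theta>" for n \<theta>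
  have pos: "cmod w + E n > 0" for w n using E(1)[of n] by (simp add: add_nonneg_pos)
  have inb: "of_real (R n) * cis \<theta> \<in> ball 0 1" for n \<theta> using R[of n] by (simp add: norm_mult)
  have meas: "u n \<in> borel_measurable lborel" for n
  proof -
    have nz: "cmod w + E n \<noteq> 0" for w using pos[of w n] by simp
    have "continuous_on UNIV (\<lambda>\<theta>. ln (cmod (g (of_real (R n) * cis \<theta>)) + E n))"
      by (intro continuous_intros continuous_on_compose2[OF holomorphic_on_imp_continuous_on[OF hol]])
         (use inb nz in \<open>auto intro!: continuous_on_cis continuous_intros\<close>)
    then have [measurable]: "(\<lambda>\<theta>. ln (cmod (g (of_real (R n) * cis \<theta>)) + E n)) \<in> borel_measurable borel"
      by (rule borel_measurable_continuous_onI)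
    show ?thesis unfolding u_def by measurable
  qed
  have le: "(if G \<theta> = 0 then \<infinity> else ennreal (max 0 (- ln (cmod (G \<theta>))))) * indicator A \<theta> \<le> liminf (\<lambda>n. u n \<theta>)" for \<theta>
  proof (cases "\<theta> \<in> A")
    case True
    then have ind: "\<theta> \<in> {0..2*pi}" using A by auto
    have l: "(\<lambda>n. g (of_real (R n) * cis \<theta>)) \<longlonglongrightarrow> G \<theta>" using filterlim_compose[OF lim[OF True] Rlim] .
    have l2: "(\<lambda>n. cmod (g (of_real (R n) * cis \<theta>)) + E n) \<longlonglongrightarrow> cmod (G \<theta>) + 0" by (intro tendsto_intros l Elim)
    have "(\<lambda>n. u n \<theta>) \<longlonglongrightarrow> (if G \<theta> = 0 then \<infinity> else ennreal (max 0 (- ln (cmod (G \<theta>)))))"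
    proof (cases "G \<theta> = 0")
      case False
      have "(\<lambda>n. ennreal (max 0 (- ln (cmod (g (of_real (R n) * cis \<theta>)) + E n)))) \<longlonglongrightarrow> ennreal (max 0 (- ln (cmod (G \<theta>) + 0)))"
        using False by (intro tendsto_ennrealI tendsto_intros l2) auto
      then show ?thesis using False ind by (simp add: u_def)
    next
      case True
      have "filterlim (\<lambda>n. cmod (g (of_real (R n) * cis \<theta>)) + E n) (at_right 0) sequentially"
        using l2 pos True by (auto simp: filterlim_at less_imp_neq[OF pos, symmetric] intro!: always_eventually)
      then have "filterlim (\<lambda>n. ln (cmod (g (of_real (R n) * cis \<theta>)) + E n)) at_bot sequentially"
        by (rule filterlim_compose[OF ln_at_0])
      then have "filterlim (\<lambda>n. - ln (cmod (g (of_real (R n) * cis \<theta>)) + E n)) at_top sequentially"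
        by (simp add: filterlim_uminus_at_bot)
      then have "filterlim (\<lambda>n. max 0 (- ln (cmod (g (of_real (R n) * cis \<theta>)) + E n))) at_top sequentially"
        by (rule filterlim_at_top_mono) auto
      then have "(\<lambda>n. ennreal (max 0 (- ln (cmod (g (of_real (R n) * cis \<theta>)) + E n)))) \<longlonglongrightarrow> top"
        by (simp add: ennreal_tendsto_top_eq_at_top)
      then show ?thesis using True ind by (simp add: u_def)
    qed
    from lim_imp_Liminf[OF _ this] show ?thesis using True by simp
  qed simp
  have "(\<integral>\<^sup>+ \<theta>. (if G \<theta> = 0 then \<infinity> else ennreal (max 0 (- ln (cmod (G \<theta>))))) * indicator A \<theta> \<partial>lborel) \<le> (\<integral>\<^sup>+ \<theta>. liminf (\<lambda>n. u n \<theta>) \<partial>lborel)"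
    by (intro nn_integral_mono le)
  also have "\<dots> \<le> liminf (\<lambda>n. \<integral>\<^sup>+ \<theta>. u n \<theta> \<partial>lborel)" by (rule nn_integral_liminf) (rule meas)
  also have "\<dots> \<le> limsup (\<lambda>n. \<integral>\<^sup>+ \<theta>. u n \<theta> \<partial>lborel)" by (rule Liminf_le_Limsup) simp
  also have "\<dots> \<le> ennreal (2 * pi * (1 - ln (cmod (g 0))))"
  proof (intro Limsup_bounded always_eventually allI)
    fix n show "(\<integral>\<^sup>+ \<theta>. u n \<theta> \<partial>lborel) \<le> ennreal (2 * pi * (1 - ln (cmod (g 0))))"
      unfolding u_def by (rule Jensen_circle[OF hol le1 R E g0])
  qed
  finally show ?thesis .
qed

section \<open>Holomorphic dependence on a parameter\<close>

lemma norm_deriv_le: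
  assumes hol: "h holomorphic_on S" and S: "open S" "cball a \<rho> \<subseteq> S" and \<rho>: "\<rho> > 0"
    and bnd: "\<And>z. z \<in> cball a \<rho> \<Longrightarrow> cmod (h z) \<le> M"
  shows "cmod (deriv h a) \<le> M / \<rho>"
proof -
  have "cmod ((deriv ^^ 1) h a) \<le> fact 1 * M / \<rho> ^ 1"
  proof (rule Cauchy_inequality)
    show "h holomorphic_on ball a \<rho>" by (rule holomorphic_on_subset[OF hol]) (use S(2) in \<open>auto simp: subset_iff\<close>)
    show "continuous_on (cball a \<rho>) h"
      by (rule continuous_on_subset[OF holomorphic_on_imp_continuous_on[OF hol]]) (use S(2) in auto)
    show "cmod (h x) \<le> M" if "cmod (a - x) = \<rho>" for x
      by (rule bnd) (use that in \<open>auto simp: dist_norm\<close>)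
  qed (use \<rho> in auto)
  then show ?thesis by simp
qed

lemma holomorphic_difference_bound:
  assumes hol: "h holomorphic_on S" and S: "open S" "cball a \<rho> \<subseteq> S" and \<rho>: "\<rho> > 0"
    and bnd: "\<And>z. z \<in> cball a \<rho> \<Longrightarrow> cmod (h z) \<le> M" and w: "cmod (w - a) < \<rho> / 2"
  shows "cmod (h w - h a) \<le> (2 * M / \<rho>) * cmod (w - a)"
proof (rule field_differentiable_bound[of "ball a (\<rho>/2)" h "deriv h"])
  show "(h has_field_derivative deriv h z) (at z within ball a (\<rho>/2))" if "z \<in> ball a (\<rho>/2)" for z
  proof -
    have "z \<in> S" using that S(2) \<rho> by (auto simp: subset_iff)
    then show ?thesis using holomorphic_derivI[OF hol S(1)] by (auto intro: has_field_derivative_at_within)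
  qed
  show "cmod (deriv h z) \<le> 2 * M / \<rho>" if z: "z \<in> ball a (\<rho>/2)" for z
  proof -
    have sub: "cball z (\<rho>/2) \<subseteq> cball a \<rho>"
    proof
      fix v assume "v \<in> cball z (\<rho>/2)"
      then show "v \<in> cball a \<rho>" using z dist_triangle[of a v z] by simp
    qed
    have "cmod (deriv h z) \<le> M / (\<rho>/2)"
      by (rule norm_deriv_le[OF hol S(1)]) (use sub S(2) \<rho> bnd in \<open>auto simp: subset_iff\<close>)
    then show ?thesis by (simp add: mult.commute)
  qed
qed (use w \<rho> in \<open>auto simp: dist_norm norm_minus_commute\<close>)

lemma holomorphic_parameter_integral:
  fixes k :: "real \<Rightarrow> complex \<Rightarrow> complex"
  assumes W: "open W" and hol: "\<And>x. k x holomorphic_on W"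
    and meas: "\<And>z. z \<in> W \<Longrightarrow> (\<lambda>x. k x z) \<in> borel_measurable borel"
    and dom: "\<And>z0. z0 \<in> W \<Longrightarrow> \<exists>r>0. \<exists>D. cball z0 r \<subseteq> W \<and> integrable lborel D \<and> (\<forall>z\<in>cball z0 r. \<forall>x. cmod (k x z) \<le> D x)"
  shows "(\<lambda>z. LBINT x. k x z) holomorphic_on W"
proof (rule holomorphic_onI)
  fix z0 assume z0: "z0 \<in> W"
  obtain r D where r: "r > 0" "cball z0 r \<subseteq> W" and D: "integrable lborel D" "\<And>z x. z \<in> cball z0 r \<Longrightarrow> cmod (k x z) \<le> D x"
    using dom[OF z0] by blast
  have kint: "integrable lborel (\<lambda>x. k x z)" if "z \<in> cball z0 r" for z
    using D(2)[OF that] meas[of z] that r(2) by (intro Bochner_Integration.integrable_bound[OF D(1)]) (auto intro!: AE_I2 intro: order.trans[OF _ abs_ge_self])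
  have "((\<lambda>h. ((LBINT x. k x (z0 + h)) - (LBINT x. k x z0)) / h) \<longlongrightarrow> (LBINT x. deriv (k x) z0)) (at 0)"
    unfolding tendsto_at_iff_sequentially
  proof (intro allI impI)
    fix X :: "nat \<Rightarrow> complex" assume X: "\<forall>i. X i \<in> UNIV - {0}" "X \<longlonglongrightarrow> 0"
    \<comment> \<open>The value 0 at the finitely many large steps lets the majorant hold for every
      index.\<close>
    define Q where "Q n x = (if cmod (X n) < r/2 then (k x (z0 + X n) - k x z0) / X n else 0)" for n x
    have ev: "\<forall>\<^sub>F n in sequentially. cmod (X n) < r/2"
      using tendstoD[OF X(2), of "r/2"] r(1) by (simp add: dist_norm)
    have inW: "z0 + X n \<in> cball z0 r" if "cmod (X n) < r/2" for n
      using that r(1) by (simp add: dist_norm)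
    have Qlim: "(\<lambda>n. Q n x) \<longlonglongrightarrow> deriv (k x) z0" for x
    proof -
      have "(k x has_field_derivative deriv (k x) z0) (at z0)" by (rule holomorphic_derivI[OF hol W z0])
      then have "((\<lambda>h. (k x (z0 + h) - k x z0) / h) \<longlongrightarrow> deriv (k x) z0) (at 0)" by (simp add: DERIV_def)
      then have "(\<lambda>n. (k x (z0 + X n) - k x z0) / X n) \<longlonglongrightarrow> deriv (k x) z0"
        using X unfolding tendsto_at_iff_sequentially o_def by blast
      then show ?thesis
        by (rule Lim_transform_eventually) (use ev in eventually_elim, simp add: Q_def)
    qed
    have Qmeas: "Q n \<in> borel_measurable lborel" for n
    proof (cases "cmod (X n) < r/2")
      case True
      have "(\<lambda>x. k x (z0 + X n)) \<in> borel_measurable borel" "(\<lambda>x. k x z0) \<in> borel_measurable borel"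
        using inW[OF True] r(2) z0 by (auto intro!: meas)
      then show ?thesis unfolding Q_def using True by simp
    qed (simp add: Q_def[abs_def])
    have Qle: "cmod (Q n x) \<le> (2 / r) * D x" for n x
    proof (cases "cmod (X n) < r/2")
      case True
      have "cmod (k x (z0 + X n) - k x z0) \<le> (2 * D x / r) * cmod (z0 + X n - z0)"
        by (rule holomorphic_difference_bound[OF hol W r(2) r(1) D(2)]) (use True in auto)
      moreover have "X n \<noteq> 0" using X(1) by auto
      ultimately show ?thesis using True by (simp add: Q_def norm_divide divide_le_eq)
    next
      case False
      have "D x \<ge> 0" using D(2)[of z0 x] r(1) norm_ge_zero order_trans by (metis centre_in_cball less_eq_real_def)
      then show ?thesis using False r(1) by (simp add: Q_def)
    qed
    have "(\<lambda>n. LBINT x. Q n x) \<longlonglongrightarrow> (LBINT x. deriv (k x) z0)"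
    proof (rule integral_dominated_convergence[where w="\<lambda>x. (2 / r) * D x"])
      show "(\<lambda>x. deriv (k x) z0) \<in> borel_measurable lborel"
        using Qlim Qmeas by (rule borel_measurable_LIMSEQ_metric[rotated])
    qed (use D(1) Qlim Qmeas Qle in auto)
    moreover have "\<forall>\<^sub>F n in sequentially. (LBINT x. Q n x) = ((\<lambda>h. ((LBINT x. k x (z0 + h)) - (LBINT x. k x z0)) / h) \<circ> X) n"
      using ev
    proof eventually_elim
      case (elim n)
      have "(LBINT x. Q n x) = (LBINT x. (k x (z0 + X n) - k x z0) / X n)" using elim by (simp add: Q_def)
      also have "\<dots> = (LBINT x. (k x (z0 + X n) - k x z0)) / X n" by simp
      also have "(LBINT x. (k x (z0 + X n) - k x z0)) = (LBINT x. k x (z0 + X n)) - (LBINT x. k x z0)"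
        using r(1) by (intro Bochner_Integration.integral_diff kint inW elim) auto
      finally show ?case by simp
    qed
    ultimately show "((\<lambda>h. ((LBINT x. k x (z0 + h)) - (LBINT x. k x z0)) / h) \<circ> X) \<longlonglongrightarrow> (LBINT x. deriv (k x) z0)"
      by (rule Lim_transform_eventually)
  qed
  then have "((\<lambda>z. LBINT x. k x z) has_field_derivative (LBINT x. deriv (k x) z0)) (at z0)"
    by (simp add: DERIV_def)
  then show "(\<lambda>z. LBINT x. k x z) field_differentiable at z0 within W"
    by (auto simp: field_differentiable_def intro: has_field_derivative_at_within)
qed

section \<open>The Blaschke product\<close>

definition node_factor :: "nat \<Rightarrow> complex \<Rightarrow> complex" where
  "node_factor n = blaschke_factor (of_nat n + \<i>)"

text \<open>The complement of a closed half-strip around the poles \<open>n - \<i>\<close>. Each of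
  its points is more than 1/4 away from all of them, so one constant bounds all partial products;
  seen from afar, it is a plane slit along the positive half-line.\<close>

definition pole_free :: "complex set" where
  "pole_free = {z. Im z > -3/4} \<union> {z. Re z < 0} \<union> {z. Im z < -3/2}"

definition partial_subproduct :: "nat set \<Rightarrow> nat \<Rightarrow> complex \<Rightarrow> complex" where
  "partial_subproduct S N z = (\<Prod>n\<in>{1..N}. if n \<in> S then node_factor n z else 1)"

definition subproduct :: "nat set \<Rightarrow> complex \<Rightarrow> complex" where
  "subproduct S z = lim (\<lambda>N. partial_subproduct S N z)"

lemma B1_eq_subproduct: "B1 = subproduct UNIV"
  by (simp add: B1_def subproduct_def partial_subproduct_def node_factor_def fun_eq_iff)

lemma open_pole_free: "open pole_free"
  unfolding pole_free_def by (intro open_Un open_halfspace_Im_gt open_halfspace_Im_lt open_halfspace_Re_lt)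

lemma pole_free_nonpole:
  assumes "z \<in> pole_free" "n \<ge> 1" shows "z - cnj (of_nat n + \<i>) \<noteq> 0"
  using assms by (auto simp: pole_free_def complex_eq_iff)

lemma pole_free_upper: "Im z \<ge> 0 \<Longrightarrow> z \<in> pole_free"
  by (simp add: pole_free_def)

lemma node_sq: "(of_nat n + \<i>)\<^sup>2 + 1 = of_nat n * (of_nat n + 2 * \<i>)"
  by (simp add: power2_eq_square algebra_simps)

lemma node_sq_nonzero: "n \<ge> 1 \<Longrightarrow> (of_nat n + \<i>)\<^sup>2 + 1 \<noteq> (0::complex)"
  unfolding node_sq by (auto simp: complex_eq_iff)

lemma node_factor_holomorphic: "n \<ge> 1 \<Longrightarrow> node_factor n holomorphic_on pole_free"
  unfolding node_factor_def blaschke_factor_def using pole_free_nonpole node_sq_nonzero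
  by (intro holomorphic_intros) auto

lemma norm_node_factor:
  assumes "n \<ge> 1"
  shows "cmod (node_factor n z) = cmod (z - (of_nat n + \<i>)) / cmod (z - cnj (of_nat n + \<i>))"
  using node_sq_nonzero[OF assms] by (simp add: node_factor_def blaschke_factor_def norm_mult norm_divide)

lemma norm_node_factor_sq:
  assumes "n \<ge> 1" "z - cnj (of_nat n + \<i>) \<noteq> 0"
  shows "(cmod (node_factor n z))\<^sup>2 = 1 - 4 * Im z / ((Re z - real n)\<^sup>2 + (Im z + 1)\<^sup>2)"
proof -
  have 1: "(cmod (z - (of_nat n + \<i>)))\<^sup>2 = (Re z - real n)\<^sup>2 + (Im z - 1)\<^sup>2"
    by (simp add: cmod_power2)
  have 2: "(cmod (z - cnj (of_nat n + \<i>)))\<^sup>2 = (Re z - real n)\<^sup>2 + (Im z + 1)\<^sup>2"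
    by (simp add: cmod_power2)
  have nz: "(Re z - real n)\<^sup>2 + (Im z + 1)\<^sup>2 \<noteq> 0" unfolding 2[symmetric] using assms(2) by simp
  have "(Re z - real n)\<^sup>2 + (Im z - 1)\<^sup>2 = ((Re z - real n)\<^sup>2 + (Im z + 1)\<^sup>2) - 4 * Im z"
    by (simp add: power2_eq_square algebra_simps)
  then show ?thesis unfolding norm_node_factor[OF assms(1)] power_divide 1 2
    using nz by (simp only: diff_divide_distrib divide_self_if if_False)
qed

lemma norm_node_factor_upper: "n \<ge> 1 \<Longrightarrow> Im z \<ge> 0 \<Longrightarrow> cmod (node_factor n z) \<le> 1"
proof -
  assume n: "n \<ge> 1" and z: "Im z \<ge> 0"
  have "(cmod (node_factor n z))\<^sup>2 \<le> 1\<^sup>2"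
    unfolding norm_node_factor_sq[OF n pole_free_nonpole[OF pole_free_upper[OF z] n]] using z by simp
  then show ?thesis by (rule power2_le_imp_le) simp
qed

lemma norm_node_factor_real: "n \<ge> 1 \<Longrightarrow> Im z = 0 \<Longrightarrow> cmod (node_factor n z) = 1"
proof -
  assume n: "n \<ge> 1" and z: "Im z = 0"
  have "(cmod (node_factor n z))\<^sup>2 = 1\<^sup>2"
    using norm_node_factor_sq[OF n pole_free_nonpole[OF pole_free_upper n], of z] z by simp
  then show ?thesis by (metis norm_ge_zero one_power2 power2_eq_iff_nonneg zero_le_one)
qed

text \<open>Each term is at most 9 times the increment of \<open>arctan\<close> over the unit
  interval about \<open>n\<close>, and the increments telescope. The factor 9: moving from
  \<open>n\<close> to a point of that interval adds at most 1/2 to twice the squared distance, and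
  \<open>d \<ge> 1/4\<close> makes 1/2 at most \<open>8 * d\<^sup>2\<close>.\<close>

lemma sum_Poisson_le:
  assumes d: "d \<ge> 1/4"
  shows "(\<Sum>n=1..N. d / ((x - real n)\<^sup>2 + d\<^sup>2)) \<le> 9 * pi"
proof -
  define A where "A n = arctan ((real n + 1/2 - x) / d)" for n
  have step: "d / ((x - real n)\<^sup>2 + d\<^sup>2) \<le> 9 * (A n - A (n - 1))" if n: "n \<ge> 1" for n
  proof -
    define f where "f t = arctan ((t - x) / d)" for t
    have f: "(f has_real_derivative d / ((t - x)\<^sup>2 + d\<^sup>2)) (at t)" for t
    proof -
      have "(f has_real_derivative inverse (1 + ((t - x) / d)\<^sup>2) * (1 / d)) (at t)"
        unfolding f_def using d by (auto intro!: derivative_eq_intros)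
      also have "inverse (1 + ((t - x) / d)\<^sup>2) * (1 / d) = d / ((t - x)\<^sup>2 + d\<^sup>2)"
      proof -
        have "1 + ((t - x) / d)\<^sup>2 = ((t - x)\<^sup>2 + d\<^sup>2) / d\<^sup>2" using d by (simp add: power_divide add_divide_distrib)
        then show ?thesis using d by (simp add: power2_eq_square)
      qed
      finally show ?thesis .
    qed
    obtain t where t: "real n - 1/2 < t" "t < real n + 1/2"
      "f (real n + 1/2) - f (real n - 1/2) = (real n + 1/2 - (real n - 1/2)) * (d / ((t - x)\<^sup>2 + d\<^sup>2))"
      using MVT2[of "real n - 1/2" "real n + 1/2" f "\<lambda>t. d / ((t - x)\<^sup>2 + d\<^sup>2)"] f by auto
    have "\<bar>t - real n\<bar> \<le> 1/2" using t(1,2) by linarith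
    then have "\<bar>t - real n\<bar>\<^sup>2 \<le> (1/2)\<^sup>2" by (intro power_mono) auto
    then have tn: "(t - real n)\<^sup>2 \<le> 1/4" by (simp add: power2_eq_square)
    have "(1/4)\<^sup>2 \<le> d\<^sup>2" using d by (intro power_mono) auto
    then have d2: "1/16 \<le> d\<^sup>2" by (simp add: power2_eq_square)
    have "(t - x)\<^sup>2 \<le> 2 * (t - real n)\<^sup>2 + 2 * (x - real n)\<^sup>2"
      using zero_le_power2[of "(t - real n) + (x - real n)"] by (simp add: power2_eq_square algebra_simps)
    moreover have "P \<le> 2 * Q + 2 * R \<Longrightarrow> Q \<le> 1/4 \<Longrightarrow> 1/16 \<le> S \<Longrightarrow> 0 \<le> R \<Longrightarrow> P + S \<le> 9 * (R + S)"
      for P Q R S :: real by argo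
    ultimately have "(t - x)\<^sup>2 + d\<^sup>2 \<le> 9 * ((x - real n)\<^sup>2 + d\<^sup>2)"
      using tn d2 zero_le_power2[of "x - real n"] by blast
    moreover have "0 < (t - x)\<^sup>2 + d\<^sup>2" "0 < (x - real n)\<^sup>2 + d\<^sup>2" using d by (auto intro!: add_nonneg_pos)
    ultimately have "(9 * d) / (9 * ((x - real n)\<^sup>2 + d\<^sup>2)) \<le> (9 * d) / ((t - x)\<^sup>2 + d\<^sup>2)"
      using d by (intro divide_left_mono mult_pos_pos) auto
    moreover have "(9 * d) / (9 * ((x - real n)\<^sup>2 + d\<^sup>2)) = d / ((x - real n)\<^sup>2 + d\<^sup>2)"
      by (rule mult_divide_mult_cancel_left) simp
    ultimately have "d / ((x - real n)\<^sup>2 + d\<^sup>2) \<le> 9 * (d / ((t - x)\<^sup>2 + d\<^sup>2))" by simp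
    also have "d / ((t - x)\<^sup>2 + d\<^sup>2) = f (real n + 1/2) - f (real n - 1/2)" using t(3) by simp
    also have "\<dots> = A n - A (n - 1)" using n by (simp add: f_def A_def of_nat_diff algebra_simps)
    finally show ?thesis .
  qed
  have "(\<Sum>n=1..N. d / ((x - real n)\<^sup>2 + d\<^sup>2)) \<le> (\<Sum>n=1..N. 9 * (A n - A (n - 1)))"
    by (intro sum_mono step) auto
  also have "\<dots> = 9 * (A N - A 0)" by (induction N) (auto simp: algebra_simps)
  also have "\<dots> \<le> 9 * pi" using arctan_ubound[of "(real N + 1/2 - x) / d"] arctan_lbound[of "(1/2 - x) / d"]
    unfolding A_def by simp
  finally show ?thesis .
qed

lemma sum_inverse_squares_le: "(\<Sum>n=1..N. 1 / (real n)\<^sup>2) \<le> 2"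
proof (cases "N = 0")
  case False
  have "(\<Sum>n=1..N. 1 / (real n)\<^sup>2) \<le> 2 - 1 / real N" if "N \<ge> 1" for N
    using that
  proof (induction N rule: dec_induct)
    case (step m)
    have "1 / (real (Suc m))\<^sup>2 \<le> 1 / real m - 1 / real (Suc m)"
    proof -
      have "1 / (real (Suc m))\<^sup>2 \<le> 1 / (real m * real (Suc m))"
        unfolding power2_eq_square using step(1) by (intro divide_left_mono mult_right_mono mult_pos_pos) auto
      also have "\<dots> = 1 / real m - 1 / real (Suc m)" using step(1) by (simp add: divide_simps)
      finally show ?thesis .
    qed
    then show ?case using step by simp
  qed simp
  from this[of N] False have "(\<Sum>n=1..N. 1 / (real n)\<^sup>2) \<le> 2 - 1 / real N" by simp
  also have "\<dots> \<le> 2" by simp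
  finally show ?thesis .
qed simp

text \<open>The exponent is half of the bound in \<open>sum_node_le\<close>, whose terms belong to
  squared moduli.\<close>

definition Blaschke_bound :: real where "Blaschke_bound = exp (6 * 9 * pi)"

lemma Blaschke_bound_ge_1: "Blaschke_bound \<ge> 1"
  by (simp add: Blaschke_bound_def)

text \<open>Below the real line the squared modulus of factor \<open>n\<close> is 1 plus this
  summand. Off the half-strip, either \<open>\<bar>Im z\<bar>\<close> is at most 3 times the
  distance to the line of poles and \<open>sum_Poisson_le\<close> applies, or \<open>z\<close> lies
  to the left, where the distance to pole \<open>n\<close> is at least \<open>n\<close>.\<close>

lemma sum_node_le:
  assumes z: "z \<in> pole_free" "Im z < 0"
  shows "(\<Sum>n=1..N. 4 * \<bar>Im z\<bar> / ((Re z - real n)\<^sup>2 + (Im z + 1)\<^sup>2)) \<le> 12 * (9 * pi)"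
proof -
  consider "\<bar>Im z + 1\<bar> \<ge> 1/4" "\<bar>Im z\<bar> \<le> 3 * \<bar>Im z + 1\<bar>" | "Re z < 0" "\<bar>Im z\<bar> \<le> 3/2"
    using z by (auto simp: pole_free_def) (force+)
  then show ?thesis
  proof cases
    case 1
    define d where "d = \<bar>Im z + 1\<bar>"
    have d: "d \<ge> 1/4" "\<bar>Im z\<bar> \<le> 3 * d" "(Im z + 1)\<^sup>2 = d\<^sup>2" using 1 by (auto simp: d_def)
    have "(\<Sum>n=1..N. 4 * \<bar>Im z\<bar> / ((Re z - real n)\<^sup>2 + (Im z + 1)\<^sup>2)) \<le> (\<Sum>n=1..N. 12 * (d / ((Re z - real n)\<^sup>2 + d\<^sup>2)))"
    proof (intro sum_mono)
      fix n
      have "4 * \<bar>Im z\<bar> / ((Re z - real n)\<^sup>2 + d\<^sup>2) \<le> (12 * d) / ((Re z - real n)\<^sup>2 + d\<^sup>2)"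
        using d by (intro divide_right_mono) auto
      then show "4 * \<bar>Im z\<bar> / ((Re z - real n)\<^sup>2 + (Im z + 1)\<^sup>2) \<le> 12 * (d / ((Re z - real n)\<^sup>2 + d\<^sup>2))"
        unfolding d(3) by simp
    qed
    also have "\<dots> = 12 * (\<Sum>n=1..N. d / ((Re z - real n)\<^sup>2 + d\<^sup>2))" by (simp add: sum_distrib_left)
    also have "\<dots> \<le> 12 * (9 * pi)" using sum_Poisson_le[OF d(1), of "Re z" N] by simp
    finally show ?thesis .
  next
    case 2
    have "(\<Sum>n=1..N. 4 * \<bar>Im z\<bar> / ((Re z - real n)\<^sup>2 + (Im z + 1)\<^sup>2)) \<le> (\<Sum>n=1..N. 6 * (1 / (real n)\<^sup>2))"
    proof (intro sum_mono)
      fix n assume n: "n \<in> {1..N}"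
      have "(real n)\<^sup>2 \<le> (Re z - real n)\<^sup>2"
        using 2 by (intro abs_le_square_iff[THEN iffD1]) auto
      then have "(real n)\<^sup>2 \<le> (Re z - real n)\<^sup>2 + (Im z + 1)\<^sup>2" by (simp add: add_increasing2)
      then have "4 * \<bar>Im z\<bar> / ((Re z - real n)\<^sup>2 + (Im z + 1)\<^sup>2) \<le> 6 / (real n)\<^sup>2"
        using n 2 by (intro frac_le) auto
      then show "4 * \<bar>Im z\<bar> / ((Re z - real n)\<^sup>2 + (Im z + 1)\<^sup>2) \<le> 6 * (1 / (real n)\<^sup>2)" by simp
    qed
    also have "\<dots> = 6 * (\<Sum>n=1..N. 1 / (real n)\<^sup>2)" by (simp add: sum_distrib_left)
    also have "\<dots> \<le> 6 * 2" by (intro mult_left_mono sum_inverse_squares_le) auto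
    also have "\<dots> \<le> 12 * (9 * pi)" using pi_gt3 by simp
    finally show ?thesis .
  qed
qed

lemma partial_subproduct_bound:
  assumes z: "z \<in> pole_free" shows "cmod (partial_subproduct S N z) \<le> Blaschke_bound"
proof (cases "Im z \<ge> 0")
  case True
  have "cmod (partial_subproduct S N z) = (\<Prod>n\<in>{1..N}. cmod (if n \<in> S then node_factor n z else 1))"
    unfolding partial_subproduct_def by (rule prod_norm[symmetric])
  also have "\<dots> \<le> 1" using norm_node_factor_upper True by (intro prod_le_1) auto
  finally show ?thesis using Blaschke_bound_ge_1 by simp
next
  case False
  define T where "T n = 4 * \<bar>Im z\<bar> / ((Re z - real n)\<^sup>2 + (Im z + 1)\<^sup>2)" for n
  have T0: "T n \<ge> 0" for n by (simp add: T_def)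
  have fac: "cmod (node_factor n z) \<le> exp (T n / 2)" if n: "n \<ge> 1" for n
  proof -
    have "(cmod (node_factor n z))\<^sup>2 = 1 + T n"
      unfolding norm_node_factor_sq[OF n pole_free_nonpole[OF z n]] T_def using False by simp
    also have "\<dots> \<le> exp (T n)" by (rule exp_ge_add_one_self)
    also have "\<dots> = (exp (T n / 2))\<^sup>2" by (simp add: power2_eq_square flip: exp_add)
    finally show ?thesis by (rule power2_le_imp_le) simp
  qed
  have "cmod (partial_subproduct S N z) = (\<Prod>n\<in>{1..N}. cmod (if n \<in> S then node_factor n z else 1))"
    unfolding partial_subproduct_def by (rule prod_norm[symmetric])
  also have "\<dots> \<le> (\<Prod>n\<in>{1..N}. exp (T n / 2))"
    using fac T0 by (intro prod_mono) auto
  also have "\<dots> = exp ((\<Sum>n=1..N. T n) / 2)" by (simp add: exp_sum sum_divide_distrib)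
  also have "\<dots> \<le> Blaschke_bound" unfolding Blaschke_bound_def T_def using sum_node_le[OF z, of N] False by simp
  finally show ?thesis .
qed

text \<open>A bare quotient \<open>(z - a) / (z - cnj a)\<close> differs from 1 by a term of order
  \<open>1 / n\<close>, which is not summable. The normalising constant equals
  \<open>s / (n + 2 * \<i>)\<close> with \<open>s - n\<close> of order \<open>1 / n\<close>; with it
  the numerator of the difference stays bounded while \<open>D\<close> grows like
  \<open>n\<^sup>2\<close>.\<close>

lemma node_factor_minus_1_bound:
  assumes z: "cmod z \<le> \<rho>" and n: "real n \<ge> 2 * \<rho> + 4"
  shows "cmod (node_factor n z - 1) \<le> (8 * \<rho> + 12) / (real n)\<^sup>2"
proof -
  have \<rho>: "\<rho> \<ge> 0" using z norm_ge_zero order_trans by blast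
  have n1: "n \<ge> 1" "real n > 0" using n \<rho> by (auto simp: Suc_le_eq intro!: gr0I)
  define s where "s = sqrt ((real n)\<^sup>2 + 4)"
  have s1: "s \<ge> real n" unfolding s_def by (rule real_le_rsqrt) simp
  have s2: "s \<le> real n + 2 / real n"
  proof -
    have "(real n + 2 / real n)\<^sup>2 = (real n)\<^sup>2 + (2 / real n)\<^sup>2 + 4" using n1 by (simp add: power2_sum)
    then show ?thesis unfolding s_def using n1 by (intro real_le_lsqrt) auto
  qed
  have cm: "cmod ((of_nat n + \<i>)\<^sup>2 + 1) = real n * s"
    unfolding node_sq norm_mult norm_of_nat by (simp add: s_def cmod_def)
  define D where "D = (of_nat n + 2 * \<i>) * (z - of_nat n + \<i>)"
  have nr: "cmod (of_nat n - \<i>) \<ge> real n" using abs_Re_le_cmod[of "of_nat n - \<i>"] by simp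
  have "cmod (of_nat n - \<i>) - cmod z \<le> cmod ((of_nat n - \<i>) - z)" by (rule norm_triangle_ineq2)
  also have "(of_nat n - \<i>) - z = - (z - of_nat n + \<i>)" by simp
  also have "cmod \<dots> = cmod (z - of_nat n + \<i>)" by (rule norm_minus_cancel)
  finally have d1: "cmod (z - of_nat n + \<i>) \<ge> real n / 2" using nr z n \<rho> by linarith
  have d2: "cmod (of_nat n + 2 * \<i>) \<ge> real n" using abs_Re_le_cmod[of "of_nat n + 2 * \<i>"] by simp
  have D: "cmod D \<ge> (real n)\<^sup>2 / 2"
  proof -
    have "real n * (real n / 2) \<le> cmod (of_nat n + 2 * \<i>) * cmod (z - of_nat n + \<i>)" using n1 by (intro mult_mono d1 d2) auto
    then show ?thesis by (simp add: D_def norm_mult power2_eq_square)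
  qed
  then have D0: "D \<noteq> 0" using n1 by auto
  have eq: "node_factor n z - 1 = ((of_real s - of_nat n) * (z - of_nat n - \<i>) - 2 * \<i> * z + 2) / D"
  proof -
    have nz: "of_nat n \<noteq> (0::complex)" using n1 by simp
    have "node_factor n z = (of_real (real n * s) / (of_nat n * (of_nat n + 2 * \<i>))) * ((z - (of_nat n + \<i>)) / (z - cnj (of_nat n + \<i>)))"
      unfolding node_factor_def blaschke_factor_def cm unfolding node_sq ..
    also have "\<dots> = (of_real s / (of_nat n + 2 * \<i>)) * ((z - of_nat n - \<i>) / (z - of_nat n + \<i>))"
    proof -
      have "z - (of_nat n + \<i>) = z - of_nat n - \<i>" "z - cnj (of_nat n + \<i>) = z - of_nat n + \<i>" by simp_all
      moreover have "complex_of_real (real n * s) / (of_nat n * (of_nat n + 2 * \<i>)) = of_real s / (of_nat n + 2 * \<i>)"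
        using nz by simp
      ultimately show ?thesis by (simp only:)
    qed
    also have "\<dots> = of_real s * (z - of_nat n - \<i>) / D" by (simp add: D_def)
    finally have "node_factor n z - 1 = (of_real s * (z - of_nat n - \<i>) - D) / D" using D0 by (simp add: diff_divide_distrib)
    also have "of_real s * (z - of_nat n - \<i>) - D = (of_real s - of_nat n) * (z - of_nat n - \<i>) - 2 * \<i> * z + 2"
      unfolding D_def by (simp add: algebra_simps)
    finally show ?thesis .
  qed
  have "cmod ((of_real s - of_nat n) * (z - of_nat n - \<i>) - 2 * \<i> * z + 2)
      \<le> cmod ((of_real s - of_nat n) * (z - of_nat n - \<i>)) + cmod (2 * \<i> * z) + 2"
    using norm_triangle_ineq[of "(of_real s - of_nat n) * (z - of_nat n - \<i>) - 2 * \<i> * z" 2]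
      norm_triangle_ineq4[of "(of_real s - of_nat n) * (z - of_nat n - \<i>)" "2 * \<i> * z"]
    unfolding norm_numeral by linarith
  also have "\<dots> \<le> (2 / real n) * (\<rho> + real n + 1) + 2 * \<rho> + 2"
  proof -
    have "cmod (of_real s - of_nat n) = s - real n"
      using s1 by (metis abs_of_nonneg diff_ge_0_iff_ge norm_of_real of_real_diff of_real_of_nat_eq)
    moreover have "cmod (z - of_nat n - \<i>) \<le> \<rho> + real n + 1"
      using norm_triangle_ineq4[of "z - of_nat n" \<i>] norm_triangle_ineq4[of z "of_nat n"] z by simp
    ultimately have "cmod ((of_real s - of_nat n) * (z - of_nat n - \<i>)) \<le> (2 / real n) * (\<rho> + real n + 1)"
      unfolding norm_mult using s1 s2 n1 by (intro mult_mono) auto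
    moreover have "cmod (2 * \<i> * z) \<le> 2 * \<rho>" using z by (simp add: norm_mult)
    ultimately show ?thesis by linarith
  qed
  also have "\<dots> \<le> 4 * \<rho> + 6"
  proof -
    have "(2 / real n) * (\<rho> + real n + 1) = 2 + 2 * (\<rho> + 1) / real n" using n1 by (simp add: field_simps)
    moreover have "2 * (\<rho> + 1) / real n \<le> 2 * (\<rho> + 1) / 1" using n \<rho> by (intro divide_left_mono) auto
    ultimately show ?thesis by simp
  qed
  finally have num: "cmod ((of_real s - of_nat n) * (z - of_nat n - \<i>) - 2 * \<i> * z + 2) \<le> 4 * \<rho> + 6" .
  have "cmod (node_factor n z - 1) \<le> (4 * \<rho> + 6) / ((real n)\<^sup>2 / 2)"
    unfolding eq norm_divide using num D n1 \<rho> by (intro frac_le) auto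
  then show ?thesis by simp
qed

lemma partial_subproduct_uniform_limit:
  assumes K: "compact K" "K \<subseteq> pole_free"
  shows "uniform_limit K (partial_subproduct S) (subproduct S) sequentially"
proof -
  define f where "f n z = (if Suc n \<in> S then node_factor (Suc n) z else 1)" for n z
  obtain \<rho> where \<rho>: "\<rho> > 0" "\<And>z. z \<in> K \<Longrightarrow> cmod z \<le> \<rho>" using compact_imp_bounded[OF K(1)] bounded_pos by blast
  have eq: "partial_subproduct S N z = (\<Prod>n<N. f n z)" for N z
    unfolding partial_subproduct_def f_def by (induction N) (auto simp: mult.commute)
  have "uniformly_convergent_on K (\<lambda>N z. \<Prod>n<N. f n z)"
  proof (rule uniformly_convergent_on_prod'[OF _ K(1)])
    show "continuous_on K (f n)" for n
      unfolding f_def using continuous_on_subset[OF holomorphic_on_imp_continuous_on[OF node_factor_holomorphic[of "Suc n"]] K(2)]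
      by (cases "Suc n \<in> S") auto
    have "uniform_limit K (\<lambda>N z. \<Sum>n<N. cmod (f n z - 1)) (\<lambda>z. \<Sum>n. cmod (f n z - 1)) sequentially"
    proof (rule Weierstrass_m_test_ev)
      have "\<forall>\<^sub>F n in sequentially. real (Suc n) \<ge> 2 * \<rho> + 4" by real_asymp
      then show "\<forall>\<^sub>F n in sequentially. \<forall>z\<in>K. norm (cmod (f n z - 1)) \<le> (8 * \<rho> + 12) * (1 / (real (Suc n))\<^sup>2)"
      proof eventually_elim
        case (elim n)
        then show ?case using node_factor_minus_1_bound[OF \<rho>(2) elim] \<rho>(1) by (auto simp: f_def)
      qed
      have "summable (\<lambda>n. 1 / (real (Suc n))\<^sup>2)"
        using inverse_power_summable[of 2, where 'a=real] by (subst summable_Suc_iff) (simp add: inverse_eq_divide)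
      then show "summable (\<lambda>n. (8 * \<rho> + 12) * (1 / (real (Suc n))\<^sup>2))" by (rule summable_mult)
    qed
    then show "uniformly_convergent_on K (\<lambda>N z. \<Sum>n<N. cmod (f n z - 1))" by (rule uniformly_convergentI)
  qed
  then have "uniform_limit K (\<lambda>N z. partial_subproduct S N z) (\<lambda>z. lim (\<lambda>N. partial_subproduct S N z)) sequentially"
    unfolding eq by (rule uniformly_convergent_uniform_limit_iff[THEN iffD1])
  then show ?thesis by (simp add: subproduct_def[abs_def])
qed

lemma partial_subproduct_tendsto: "z \<in> pole_free \<Longrightarrow> (\<lambda>N. partial_subproduct S N z) \<longlonglongrightarrow> subproduct S z"
  using tendsto_uniform_limitI[OF partial_subproduct_uniform_limit[of "{z}" S], of z] by simp

lemma partial_subproduct_holomorphic: "partial_subproduct S N holomorphic_on pole_free"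
proof -
  have "(if n \<in> S then node_factor n z else 1) = (if n \<in> S then node_factor n else (\<lambda>_. 1)) z" for n z by simp
  then show ?thesis unfolding partial_subproduct_def[abs_def]
    by (simp only:) (intro holomorphic_intros, use node_factor_holomorphic in auto)
qed

lemma subproduct_holomorphic: "subproduct S holomorphic_on pole_free"
proof (rule holomorphic_uniform_sequence[OF open_pole_free partial_subproduct_holomorphic])
  fix x assume "x \<in> pole_free"
  then obtain d where d: "d > 0" "cball x d \<subseteq> pole_free" using open_pole_free open_contains_cball by blast
  then show "\<exists>d>0. cball x d \<subseteq> pole_free \<and> uniform_limit (cball x d) (partial_subproduct S) (subproduct S) sequentially"
    using partial_subproduct_uniform_limit[OF compact_cball d(2)] by blast
qed

lemma subproduct_bound: "z \<in> pole_free \<Longrightarrow> cmod (subproduct S z) \<le> Blaschke_bound"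
  by (rule tendsto_upperbound[OF tendsto_norm[OF partial_subproduct_tendsto]]) (auto intro!: always_eventually partial_subproduct_bound)

lemma subproduct_upper:
  assumes "Im z \<ge> 0" shows "cmod (subproduct S z) \<le> 1"
proof (rule tendsto_upperbound[OF tendsto_norm[OF partial_subproduct_tendsto[OF pole_free_upper[OF assms]]]])
  show "\<forall>\<^sub>F N in sequentially. cmod (partial_subproduct S N z) \<le> 1"
    unfolding partial_subproduct_def prod_norm[symmetric] using norm_node_factor_upper assms
    by (intro always_eventually allI prod_le_1) auto
qed simp

lemma subproduct_real:
  assumes "Im z = 0" shows "cmod (subproduct S z) = 1"
proof -
  have "(\<lambda>N. cmod (partial_subproduct S N z)) \<longlonglongrightarrow> cmod (subproduct S z)"
    using assms by (intro tendsto_norm partial_subproduct_tendsto pole_free_upper) simp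
  moreover have "cmod (partial_subproduct S N z) = 1" for N
    unfolding partial_subproduct_def prod_norm[symmetric] using norm_node_factor_real assms by (intro prod.neutral) auto
  ultimately show ?thesis by (simp add: LIMSEQ_const_iff)
qed

lemma B1_split: "z \<in> pole_free \<Longrightarrow> B1 z = subproduct S z * subproduct (- S) z"
proof -
  assume z: "z \<in> pole_free"
  have "partial_subproduct UNIV N z = partial_subproduct S N z * partial_subproduct (- S) N z" for N
    unfolding partial_subproduct_def prod.distrib[symmetric] by (intro prod.cong) auto
  then have "(\<lambda>N. partial_subproduct UNIV N z) \<longlonglongrightarrow> subproduct S z * subproduct (- S) z"
    using tendsto_mult[OF partial_subproduct_tendsto[OF z, of S] partial_subproduct_tendsto[OF z, of "- S"]] by simp
  then show ?thesis unfolding B1_eq_subproduct using partial_subproduct_tendsto[OF z, of UNIV] LIMSEQ_unique by blast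
qed

section \<open>Necessity\<close>

lemma norm_B1_real: "Im z = 0 \<Longrightarrow> cmod (B1 z) = 1"
  by (simp add: B1_eq_subproduct subproduct_real)

lemma B1_holomorphic: "B1 holomorphic_on pole_free"
  by (simp add: B1_eq_subproduct subproduct_holomorphic)

lemma B1_bound: "z \<in> pole_free \<Longrightarrow> cmod (B1 z) \<le> Blaschke_bound"
  by (simp add: B1_eq_subproduct subproduct_bound)

lemma vertical_limit_real:
  assumes "h holomorphic_on pole_free"
  shows "((\<lambda>y. h (Complex x y)) \<longlongrightarrow> h (of_real x)) (at_right 0)"
proof -
  have "isCont h (of_real x)"
    using continuous_on_interior[OF holomorphic_on_imp_continuous_on[OF assms]] open_pole_free
    by (simp add: interior_open pole_free_upper)
  then have "isCont (\<lambda>y. h (of_real x + \<i> * of_real y)) 0"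
    using isCont_o2[of 0 "\<lambda>y. of_real x + \<i> * of_real y" h] by (auto intro!: continuous_intros)
  then have "((\<lambda>y. h (of_real x + \<i> * of_real y)) \<longlongrightarrow> h (of_real x + \<i> * of_real 0)) (at 0)"
    by (simp add: isCont_def)
  then show ?thesis by (auto simp: Complex_eq intro: tendsto_mono[OF at_le])
qed

lemma continuous_on_real_line:
  "h holomorphic_on pole_free \<Longrightarrow> continuous_on UNIV (\<lambda>x. h (complex_of_real x))"
  by (rule continuous_on_compose2[OF holomorphic_on_imp_continuous_on]) (auto intro!: continuous_intros simp: pole_free_upper)

section \<open>Analytic continuation of functions in the model space\<close>

definition B1_quotient :: "real \<Rightarrow> complex \<Rightarrow> complex" where
  "B1_quotient x z = (if z = of_real x then deriv B1 (of_real x) else (B1 z - B1 (of_real x)) / (z - of_real x))"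

lemma B1_quotient_holomorphic: "B1_quotient x holomorphic_on pole_free"
  unfolding B1_quotient_def[abs_def] by (rule pole_lemma_open[OF B1_holomorphic open_pole_free])

lemma B1_quotient_measurable: "(\<lambda>x. B1_quotient x z) \<in> borel_measurable borel"
proof -
  have [measurable]: "(\<lambda>x. B1 (complex_of_real x)) \<in> borel_measurable borel"
    by (intro borel_measurable_continuous_onI continuous_on_real_line B1_holomorphic)
  have [measurable]: "Measurable.pred borel (\<lambda>x. z = complex_of_real x)"
    by measurable
  have "(\<lambda>x. B1_quotient x z) = (\<lambda>x. if z = of_real x then deriv B1 z else (B1 z - B1 (of_real x)) / (z - of_real x))"
    by (auto simp: B1_quotient_def fun_eq_iff)
  also have "\<dots> \<in> borel_measurable borel" by measurable
  finally show ?thesis .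
qed

text \<open>Close to \<open>x\<close>, Cauchy's estimate in a disc of radius 1/2 about the real
  point bounds the quotient by \<open>4 * Blaschke_bound\<close>; farther away it is at most
  \<open>2 * Blaschke_bound\<close> over the distance. The second case fixes the constant
  \<open>4 * 17 = 68\<close>, since there \<open>s + 1 \<le> 17 * S\<close>.\<close>

lemma norm_B1_quotient_sq:
  assumes z: "z \<in> pole_free"
  shows "(cmod (B1_quotient x z))\<^sup>2 \<le> 68 * Blaschke_bound\<^sup>2 / ((x - Re z)\<^sup>2 + 1\<^sup>2)"
proof -
  define s where "s = (x - Re z)\<^sup>2"
  have s0: "s \<ge> 0" by (simp add: s_def)
  have Blaschke_bound: "Blaschke_bound \<ge> 1" by (rule Blaschke_bound_ge_1)
  define S where "S = (cmod (z - of_real x))\<^sup>2"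
  have "\<bar>Re z - x\<bar> \<le> cmod (z - of_real x)" using abs_Re_le_cmod[of "z - of_real x"] by simp
  then have "\<bar>Re z - x\<bar>\<^sup>2 \<le> S" unfolding S_def by (intro power_mono) auto
  then have sS: "s \<le> S" by (simp add: s_def power2_commute)
  have sub: "cball (of_real x) (1/2) \<subseteq> pole_free"
  proof
    fix v assume "v \<in> cball (complex_of_real x) (1/2)"
    then have "\<bar>Im (of_real x - v)\<bar> \<le> 1/2" using abs_Im_le_cmod[of "of_real x - v"] unfolding mem_cball dist_norm by linarith
    then have "Im v > -3/4" by (simp add: abs_le_iff)
    then show "v \<in> pole_free" by (simp add: pole_free_def)
  qed
  have bnd: "v \<in> cball (of_real x) (1/2) \<Longrightarrow> cmod (B1 v) \<le> Blaschke_bound" for v using sub B1_bound by auto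
  have half: "(0::real) < 1/2" by simp
  have "(cmod (B1_quotient x z))\<^sup>2 \<le> 68 * Blaschke_bound\<^sup>2 / (s + 1)"
  proof (cases "cmod (z - of_real x) < 1/4")
    case True
    have "cmod (B1_quotient x z) \<le> 4 * Blaschke_bound"
    proof (cases "z = of_real x")
      case True
      have "cmod (deriv B1 (of_real x)) \<le> Blaschke_bound / (1/2)"
        by (rule norm_deriv_le[OF B1_holomorphic open_pole_free sub half bnd])
      then show ?thesis using True Blaschke_bound by (simp add: B1_quotient_def)
    next
      case False
      have "cmod (B1 z - B1 (of_real x)) \<le> (2 * Blaschke_bound / (1/2)) * cmod (z - of_real x)"
        by (rule holomorphic_difference_bound[OF B1_holomorphic open_pole_free sub half bnd]) (use \<open>cmod (z - of_real x) < 1/4\<close> in auto)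
      then show ?thesis using False by (simp add: B1_quotient_def norm_divide divide_le_eq)
    qed
    then have "(cmod (B1_quotient x z))\<^sup>2 \<le> (4 * Blaschke_bound)\<^sup>2" by (intro power_mono) auto
    also have "\<dots> = 16 * Blaschke_bound\<^sup>2" by (simp add: power_mult_distrib)
    finally have 1: "(cmod (B1_quotient x z))\<^sup>2 \<le> 16 * Blaschke_bound\<^sup>2" .
    have "S \<le> (1/4)\<^sup>2" unfolding S_def using True by (intro power_mono) auto
    then have "s + 1 \<le> 2" using sS by (simp add: power2_eq_square)
    then have "16 * Blaschke_bound\<^sup>2 * (s + 1) \<le> 16 * Blaschke_bound\<^sup>2 * 2" by (intro mult_left_mono) auto
    also have "\<dots> \<le> 68 * Blaschke_bound\<^sup>2" by simp
    finally have "16 * Blaschke_bound\<^sup>2 \<le> 68 * Blaschke_bound\<^sup>2 / (s + 1)" using s0 by (simp add: pos_le_divide_eq)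
    with 1 show ?thesis by linarith
  next
    case False
    then have ne: "z \<noteq> of_real x" by auto
    have "(1/4)\<^sup>2 \<le> S" unfolding S_def using False by (intro power_mono) auto
    then have S: "1/16 \<le> S" by (simp add: power2_eq_square)
    have "cmod (B1 z - B1 (of_real x)) \<le> Blaschke_bound + Blaschke_bound"
      using norm_triangle_ineq4[of "B1 z" "B1 (of_real x)"] B1_bound[OF z] B1_bound[of "of_real x"] pole_free_upper[of "of_real x"] by simp
    then have "(cmod (B1 z - B1 (of_real x)))\<^sup>2 \<le> (2 * Blaschke_bound)\<^sup>2" by (intro power_mono) auto
    then have "(cmod (B1_quotient x z))\<^sup>2 \<le> 4 * Blaschke_bound\<^sup>2 / S"
      unfolding B1_quotient_def S_def using ne by (simp add: norm_divide power_divide power_mult_distrib divide_right_mono)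
    also have "\<dots> \<le> 4 * Blaschke_bound\<^sup>2 / ((s + 1) / 17)"
    proof (rule divide_left_mono)
      have "s + 1 \<le> S + 16 * S" using sS S by simp
      then show "(s + 1) / 17 \<le> S" by simp
      show "0 < S * ((s + 1) / 17)" using S s0 by (intro mult_pos_pos) auto
    qed simp
    also have "\<dots> = 68 * Blaschke_bound\<^sup>2 / (s + 1)" using s0 by simp
    finally show ?thesis .
  qed
  then show ?thesis by (simp add: s_def)
qed

text \<open>Orthogonality of \<open>f\<close> to \<open>B1\<close> times the kernel
  \<open>1 / (w - cnj z)\<close> says that \<open>F * cnj B1 / (x - z)\<close> has integral 0.
  Subtracting \<open>B1 z\<close> times this from Cauchy's formula, with
  \<open>cnj B1 * B1 = 1\<close> on the real line, replaces the singular kernel by a divided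
  difference of \<open>B1\<close>.\<close>

lemma model_space_reproducing:
  assumes f: "f \<in> model_space B1" and F: "H2_trace f F" and z: "Im z > 0"
  shows "f z = (LBINT x. F x * cnj (B1 (of_real x)) * B1_quotient x z / (2 * pi * \<i>))"
proof -
  have fH: "f \<in> H2" using f by (simp add: model_space_def)
  note [measurable] = H2_trace_measurable[OF F]
  have [measurable]: "(\<lambda>x. B1 (complex_of_real x)) \<in> borel_measurable borel"
    by (intro borel_measurable_continuous_onI continuous_on_real_line B1_holomorphic)
  note Cauchy_kernel_measurable[measurable]
  define g where "g w = 1 / (w - cnj z)" for w
  have gH: "g \<in> H2" unfolding g_def by (rule Cauchy_kernel_H2(1)[OF z])
  define \<psi> where "\<psi> x = F x * (cnj (B1 (of_real x)) * (1 / (of_real x - z)))" for x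
  have [measurable]: "\<psi> \<in> borel_measurable borel" unfolding \<psi>_def by measurable
  have bvg: "bv (\<lambda>w. B1 w * g w) x = B1 (of_real x) * (1 / (of_real x - cnj z))" for x
  proof -
    have "((\<lambda>y. g (Complex x y)) \<longlongrightarrow> 1 / (of_real x - cnj z)) (at_right 0)"
    proof -
      have "((\<lambda>y. 1 / (of_real x + \<i> * of_real y - cnj z)) \<longlongrightarrow> 1 / (of_real x + \<i> * of_real 0 - cnj z)) (at_right 0)"
        using z by (intro tendsto_intros) (auto simp: complex_eq_iff)
      then show ?thesis by (simp add: Complex_eq g_def)
    qed
    then have "((\<lambda>y. B1 (Complex x y) * g (Complex x y)) \<longlongrightarrow> B1 (of_real x) * (1 / (of_real x - cnj z))) (at_right 0)"
      by (intro tendsto_mult vertical_limit_real B1_holomorphic)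
    then show ?thesis unfolding bv_def by (intro tendsto_Lim) auto
  qed
  have "(LINT x|lebesgue. bv f x * cnj (bv (\<lambda>w. B1 w * g w) x)) = (LBINT x. \<psi> x)"
  proof (rule lebesgue_integral_AE_borel)
    show "AE x in lborel. bv f x * cnj (bv (\<lambda>w. B1 w * g w) x) = \<psi> x"
      using H2_trace_bv[OF F] by eventually_elim (simp add: bvg \<psi>_def)
  qed measurable
  moreover have "(LINT x|lebesgue. bv f x * cnj (bv (\<lambda>w. B1 w * g w) x)) = 0"
    using f gH by (simp add: model_space_def)
  ultimately have zero: "(LBINT x. \<psi> x) = 0" by simp
  have hb: "has_bochner_integral lborel (\<lambda>t. F t * (1 / (of_real t - z))) (2 * pi * \<i> * f z)"
    by (rule H2_trace_Cauchy[OF fH F z])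
  have fin: "l2sq (\<lambda>t. cnj (B1 (of_real t)) * (1 / (of_real t - z))) < \<infinity>"
  proof -
    have "l2sq (\<lambda>t. cnj (B1 (of_real t)) * (1 / (of_real t - z))) = l2sq (\<lambda>t. 1 / (of_real t - z))"
      unfolding l2sq_def by (simp add: norm_mult norm_divide norm_B1_real)
    then show ?thesis using Cauchy_kernel_l2sq[of z] z by simp
  qed
  have int\<psi>: "integrable lborel \<psi>"
    unfolding \<psi>_def using fin by (intro l2_product_integrable H2_trace_l2sq_finite[OF fH F]) auto
  have "has_bochner_integral lborel (\<lambda>t. F t * (1 / (of_real t - z)) - B1 z * \<psi> t) (2 * pi * \<i> * f z - B1 z * 0)"
    using int\<psi> zero by (intro has_bochner_integral_diff hb has_bochner_integral_mult_right) (auto simp: has_bochner_integral_iff)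
  moreover have "F t * (1 / (of_real t - z)) - B1 z * \<psi> t = F t * cnj (B1 (of_real t)) * B1_quotient t z" for t
  proof -
    have ne: "z \<noteq> of_real t" using z by auto
    then have nz: "z - of_real t \<noteq> 0" "of_real t - z \<noteq> 0" by auto
    have one: "cnj (B1 (of_real t)) * B1 (of_real t) = 1"
      using norm_B1_real[of "of_real t"] complex_norm_square[of "B1 (of_real t)"] by (simp add: mult.commute)
    have "F t * cnj (B1 (of_real t)) * B1_quotient t z = F t * (cnj (B1 (of_real t)) * B1 z - cnj (B1 (of_real t)) * B1 (of_real t)) / (z - of_real t)"
      using ne by (simp add: B1_quotient_def right_diff_distrib mult.assoc)
    also have "\<dots> = F t * (1 - cnj (B1 (of_real t)) * B1 z) / (of_real t - z)"
      unfolding one using nz by (simp add: field_simps)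
    also have "\<dots> = F t * (1 / (of_real t - z)) - B1 z * \<psi> t"
      by (simp add: \<psi>_def algebra_simps diff_divide_distrib)
    finally show ?thesis by simp
  qed
  ultimately have "has_bochner_integral lborel (\<lambda>t. F t * cnj (B1 (of_real t)) * B1_quotient t z) (2 * pi * \<i> * f z)" by simp
  then show ?thesis by (simp add: has_bochner_integral_iff)
qed

text \<open>The reproducing integral makes sense for every \<open>z\<close> in
  \<open>pole_free\<close>, and its majorant there has an integral that does not depend on
  \<open>z\<close>; so the extension is bounded on the whole region.\<close>

lemma model_space_extension:
  assumes f: "f \<in> model_space B1"
  obtains E M where "E holomorphic_on pole_free" "\<And>z. z \<in> pole_free \<Longrightarrow> cmod (E z) \<le> M" "\<And>z. Im z > 0 \<Longrightarrow> f z = E z"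
proof -
  have fH: "f \<in> H2" using f by (simp add: model_space_def)
  obtain F where F: "H2_trace f F" using H2_trace_exists[OF fH] by blast
  note [measurable] = H2_trace_measurable[OF F] B1_quotient_measurable
  have [measurable]: "(\<lambda>x. B1 (complex_of_real x)) \<in> borel_measurable borel"
    by (intro borel_measurable_continuous_onI continuous_on_real_line B1_holomorphic)
  define k where "k x z = F x * cnj (B1 (of_real x)) * B1_quotient x z / (2 * pi * \<i>)" for x z
  define c where "c = 68 * Blaschke_bound\<^sup>2"
  have c: "c \<ge> 0" by (simp add: c_def)
  have kle: "cmod (k x z) \<le> (cmod (F x))\<^sup>2 + c * (1 / ((x - Re z)\<^sup>2 + 1\<^sup>2))" if z: "z \<in> pole_free" for x z
  proof -
    have "cmod (k x z) = cmod (F x) * cmod (B1_quotient x z) / (2 * pi)"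
      by (simp add: k_def norm_mult norm_divide norm_B1_real)
    also have "\<dots> \<le> cmod (F x) * cmod (B1_quotient x z) / 1"
      using pi_gt3 by (intro divide_left_mono) auto
    also have "\<dots> \<le> (cmod (F x))\<^sup>2 + (cmod (B1_quotient x z))\<^sup>2"
      using zero_le_power2[of "cmod (F x) - cmod (B1_quotient x z)"] zero_le_power2[of "cmod (F x)"] zero_le_power2[of "cmod (B1_quotient x z)"]
      unfolding power2_diff by argo
    also have "\<dots> \<le> (cmod (F x))\<^sup>2 + c * (1 / ((x - Re z)\<^sup>2 + 1\<^sup>2))"
      using norm_B1_quotient_sq[OF z, of x] by (simp add: c_def)
    finally show ?thesis .
  qed
  have intF: "integrable lborel (\<lambda>x. (cmod (F x))\<^sup>2)"
    using H2_trace_l2sq_finite[OF fH F] by (intro integrableI_bounded) (auto simp: l2sq_def)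
  have intq: "has_bochner_integral lborel (\<lambda>x. 1 / ((x - a)\<^sup>2 + 1\<^sup>2)) pi" for a
    using has_bochner_integral_inverse_quadratic[of 1 a] by simp
  define E where "E z = (LBINT x. k x z)" for z
  have meas: "(\<lambda>x. k x z) \<in> borel_measurable borel" for z
    unfolding k_def by measurable
  have "E holomorphic_on pole_free"
    unfolding E_def
  proof (rule holomorphic_parameter_integral[OF open_pole_free _ meas])
    show "k x holomorphic_on pole_free" for x
      unfolding k_def by (intro holomorphic_intros B1_quotient_holomorphic) auto
    fix z0 assume "z0 \<in> pole_free"
    then obtain d where d: "d > 0" "cball z0 d \<subseteq> pole_free" using open_pole_free open_contains_cball by blast
    \<comment> \<open>Radius at most 1 lets one majorant serve the whole disc: moving
      \<open>Re z\<close> by at most 1 costs a factor 3.\<close>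
    define r where "r = min d 1"
    have r: "r > 0" "cball z0 r \<subseteq> pole_free" "r \<le> 1" using d by (auto simp: r_def)
    define D where "D x = (cmod (F x))\<^sup>2 + (3 * c) * (1 / ((x - Re z0)\<^sup>2 + 1\<^sup>2))" for x
    have "cmod (k x z) \<le> D x" if z: "z \<in> cball z0 r" for z x
    proof -
      have "\<bar>Re (z0 - z)\<bar> \<le> 1" using z r(3) abs_Re_le_cmod[of "z0 - z"] by (simp add: dist_norm)
      then have "\<bar>Re z0 - Re z\<bar>\<^sup>2 \<le> 1\<^sup>2" by (intro power_mono) auto
      then have 1: "(Re z0 - Re z)\<^sup>2 \<le> 1" by simp
      have "(x - Re z0)\<^sup>2 \<le> 2 * (x - Re z)\<^sup>2 + 2 * (Re z0 - Re z)\<^sup>2"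
        using zero_le_power2[of "(x - Re z) + (Re z0 - Re z)"] by (simp add: power2_eq_square algebra_simps)
      with 1 have "(x - Re z0)\<^sup>2 + 1\<^sup>2 \<le> 3 * ((x - Re z)\<^sup>2 + 1\<^sup>2)"
        using zero_le_power2[of "x - Re z"] by (simp only: one_power2) argo
      then have "1 / (3 * ((x - Re z)\<^sup>2 + 1\<^sup>2)) \<le> 1 / ((x - Re z0)\<^sup>2 + 1\<^sup>2)"
        by (intro divide_left_mono mult_pos_pos) (auto intro: add_nonneg_pos)
      then have le: "(3 * c) * (1 / (3 * ((x - Re z)\<^sup>2 + 1\<^sup>2))) \<le> (3 * c) * (1 / ((x - Re z0)\<^sup>2 + 1\<^sup>2))"
        using c by (intro mult_left_mono) auto
      have eq: "(3 * c) * (1 / (3 * T)) = c * (1 / T)" for T :: real by simp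
      have "c * (1 / ((x - Re z)\<^sup>2 + 1\<^sup>2)) \<le> (3 * c) * (1 / ((x - Re z0)\<^sup>2 + 1\<^sup>2))"
        using le unfolding eq .
      moreover have "cmod (k x z) \<le> (cmod (F x))\<^sup>2 + c * (1 / ((x - Re z)\<^sup>2 + 1\<^sup>2))"
        using kle[of z x] r(2) z by blast
      ultimately show ?thesis unfolding D_def by linarith
    qed
    moreover have "integrable lborel D"
      unfolding D_def using intF intq[of "Re z0"] by (intro Bochner_Integration.integrable_add integrable_mult_right) (auto simp: has_bochner_integral_iff)
    ultimately show "\<exists>r>0. \<exists>D. cball z0 r \<subseteq> pole_free \<and> integrable lborel D \<and> (\<forall>z\<in>cball z0 r. \<forall>x. cmod (k x z) \<le> D x)"
      using r by blast
  qed
  moreover have "cmod (E z) \<le> (LBINT x. (cmod (F x))\<^sup>2) + c * pi" if z: "z \<in> pole_free" for z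
  proof -
    define D where "D x = (cmod (F x))\<^sup>2 + c * (1 / ((x - Re z)\<^sup>2 + 1\<^sup>2))" for x
    have D: "has_bochner_integral lborel D ((LBINT x. (cmod (F x))\<^sup>2) + c * pi)"
      unfolding D_def using intF by (intro has_bochner_integral_add has_bochner_integral_mult_right intq) (simp add: has_bochner_integral_iff)
    have Dint: "integrable lborel D" using D by (rule has_bochner_integral_iff[THEN iffD1, THEN conjunct1])
    have kD: "cmod (k x z) \<le> D x" for x using kle[OF z, of x] unfolding D_def .
    have "integrable lborel (\<lambda>x. k x z)"
    proof (rule Bochner_Integration.integrable_bound[OF Dint])
      show "(\<lambda>x. k x z) \<in> borel_measurable lborel" using meas by simp
      show "AE x in lborel. norm (k x z) \<le> norm (D x)"
        using kD by (intro AE_I2) (metis abs_ge_self order_trans real_norm_def)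
    qed
    then have "cmod (E z) \<le> (LBINT x. cmod (k x z))" "integrable lborel (\<lambda>x. cmod (k x z))"
      unfolding E_def by auto
    moreover have "(LBINT x. cmod (k x z)) \<le> (LBINT x. D x)"
      using calculation(2) Dint kD by (rule integral_mono)
    ultimately have "cmod (E z) \<le> (LBINT x. D x)" by linarith
    then show ?thesis using D by (simp add: has_bochner_integral_iff)
  qed
  moreover have "f z = E z" if "Im z > 0" for z
    unfolding E_def k_def by (rule model_space_reproducing[OF f F that])
  ultimately show ?thesis by (rule that)
qed

text \<open>In the quadrant, \<open>v\<^sup>4\<close> covers the plane slit along the positive half-line; the term \<open>2 v\<^sup>3\<close> pushes the image
  of the imaginary axis to \<open>Im = - 2 \<bar>v\<bar>\<^sup>3\<close>, that is below the poles except for small \<open>v\<close>, where the translation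
  by \<open>4\<close> moves it to the left of them.\<close>

lemma slit_map_in_pole_free:
  assumes p: "0 < Re v" and q: "0 < Im v"
  shows "v ^ 4 + 2 * v ^ 3 - 4 \<in> pole_free"
proof (rule ccontr)
  define p' q' where "p' = Re v" and "q' = Im v"
  have pq: "p' > 0" "q' > 0" using assms by (auto simp: p'_def q'_def)
  have v: "v = Complex p' q'" by (simp add: p'_def q'_def)
  have Re: "Re (v ^ 4 + 2 * v ^ 3 - 4) = p'^4 - 6 * p'^2 * q'^2 + q'^4 + 2 * p'^3 - 6 * p' * q'^2 - 4"
    by (simp add: v eval_nat_numeral algebra_simps)
  have Im: "Im (v ^ 4 + 2 * v ^ 3 - 4) = q' * (4 * p'^3 + 6 * p'^2 - (4 * p' + 2) * q'^2)"
    by (simp add: v eval_nat_numeral algebra_simps)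
  assume "v ^ 4 + 2 * v ^ 3 - 4 \<notin> pole_free"
  then have ass: "Im (v ^ 4 + 2 * v ^ 3 - 4) \<le> - 3/4" "Im (v ^ 4 + 2 * v ^ 3 - 4) \<ge> - 3/2" "Re (v ^ 4 + 2 * v ^ 3 - 4) \<ge> 0"
    by (auto simp: pole_free_def)
  define Q where "Q = q'^2"
  have Q4: "q'^4 = Q^2" by (simp add: Q_def)
  have "q' * (4 * p'^3 + 6 * p'^2 - (4 * p' + 2) * Q) < 0" using ass(1) unfolding Im Q_def by linarith
  then have neg: "4 * p'^3 + 6 * p'^2 < (4 * p' + 2) * Q" using pq by (simp add: mult_less_0_iff)
  have Qp: "p'^2 < Q"
  proof -
    have "(4 * p' + 2) * p'^2 \<le> 4 * p'^3 + 6 * p'^2" by (simp add: power2_eq_square power3_eq_cube algebra_simps)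
    with neg have "(4 * p' + 2) * p'^2 < (4 * p' + 2) * Q" by linarith
    then show ?thesis using pq by (simp add: mult_less_cancel_left)
  qed
  have re: "p'^4 - 6 * p'^2 * Q + Q^2 + 2 * p'^3 - 6 * p' * Q \<ge> 4" using ass(3) unfolding Re Q4 Q_def[symmetric] by linarith
  \<comment> \<open>Before the translation the real part is
    \<open>(Q - p'^2) * (Q - 5 * p'^2 - 6 * p')\<close> minus positive terms, so for smaller
    \<open>Q\<close> it could not even be positive.\<close>
  have big: "Q \<ge> 3 * p'^2 + 3 * p'"
  proof (rule ccontr)
    assume "\<not> ?thesis"
    then have le: "Q + p'^2 - 6 * p'^2 - 6 * p' \<le> 0" using pq by (smt (verit) zero_le_power2)
    have "(Q - p'^2) * (Q + p'^2 - 6 * p'^2 - 6 * p') \<le> 0"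
      using Qp le by (intro mult_nonneg_nonpos) auto
    moreover have "p'^4 - 6 * p'^2 * Q + Q^2 + 2 * p'^3 - 6 * p' * Q = (Q - p'^2) * (Q + p'^2 - 6 * p'^2 - 6 * p') - 4 * p'^4 - 4 * p'^3"
      by (simp add: eval_nat_numeral algebra_simps)
    moreover have "p'^4 > 0" "p'^3 > 0" using pq by auto
    ultimately show False using re by linarith
  qed
  \<comment> \<open>Hence the imaginary part is at most \<open>- 2 * q' * Q\<close>; being at least
    -3/2, it forces \<open>p'\<close> and \<open>q'\<close> to be at most 1. Then the positive terms
    \<open>p'^4 + Q^2 + 2 * p'^3\<close> stay below 4, the amount of the translation.\<close>
  have "(4 * p' + 2) * Q - (4 * p'^3 + 6 * p'^2) \<ge> 2 * Q"
  proof -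
    have "4 * p' * (3 * p'^2 + 3 * p') \<le> 4 * p' * Q" using big pq by (intro mult_left_mono) auto
    moreover have "4 * p' * (3 * p'^2 + 3 * p') = 12 * p'^3 + 12 * p'^2" by (simp add: eval_nat_numeral algebra_simps)
    moreover have "p'^3 > 0" "p'^2 > 0" using pq by auto
    moreover have "(4 * p' + 2) * Q = 4 * p' * Q + 2 * Q" by (simp add: algebra_simps)
    ultimately show ?thesis by linarith
  qed
  then have "q' * (2 * Q) \<le> q' * ((4 * p' + 2) * Q - (4 * p'^3 + 6 * p'^2))" using pq by (intro mult_left_mono) auto
  also have "\<dots> = - (q' * (4 * p'^3 + 6 * p'^2 - (4 * p' + 2) * q'^2))" by (simp add: Q_def algebra_simps)
  also have "\<dots> \<le> 3/2" using ass(2) unfolding Im by linarith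
  finally have q3: "q' * Q \<le> 3/4" by simp
  have q1: "q' \<le> 1"
  proof (rule ccontr)
    assume "\<not> q' \<le> 1"
    then have "1 * 1 \<le> q' * q'^2" by (intro mult_mono) auto
    then show False using q3 by (simp add: Q_def)
  qed
  have Q1: "Q \<le> 1" "Q \<ge> 0" using q1 pq by (auto simp: Q_def power_le_one)
  have p1: "p'^2 \<le> 1/3" using big Q1 pq by linarith
  have pp: "p' \<le> 1" using p1 pq by (intro power2_le_imp_le[of p' 1]) auto
  have "p'^3 \<le> 1" using pp pq by (simp add: power_le_one)
  moreover have "Q^2 \<le> 1" using Q1 by (simp add: power_le_one)
  moreover have "p'^2 * Q \<ge> 0" "p' * Q > 0" using Q1 pq by (auto simp: Q_def)
  moreover have "p'^4 < 1"
  proof -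
    have "p'^2 * p'^2 \<le> (1/3) * (1/3)" using p1 by (intro mult_mono) auto
    then show ?thesis by (simp add: eval_nat_numeral)
  qed
  moreover have "6 * p'^2 * Q = 6 * (p'^2 * Q)" "6 * p' * Q = 6 * (p' * Q)" by simp_all
  ultimately show False using re by linarith
qed

section \<open>Pull-back to the unit disc and Jensen's inequality\<close>

lemma csqrt_quadrant:
  assumes "Im z > 0" shows "Re (csqrt z) > 0" "Im (csqrt z) > 0"
proof -
  have "2 * Re (csqrt z) * Im (csqrt z) = Im z"
    using arg_cong[OF power2_csqrt[of z], of Im] by (simp add: power2_eq_square mult_ac del: csqrt.simps)
  then have p: "Re (csqrt z) * Im (csqrt z) > 0" using assms by simp
  then show "Re (csqrt z) > 0" using Re_csqrt[of z] by (auto simp: less_le)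
  then show "Im (csqrt z) > 0" using p by (simp add: zero_less_mult_iff)
qed

text \<open>The Cayley map with 0 going to \<open>\<i> * b\<close>. The parameter \<open>b\<close>
  is free so that the centre can be placed where \<open>E\<close> does not vanish.\<close>

definition disc_to_half :: "real \<Rightarrow> complex \<Rightarrow> complex" where
  "disc_to_half b u = \<i> * of_real b * (1 + u) / (1 - u)"

lemma Im_disc_to_half:
  assumes "b > 0" "cmod u < 1" shows "Im (disc_to_half b u) > 0"
proof -
  have ne: "1 - u \<noteq> 0" using assms by auto
  have "disc_to_half b u = \<i> * of_real b * ((1 + u) * cnj (1 - u)) / of_real ((cmod (1 - u))\<^sup>2)"
  proof -
    have "\<i> * of_real b * (1 + u) / (1 - u) = (\<i> * of_real b * (1 + u) * cnj (1 - u)) / ((1 - u) * cnj (1 - u))"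
      by (rule mult_divide_mult_cancel_right[symmetric]) (use ne in \<open>simp only: complex_cnj_zero_iff not_False_eq_True\<close>)
    then show ?thesis unfolding disc_to_half_def complex_norm_square by (simp only: mult.assoc)
  qed
  then have "Im (disc_to_half b u) = b * Re ((1 + u) * cnj (1 - u)) / (cmod (1 - u))\<^sup>2"
    by (simp add: Im_divide_of_real)
  also have "Re ((1 + u) * cnj (1 - u)) = 1 - (cmod u)\<^sup>2"
    unfolding cmod_power2 by (simp add: power2_eq_square algebra_simps)
  finally have *: "Im (disc_to_half b u) = b * (1 - (cmod u)\<^sup>2) / (cmod (1 - u))\<^sup>2" .
  have "(cmod u)\<^sup>2 < 1" using assms by (simp add: power_less_one_iff)
  then show ?thesis unfolding * using assms ne by simp
qed

lemma disc_to_half_boundary: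
  assumes b: "b > 0"
  shows "1 - cis (pi + 2 * arctan y) \<noteq> 0" "disc_to_half b (cis (pi + 2 * arctan y)) = of_real (b * y)"
proof -
  have nz: "of_real y + \<i> \<noteq> 0" by (simp add: complex_eq_iff)
  have s: "sqrt (1 + y\<^sup>2) \<noteq> 0" "(sqrt (1 + y\<^sup>2))\<^sup>2 = 1 + y\<^sup>2" by (auto simp: add_pos_nonneg add_nonneg_eq_0_iff)
  have c: "cis (arctan y) = (1 + \<i> * of_real y) / of_real (sqrt (1 + y\<^sup>2))"
    by (simp add: complex_eq_iff cos_arctan sin_arctan Re_divide_of_real Im_divide_of_real)
  have "cis (pi + 2 * arctan y) = - (cis (arctan y))\<^sup>2"
    using Complex.DeMoivre[of "arctan y" 2] by (simp flip: cis_mult)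
  also have "\<dots> = - ((1 + \<i> * of_real y)\<^sup>2 / of_real (1 + y\<^sup>2))"
    unfolding c power_divide of_real_power[symmetric] s(2) ..
  also have "\<dots> = (of_real y - \<i>) / (of_real y + \<i>)"
  proof -
    have "of_real (1 + y\<^sup>2) = (of_real y - \<i>) * (of_real y + \<i>)" by (simp add: complex_eq_iff power2_eq_square)
    moreover have "(1 + \<i> * of_real y)\<^sup>2 = - ((of_real y - \<i>)\<^sup>2)" by (simp add: power2_eq_square algebra_simps)
    moreover have "of_real y - \<i> \<noteq> 0" by (simp add: complex_eq_iff)
    ultimately show ?thesis using nz by (simp add: power2_eq_square)
  qed
  finally have u: "cis (pi + 2 * arctan y) = (of_real y - \<i>) / (of_real y + \<i>)" .
  have 1: "1 - cis (pi + 2 * arctan y) = 2 * \<i> / (of_real y + \<i>)" unfolding u using nz by (simp add: field_simps)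
  have 2: "1 + cis (pi + 2 * arctan y) = 2 * of_real y / (of_real y + \<i>)" unfolding u using nz by (simp add: field_simps)
  show "1 - cis (pi + 2 * arctan y) \<noteq> 0" unfolding 1 using nz by simp
  show "disc_to_half b (cis (pi + 2 * arctan y)) = of_real (b * y)"
    unfolding disc_to_half_def 1 2 using nz by simp
qed

text \<open>The curve is the image of the diagonal of the quadrant under the slit map, that is, the
  set of possible images of the centre of the disc. It runs in the upper half-plane, so by the
  identity theorem \<open>E\<close> cannot vanish along it.\<close>

lemma nonzero_on_curve:
  assumes E: "E holomorphic_on pole_free" and nz: "z1 \<in> upper_half" "E z1 \<noteq> 0"
  shows "\<exists>t>0. E (Complex (- 4 * t^4 - 4 * t^3 - 4) (4 * t^3)) \<noteq> 0"
proof (rule ccontr)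
  assume "\<not> ?thesis"
  then have zero: "E (Complex (- 4 * t^4 - 4 * t^3 - 4) (4 * t^3)) = 0" if "t > 0" for t :: real using that by blast
  define c where "c t = Complex (- 4 * t^4 - 4 * t^3 - 4) (4 * t^3)" for t :: real
  define X where "X n = c (1 + 1 / real (Suc n))" for n
  define U where "U = range X"
  have pos: "1 + 1 / real (Suc n) > 1" for n by simp
  have up: "open upper_half" "connected upper_half"
    by (auto simp: upper_half_def open_halfspace_Im_gt intro!: convex_connected convex_halfspace_Im_gt)
  have sub: "upper_half \<subseteq> pole_free" by (auto simp: upper_half_def pole_free_def)
  have "X \<longlonglongrightarrow> c 1"
  proof -
    have "isCont c 1" unfolding c_def Complex_eq by (intro continuous_intros)
    moreover have "(\<lambda>n. 1 + 1 / real (Suc n)) \<longlonglongrightarrow> 1" by real_asymp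
    ultimately show ?thesis unfolding X_def by (rule isCont_tendsto_compose)
  qed
  moreover have Xne: "X n \<noteq> c 1" for n
  proof
    assume "X n = c 1"
    then have "(1 + 1 / real (Suc n))^3 = 1^3" by (simp add: X_def c_def)
    moreover have "1^3 < (1 + 1 / real (Suc n))^3" using pos[of n] by (intro power_strict_mono) auto
    ultimately show False by linarith
  qed
  ultimately have "c 1 islimpt U"
    unfolding islimpt_sequential U_def by (intro exI[of _ X]) auto
  have "E z1 = 0"
  proof (rule analytic_continuation[OF holomorphic_on_subset[OF E sub] up _ _ \<open>c 1 islimpt U\<close> _ nz(1)])
    show "U \<subseteq> upper_half" by (auto simp: U_def X_def c_def upper_half_def intro!: add_pos_nonneg)
    show "c 1 \<in> upper_half" by (simp add: c_def upper_half_def)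
    fix z assume "z \<in> U"
    then obtain n where "z = X n" by (auto simp: U_def)
    moreover have "1 + 1 / real (Suc n) > 0" using pos[of n] by linarith
    ultimately show "E z = 0" using zero[of "1 + 1 / real (Suc n)"] by (simp add: X_def c_def)
  qed
  then show False using nz(2) by simp
qed

lemma csqrt_imaginary: "t > 0 \<Longrightarrow> csqrt (\<i> * of_real (2 * t\<^sup>2)) = Complex t t"
  by (rule csqrt_unique) (auto simp: complex_eq_iff power2_eq_square)

lemma slit_map_imaginary:
  "(Complex t t) ^ 4 + 2 * (Complex t t) ^ 3 - 4 = Complex (- 4 * t^4 - 4 * t^3 - 4) (4 * t^3)"
  by (simp add: complex_eq_iff eval_nat_numeral algebra_simps)

text \<open>The slit map on the real side of the quadrant.\<close>

definition slit_parameter :: "real \<Rightarrow> real" where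
  "slit_parameter s = s^4 + 2 * s^3 - 4"

text \<open>At these boundary points every map in the composition is continuous: the point of the
  circle is not 1, the value \<open>b * y > 0\<close> avoids the cut of \<open>csqrt\<close>, and
  \<open>E\<close> is holomorphic across the real line.\<close>

lemma continuous_disc_pullback:
  assumes E: "E holomorphic_on pole_free" and b: "b > 0" and y: "y > 0"
  shows "((\<lambda>r. E ((csqrt (disc_to_half b (of_real r * cis (pi + 2 * arctan y))))^4 + 2 * (csqrt (disc_to_half b (of_real r * cis (pi + 2 * arctan y))))^3 - 4))
     \<longlongrightarrow> E (of_real (slit_parameter (sqrt (b * y))))) (at_left 1)"
proof -
  define u where "u = cis (pi + 2 * arctan y)"
  define v where "v r = csqrt (disc_to_half b (of_real r * u))" for r :: real
  have u1: "1 - u \<noteq> 0" and du: "disc_to_half b u = of_real (b * y)"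
    using disc_to_half_boundary[OF b, of y] by (auto simp: u_def)
  have "isCont (\<lambda>r. disc_to_half b (of_real r * u)) 1"
    unfolding disc_to_half_def using u1 by (intro continuous_intros) auto
  moreover have "isCont csqrt (disc_to_half b (of_real 1 * u))"
    using mult_pos_pos[OF b y] du by (intro continuous_at_csqrt) (auto simp: complex_nonpos_Reals_iff)
  ultimately have "isCont v 1" unfolding v_def by (rule isCont_o2)
  moreover have v1: "v 1 = of_real (sqrt (b * y))"
  proof -
    have "v 1 = csqrt (of_real (b * y))" unfolding v_def by (simp add: du)
    also have "\<dots> = of_real (sqrt (b * y))" using b y by (simp add: csqrt_of_real_nonneg del: of_real_mult)
    finally show ?thesis .
  qed
  ultimately have "isCont (\<lambda>r. v r ^ 4 + 2 * v r ^ 3 - 4) 1" by (intro continuous_intros)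
  moreover have e: "v 1 ^ 4 + 2 * v 1 ^ 3 - 4 = of_real (slit_parameter (sqrt (b * y)))"
    unfolding v1 slit_parameter_def by simp
  moreover have "isCont E (of_real (slit_parameter (sqrt (b * y))))"
    using continuous_on_interior[OF holomorphic_on_imp_continuous_on[OF E]] open_pole_free
    by (simp add: interior_open pole_free_upper)
  ultimately have "isCont (\<lambda>r. E (v r ^ 4 + 2 * v r ^ 3 - 4)) 1"
    using isCont_o2[of 1 "\<lambda>r. v r ^ 4 + 2 * v r ^ 3 - 4" E] by simp
  then have "((\<lambda>r. E (v r ^ 4 + 2 * v r ^ 3 - 4)) \<longlongrightarrow> E (v 1 ^ 4 + 2 * v 1 ^ 3 - 4)) (at 1)"
    by (simp add: isCont_def)
  then show ?thesis unfolding e unfolding v_def u_def by (auto intro: tendsto_mono[OF at_le])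
qed

text \<open>The arc from \<open>pi\<close> to \<open>2 * pi\<close> lies over the real side of the
  quadrant; over the other side only the bound on \<open>E\<close> enters. With
  \<open>b = 2 * t\<^sup>2\<close> the centre goes to \<open>t + \<i> * t\<close> in the quadrant,
  where \<open>nonzero_on_curve\<close> applies.\<close>

lemma Jensen_slit:
  assumes E: "E holomorphic_on pole_free" and le1: "\<And>z. z \<in> pole_free \<Longrightarrow> cmod (E z) \<le> 1"
    and nz: "z1 \<in> upper_half" "E z1 \<noteq> 0"
  obtains b C where "b > 0" "C \<ge> 0"
    "(\<integral>\<^sup>+ \<theta>. (if E (of_real (slit_parameter (sqrt (b * tan ((\<theta> - pi) / 2))))) = 0 then \<infinity>
        else ennreal (max 0 (- ln (cmod (E (of_real (slit_parameter (sqrt (b * tan ((\<theta> - pi) / 2))))))))))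
        * indicator {pi<..<2*pi} \<theta> \<partial>lborel) \<le> ennreal C"
proof -
  obtain t where t: "t > 0" "E (Complex (- 4 * t^4 - 4 * t^3 - 4) (4 * t^3)) \<noteq> 0"
    using nonzero_on_curve[OF E nz] by blast
  define b where "b = 2 * t\<^sup>2"
  have b: "b > 0" using t by (simp add: b_def)
  define g where "g u = E ((csqrt (disc_to_half b u))^4 + 2 * (csqrt (disc_to_half b u))^3 - 4)" for u
  define G where "G \<theta> = E (of_real (slit_parameter (sqrt (b * tan ((\<theta> - pi) / 2)))))" for \<theta>
  have Wr: "(csqrt (disc_to_half b u))^4 + 2 * (csqrt (disc_to_half b u))^3 - 4 \<in> pole_free" if "u \<in> ball 0 1" for u
    using that by (intro slit_map_in_pole_free csqrt_quadrant Im_disc_to_half b) auto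
  have d: "disc_to_half b holomorphic_on ball 0 1"
    unfolding disc_to_half_def[abs_def] by (intro holomorphic_intros) auto
  have dn: "disc_to_half b u \<notin> \<real>\<^sub>\<le>\<^sub>0" if "u \<in> ball 0 1" for u
    using Im_disc_to_half[OF b, of u] that by (auto simp: complex_nonpos_Reals_iff)
  have "(\<lambda>u. (csqrt (disc_to_half b u))^4 + 2 * (csqrt (disc_to_half b u))^3 - 4) holomorphic_on ball 0 1"
    by (intro holomorphic_intros d dn)
  moreover have "(\<lambda>u. (csqrt (disc_to_half b u))^4 + 2 * (csqrt (disc_to_half b u))^3 - 4) ` ball 0 1 \<subseteq> pole_free"
    using Wr by blast
  ultimately have hol: "g holomorphic_on ball 0 1"
    using holomorphic_on_compose_gen[OF _ E] unfolding g_def[abs_def] o_def by blast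
  have gle: "cmod (g u) \<le> 1" if "u \<in> ball 0 1" for u unfolding g_def using Wr[OF that] by (rule le1)
  have g0: "g 0 \<noteq> 0"
    using t unfolding g_def disc_to_half_def b_def
    by (simp add: csqrt_imaginary[OF t(1), simplified] slit_map_imaginary[simplified])
  have "(\<integral>\<^sup>+ \<theta>. (if G \<theta> = 0 then \<infinity> else ennreal (max 0 (- ln (cmod (G \<theta>))))) * indicator {pi<..<2*pi} \<theta> \<partial>lborel)
          \<le> ennreal (2 * pi * (1 - ln (cmod (g 0))))"
  proof (rule Jensen_boundary[OF hol gle g0])
    show "{pi<..<2*pi} \<subseteq> {0..2*pi}" using pi_gt_zero by (auto intro: order.trans less_imp_le)
    fix \<theta> assume th: "\<theta> \<in> {pi<..<2*pi}"
    define y where "y = tan ((\<theta> - pi) / 2)"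
    have y: "y > 0" unfolding y_def using th by (intro tan_gt_zero) auto
    have "arctan y = (\<theta> - pi) / 2" unfolding y_def using th by (intro arctan_tan) auto
    then have "\<theta> = pi + 2 * arctan y" by simp
    then show "((\<lambda>r. g (of_real r * cis \<theta>)) \<longlongrightarrow> G \<theta>) (at_left 1)"
      unfolding g_def G_def using continuous_disc_pullback[OF E b y] by (simp add: y_def)
  qed
  moreover have "2 * pi * (1 - ln (cmod (g 0))) \<ge> 0"
  proof -
    have "ln (cmod (g 0)) \<le> 0" using gle[of 0] g0 by (simp add: ln_le_zero_iff)
    then show ?thesis by simp
  qed
  ultimately show ?thesis using that b unfolding G_def by blast
qed

text \<open>With \<open>t = slit_parameter s\<close> both densities are of order
  \<open>s^(-3)\<close> for large \<open>s\<close>: \<open>t powr (-3/2)\<close> is about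
  \<open>s^(-6)\<close> and \<open>dt\<close> about \<open>4 * s^3 ds\<close>, and
  \<open>4 * s * b / (b\<^sup>2 + s^4)\<close> is the density of the angle on the circle. The
  hypothesis \<open>slit_parameter s \<ge> 1\<close> absorbs the translation by 4 in
  \<open>s^4 \<le> 5 * slit_parameter s\<close>.\<close>

lemma slit_density_le:
  assumes b: "b > 0" and s: "s \<ge> 1" and ts: "slit_parameter s \<ge> 1"
  shows "slit_parameter s powr (-3/2) * (4 * s^3 + 6 * s^2) \<le> (150 * (b\<^sup>2 + 1) / (4 * b)) * (4 * s * b / (b\<^sup>2 + s^4))"
proof -
  define \<tau> where "\<tau> = slit_parameter s"
  have \<tau>: "\<tau> \<ge> 1" using ts by (simp add: \<tau>_def)
  have s3: "s^3 > 0" "s^4 \<ge> 1" using s by (auto simp: one_le_power)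
  have "s^4 \<le> 5 * \<tau>"
    using \<tau> s3 unfolding \<tau>_def slit_parameter_def by argo
  then have 1: "s^4 / 5 \<le> \<tau>" by simp
  have "s^2 / 3 \<le> sqrt \<tau>"
  proof (rule real_le_rsqrt)
    have "(s\<^sup>2 / 3)\<^sup>2 = s^4 / 9" by (simp add: power_divide)
    also have "\<dots> \<le> \<tau>" using 1 s3 by simp
    finally show "(s\<^sup>2 / 3)\<^sup>2 \<le> \<tau>" .
  qed
  then have "(s^4 / 5) * (s^2 / 3) \<le> \<tau> * sqrt \<tau>" using 1 \<tau> s by (intro mult_mono) auto
  then have 2: "s^6 / 15 \<le> \<tau> * sqrt \<tau>" by (simp flip: power_add)
  have "\<tau> powr (-3/2) = 1 / (\<tau> * sqrt \<tau>)"
  proof -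
    have "\<tau> powr (3/2) = \<tau> powr (1 + 1/2)" by simp
    also have "\<dots> = \<tau> powr 1 * \<tau> powr (1/2)" by (rule powr_add)
    also have "\<dots> = \<tau> * sqrt \<tau>" using \<tau> by (simp add: powr_half_sqrt)
    finally show ?thesis by (simp add: powr_minus_divide)
  qed
  also have "\<dots> \<le> 1 / (s^6 / 15)" using 2 s by (intro divide_left_mono mult_pos_pos) (use \<tau> in auto)
  finally have 3: "\<tau> powr (-3/2) \<le> 15 / s^6" by simp
  have "s^2 \<le> s^3" using s by (intro power_increasing) auto
  then have 4: "4 * s^3 + 6 * s^2 \<le> 10 * s^3" by linarith
  have "\<tau> powr (-3/2) * (4 * s^3 + 6 * s^2) \<le> (15 / s^6) * (10 * s^3)"
    using 3 4 s by (intro mult_mono) auto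
  also have "\<dots> = 150 * s / s^4" using s by (simp add: field_simps eval_nat_numeral)
  also have "\<dots> = ((b\<^sup>2 + 1) * (150 * s)) / ((b\<^sup>2 + 1) * s^4)"
    by (rule mult_divide_mult_cancel_left[symmetric]) (simp add: add_nonneg_eq_0_iff)
  also have "\<dots> = (150 * (b\<^sup>2 + 1) * s) / ((b\<^sup>2 + 1) * s^4)" by (simp only: mult_ac)
  also have "\<dots> \<le> (150 * (b\<^sup>2 + 1) * s) / (b\<^sup>2 + s^4)"
  proof (rule divide_left_mono)
    have "b\<^sup>2 * 1 \<le> b\<^sup>2 * s^4" using s3 by (intro mult_left_mono) auto
    then show "b\<^sup>2 + s^4 \<le> (b\<^sup>2 + 1) * s^4" by (simp add: algebra_simps)
  qed (use s b in \<open>auto intro!: mult_pos_pos add_pos_pos\<close>)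
  also have "\<dots> = (150 * (b\<^sup>2 + 1) / (4 * b)) * (4 * s * b / (b\<^sup>2 + s^4))"
    using b by simp
  finally show ?thesis by (simp add: \<tau>_def)
qed

text \<open>Two substitutions from the same variable \<open>s\<close>, namely
  \<open>t = slit_parameter s\<close> on the half-line and
  \<open>\<theta> = pi + 2 * arctan (s\<^sup>2 / b)\<close> on the circle, carry the integral to the
  one in \<open>Jensen_slit\<close>; \<open>slit_density_le\<close> compares the densities.\<close>

lemma log_integrability_bounded:
  assumes E: "E holomorphic_on pole_free" and le1: "\<And>z. z \<in> pole_free \<Longrightarrow> cmod (E z) \<le> 1"
    and nz: "z1 \<in> upper_half" "E z1 \<noteq> 0"
  shows "(\<integral>\<^sup>+ t. log_integrand (\<lambda>t. cmod (E (of_real t))) t * indicator {1..} t \<partial>lborel) < \<infinity>"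
proof -
  define L where "L a = (if a = 0 then \<infinity> else ennreal (max 0 (- ln (cmod a))))" for a :: complex
  define h where "h t = E (of_real t)" for t :: real
  obtain b C where b: "b > 0" and C: "C \<ge> 0" and Jen: "(\<integral>\<^sup>+ \<theta>. L (h (slit_parameter (sqrt (b * tan ((\<theta> - pi) / 2))))) * indicator {pi<..<2*pi} \<theta> \<partial>lborel) \<le> ennreal C"
    using Jensen_slit[OF E le1 nz] unfolding L_def h_def by blast
  have [measurable]: "h \<in> borel_measurable borel"
    unfolding h_def by (intro borel_measurable_continuous_onI continuous_on_real_line E)
  have [measurable]: "L \<in> borel_measurable borel" unfolding L_def by measurable
  have [measurable]: "slit_parameter \<in> borel_measurable borel" unfolding slit_parameter_def[abs_def] by measurable
  define \<Phi> where "\<Phi> \<theta> = L (h (slit_parameter (sqrt (b * tan ((\<theta> - pi) / 2))))) * indicator {pi<..<2*pi} \<theta>" for \<theta>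
  have \<Phi>_meas: "\<Phi> \<in> borel_measurable borel" unfolding \<Phi>_def tan_def by measurable
  define \<theta> where "\<theta> s = pi + 2 * arctan (s\<^sup>2 / b)" for s
  define \<theta>' where "\<theta>' s = 4 * s * b / (b\<^sup>2 + s^4)" for s
  define \<tau>' where "\<tau>' s = 4 * s^3 + 6 * s^2" for s :: real
  define f where "f t = log_integrand (\<lambda>t. cmod (h t)) t * indicator {1..} t" for t
  have f_alt: "f t = (if h t = 0 then \<infinity> else ennreal (t powr (-3/2) * max 0 (- ln (cmod (h t))))) * indicator {1..} t" for t
    by (simp add: f_def log_integrand_def)
  have f_meas: "f \<in> borel_measurable borel" unfolding f_alt[abs_def] by measurable
  define K where "K = 150 * (b\<^sup>2 + 1) / (4 * b)"
  have K: "K \<ge> 0" using b by (simp add: K_def)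
  have \<Phi>\<theta>: "\<Phi> (\<theta> s) = L (h (slit_parameter s))" if "s \<ge> 1" for s
  proof -
    have "s\<^sup>2 / b > 0" using that b by simp
    then have "arctan (s\<^sup>2 / b) > 0" by simp
    moreover have "arctan (s\<^sup>2 / b) < pi / 2" by (rule arctan_ubound)
    ultimately have "\<theta> s \<in> {pi<..<2*pi}" by (auto simp: \<theta>_def)
    moreover have "sqrt (b * tan ((\<theta> s - pi) / 2)) = s"
      using that b by (simp add: \<theta>_def tan_arctan)
    ultimately show ?thesis by (simp add: \<Phi>_def)
  qed
  have pointwise: "f (slit_parameter s) * ennreal (\<tau>' s) \<le> ennreal K * (\<Phi> (\<theta> s) * ennreal (\<theta>' s))" if s: "s \<ge> 1" for s
  proof (cases "slit_parameter s \<ge> 1")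
    case True
    define m where "m = max 0 (- ln (cmod (h (slit_parameter s))))"
    have m: "m \<ge> 0" by (simp add: m_def)
    have th: "\<theta>' s > 0" using s b by (auto simp: \<theta>'_def intro!: divide_pos_pos mult_pos_pos add_pos_nonneg)
    have K': "K > 0" using b by (auto simp: K_def intro!: divide_pos_pos add_nonneg_pos)
    have ta: "\<tau>' s \<ge> 0" using s by (simp add: \<tau>'_def)
    have le: "slit_parameter s powr (-3/2) * \<tau>' s \<le> K * \<theta>' s"
      unfolding \<tau>'_def K_def \<theta>'_def by (rule slit_density_le[OF b s True])
    show ?thesis
    proof (cases "h (slit_parameter s) = 0")
      case True
      then show ?thesis using \<Phi>\<theta>[OF s] th K' by (simp add: L_def ennreal_mult_eq_top_iff ennreal_top_mult ennreal_mult_top)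
    next
      case False
      have "f (slit_parameter s) * ennreal (\<tau>' s) = ennreal (slit_parameter s powr (-3/2) * m) * ennreal (\<tau>' s)"
        using False True by (simp add: f_alt m_def)
      also have "\<dots> = ennreal (slit_parameter s powr (-3/2) * m * \<tau>' s)"
        by (rule ennreal_mult[symmetric]) (use m ta in auto)
      also have "\<dots> = ennreal (m * (slit_parameter s powr (-3/2) * \<tau>' s))" by (simp only: mult_ac)
      also have "\<dots> \<le> ennreal (m * (K * \<theta>' s))" using le m by (intro ennreal_leI mult_left_mono)
      also have "\<dots> = ennreal (K * (m * \<theta>' s))" by (simp only: mult_ac)
      also have "\<dots> = ennreal K * ennreal (m * \<theta>' s)" by (rule ennreal_mult) (use m K th in auto)
      also have "ennreal (m * \<theta>' s) = ennreal m * ennreal (\<theta>' s)" by (rule ennreal_mult) (use m th in auto)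
      also have "ennreal m = \<Phi> (\<theta> s)" using False \<Phi>\<theta>[OF s] by (simp add: L_def m_def)
      finally show ?thesis .
    qed
  next
    case False
    then show ?thesis by (simp add: f_def)
  qed
  \<comment> \<open>The substitutions are made on bounded intervals with a bound independent of
    \<open>n\<close>, and Fatou's lemma removes the truncation. The lower end
    \<open>slit_parameter 1 = -1\<close> lies below the support of \<open>f\<close>.\<close>
  have bound: "(\<integral>\<^sup>+ t. f t * indicator {slit_parameter 1..slit_parameter (real n + 2)} t \<partial>lborel) \<le> ennreal (K * C)" for n :: nat
  proof -
    have n: "(1::real) < real n + 2" by simp
    have "(\<integral>\<^sup>+ t. f t * indicator {slit_parameter 1..slit_parameter (real n + 2)} t \<partial>lborel)
      = (\<integral>\<^sup>+ s. f (slit_parameter s) * ennreal (\<tau>' s) * indicator {1..real n + 2} s \<partial>lborel)"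
    proof (rule nn_integral_substitution_aux[OF f_meas _ _ _ _ n])
      show "(slit_parameter has_real_derivative \<tau>' s) (at s)" for s
        unfolding slit_parameter_def[abs_def] \<tau>'_def by (auto intro!: derivative_eq_intros)
      show "continuous_on {1..real n + 2} \<tau>'" unfolding \<tau>'_def by (intro continuous_intros)
      show "\<tau>' s \<ge> 0" if "s \<in> {1..real n + 2}" for s using that by (simp add: \<tau>'_def)
    qed simp
    also have "\<dots> \<le> (\<integral>\<^sup>+ s. ennreal K * (\<Phi> (\<theta> s) * ennreal (\<theta>' s) * indicator {1..real n + 2} s) \<partial>lborel)"
      using pointwise by (intro nn_integral_mono) (auto simp: indicator_def)
    also have "\<dots> = ennreal K * (\<integral>\<^sup>+ s. \<Phi> (\<theta> s) * ennreal (\<theta>' s) * indicator {1..real n + 2} s \<partial>lborel)"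
    proof (rule nn_integral_cmult)
      have [measurable]: "\<theta> \<in> borel_measurable borel" "\<theta>' \<in> borel_measurable borel"
        unfolding \<theta>_def[abs_def] \<theta>'_def[abs_def] by measurable
      note [measurable] = \<Phi>_meas
      show "(\<lambda>s. \<Phi> (\<theta> s) * ennreal (\<theta>' s) * indicator {1..real n + 2} s) \<in> borel_measurable lborel" by measurable
    qed
    also have "(\<integral>\<^sup>+ s. \<Phi> (\<theta> s) * ennreal (\<theta>' s) * indicator {1..real n + 2} s \<partial>lborel)
      = (\<integral>\<^sup>+ x. \<Phi> x * indicator {\<theta> 1..\<theta> (real n + 2)} x \<partial>lborel)"
    proof (rule nn_integral_substitution_aux[OF \<Phi>_meas _ _ _ _ n, symmetric])
      show "(\<theta> has_real_derivative \<theta>' s) (at s)" for s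
      proof -
        have "(\<theta> has_real_derivative 2 * (inverse (1 + (s\<^sup>2 / b)\<^sup>2) * (2 * s / b))) (at s)"
          unfolding \<theta>_def[abs_def] using b by (auto intro!: derivative_eq_intros)
        also have "2 * (inverse (1 + (s\<^sup>2 / b)\<^sup>2) * (2 * s / b)) = \<theta>' s"
        proof -
          have "1 + (s\<^sup>2 / b)\<^sup>2 = (b\<^sup>2 + s^4) / b\<^sup>2" using b by (simp add: power_divide add_divide_distrib)
          then show ?thesis using b by (simp add: \<theta>'_def power2_eq_square)
        qed
        finally show ?thesis .
      qed
      show "continuous_on {1..real n + 2} \<theta>'" unfolding \<theta>'_def using b
        by (intro continuous_intros) (auto simp: add_nonneg_eq_0_iff)
      show "\<theta>' s \<ge> 0" if "s \<in> {1..real n + 2}" for s using that b by (simp add: \<theta>'_def)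
    qed simp
    also have "\<dots> \<le> (\<integral>\<^sup>+ x. \<Phi> x \<partial>lborel)" by (intro nn_integral_mono) (auto simp: indicator_def)
    also have "\<dots> \<le> ennreal C" using Jen by (simp add: \<Phi>_def)
    also have "ennreal K * ennreal C = ennreal (K * C)" using K C by (simp add: ennreal_mult)
    finally show ?thesis by (simp add: mult_left_mono)
  qed
  have "(\<integral>\<^sup>+ t. f t \<partial>lborel) \<le> (\<integral>\<^sup>+ t. liminf (\<lambda>n. f t * indicator {slit_parameter 1..slit_parameter (real n + 2)} t) \<partial>lborel)"
  proof (intro nn_integral_mono)
    fix t
    have "(\<lambda>n. f t * indicator {slit_parameter 1..slit_parameter (real n + 2)} t) \<longlonglongrightarrow> f t"
    proof (cases "t \<ge> 1")
      case True
      have "\<forall>\<^sub>F n in sequentially. slit_parameter (real n + 2) \<ge> t" unfolding slit_parameter_def by real_asymp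
      then have "\<forall>\<^sub>F n in sequentially. f t * indicator {slit_parameter 1..slit_parameter (real n + 2)} t = f t"
        by eventually_elim (use True in \<open>simp add: slit_parameter_def\<close>)
      then show ?thesis by (rule tendsto_eventually)
    qed (simp add: f_def)
    from lim_imp_Liminf[OF _ this] show "f t \<le> liminf (\<lambda>n. f t * indicator {slit_parameter 1..slit_parameter (real n + 2)} t)" by simp
  qed
  also have "\<dots> \<le> liminf (\<lambda>n. \<integral>\<^sup>+ t. f t * indicator {slit_parameter 1..slit_parameter (real n + 2)} t \<partial>lborel)"
    using f_meas by (intro nn_integral_liminf borel_measurable_times_ennreal borel_measurable_indicator) auto
  also have "\<dots> \<le> limsup (\<lambda>n. \<integral>\<^sup>+ t. f t * indicator {slit_parameter 1..slit_parameter (real n + 2)} t \<partial>lborel)"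
    by (rule Liminf_le_Limsup) simp
  also have "\<dots> \<le> ennreal (K * C)"
    using bound by (intro Limsup_bounded always_eventually allI)
  also have "\<dots> < \<infinity>" by simp
  finally show ?thesis by (simp add: f_def h_def)
qed

lemma log_integrand_mono:
  assumes "0 < c" "c \<le> 1" "0 \<le> v t" "v t * c \<le> w t"
  shows "log_integrand w t \<le> log_integrand (\<lambda>t. v t * c) t"
proof (cases "v t = 0")
  case False
  then have vc: "v t * c > 0" using assms(1,3) by (simp add: less_le)
  then have w: "w t > 0" using assms(4) by linarith
  have "- ln (w t) \<le> - ln (v t * c)" using vc w assms(4) by simp
  then have "t powr (-3/2) * max 0 (- ln (w t)) \<le> t powr (-3/2) * max 0 (- ln (v t * c))"
    by (intro mult_left_mono max.mono) auto
  then show ?thesis using vc w unfolding log_integrand_def by (simp add: ennreal_leI)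
qed (use assms in \<open>simp add: log_integrand_def\<close>)

lemma Adm_plus_log_integrable:
  assumes w: "w \<in> Adm_plus B1"
  shows "(\<integral>\<^sup>+ t\<in>{1..}. log_integrand w t \<partial>lborel) < \<infinity>"
proof -
  obtain f where f: "f \<in> model_space B1" "nonzero_on_upper f" "AE x in lebesgue. x > 0 \<longrightarrow> cmod (bv f x) \<le> w x"
    using w by (auto simp: Adm_plus_def)
  obtain E M where E: "E holomorphic_on pole_free" "\<And>z. z \<in> pole_free \<Longrightarrow> cmod (E z) \<le> M" "\<And>z. Im z > 0 \<Longrightarrow> f z = E z"
    using model_space_extension[OF f(1)] by blast
  \<comment> \<open>The maximum with 1 gives \<open>c \<le> 1\<close>, so the normalised function
    stays below \<open>w\<close> as well.\<close>
  define c where "c = 1 / max M 1"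
  have c: "0 < c" "c \<le> 1" by (auto simp: c_def)
  define E' where "E' z = of_real c * E z" for z
  have E': "E' holomorphic_on pole_free" unfolding E'_def by (intro holomorphic_intros E)
  have le1: "cmod (E' z) \<le> 1" if "z \<in> pole_free" for z
  proof -
    have "cmod (E z) \<le> max M 1" using E(2)[OF that] by simp
    then have "c * cmod (E z) \<le> c * max M 1" using c by (intro mult_left_mono) auto
    also have "\<dots> = 1" by (simp add: c_def)
    finally show ?thesis unfolding E'_def using c by (simp add: norm_mult)
  qed
  obtain z1 where z1: "z1 \<in> upper_half" "f z1 \<noteq> 0" using f(2) by (auto simp: nonzero_on_upper_def)
  have nz: "E' z1 \<noteq> 0" using z1 E(3)[of z1] c by (auto simp: E'_def upper_half_def)
  have fin: "(\<integral>\<^sup>+ t. log_integrand (\<lambda>t. cmod (E' (of_real t))) t * indicator {1..} t \<partial>lborel) < \<infinity>"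
    by (rule log_integrability_bounded[OF E' le1 z1(1) nz])
  have bv: "bv f x = E (of_real x)" for x
  proof -
    have "((\<lambda>y. E (Complex x y)) \<longlongrightarrow> E (of_real x)) (at_right 0)" by (rule vertical_limit_real[OF E(1)])
    moreover have "\<forall>\<^sub>F y in at_right (0::real). E (Complex x y) = f (Complex x y)"
      using E(3) unfolding eventually_at_right_field by (intro exI[of _ 1]) auto
    ultimately have "((\<lambda>y. f (Complex x y)) \<longlongrightarrow> E (of_real x)) (at_right 0)" by (rule Lim_transform_eventually)
    then show ?thesis unfolding bv_def by (intro tendsto_Lim) auto
  qed
  have "AE x in lborel. x > 0 \<longrightarrow> cmod (E (of_real x)) \<le> w x"
    using f(3) by (simp add: bv AE_completion_iff)
  then have "AE x in lborel. log_integrand w x * indicator {1..} x \<le> log_integrand (\<lambda>t. cmod (E' (of_real t))) x * indicator {1..} x"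
  proof eventually_elim
    case (elim x)
    show ?case
    proof (cases "x \<ge> 1")
      case True
      have "cmod (E (of_real x)) * c \<le> cmod (E (of_real x)) * 1" using c by (intro mult_left_mono) auto
      also have "\<dots> \<le> w x" using elim True by simp
      finally have "log_integrand w x \<le> log_integrand (\<lambda>t. cmod (E (of_real t)) * c) x"
        by (intro log_integrand_mono c) auto
      then show ?thesis using True c by (simp add: E'_def norm_mult mult.commute)
    qed simp
  qed
  then have "(\<integral>\<^sup>+ t. log_integrand w t * indicator {1..} t \<partial>lborel) \<le> (\<integral>\<^sup>+ t. log_integrand (\<lambda>t. cmod (E' (of_real t))) t * indicator {1..} t \<partial>lborel)"
    by (rule nn_integral_mono_AE)
  also note fin
  finally show ?thesis .
qed

section \<open>Sufficiency\<close>

text \<open>\<open>ln (cmod (1 - x / (k\<^sup>2 - \<i>)))\<close> for real \<open>x\<close>.\<close>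

definition log_factor :: "real \<Rightarrow> nat \<Rightarrow> real" where
  "log_factor x k = ln ((((real k)\<^sup>2 - x)\<^sup>2 + 1) / (((real k)\<^sup>2)\<^sup>2 + 1)) / 2"

definition log_factor_bound :: "real \<Rightarrow> real" where
  "log_factor_bound x = ln (2 * x\<^sup>2 + 2) / 2"

lemma sq_plus_1_pos [simp]: "0 < (a::real)\<^sup>2 + 1"
  by (simp add: add_nonneg_pos)

lemma sq_plus_1_shift: "((t::real) - x)\<^sup>2 + 1 \<le> (2 * x\<^sup>2 + 2) * (t\<^sup>2 + 1)"
proof -
  have "(t - x)\<^sup>2 \<le> 2 * t\<^sup>2 + 2 * x\<^sup>2"
    using zero_le_power2[of "t + x"] by (simp add: power2_eq_square algebra_simps)
  moreover have "(2 * x\<^sup>2 + 2) * (t\<^sup>2 + 1) = 2 * (x\<^sup>2 * t\<^sup>2) + 2 * x\<^sup>2 + 2 * t\<^sup>2 + 2" by (simp add: algebra_simps)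
  moreover have "0 \<le> x\<^sup>2 * t\<^sup>2" by simp
  ultimately show ?thesis by linarith
qed

text \<open>Replacing \<open>t\<close> by \<open>t - x\<close> changes \<open>t\<^sup>2 + 1\<close>
  by at most the factor \<open>2 * x\<^sup>2 + 2\<close> in either direction; the lower bound is the
  upper one for the shift by \<open>-x\<close>.\<close>

lemma abs_log_factor_le: "\<bar>log_factor x k\<bar> \<le> log_factor_bound x"
proof -
  define t where "t = (real k)\<^sup>2"
  have c: "2 * x\<^sup>2 + 2 > 0" by (simp add: add_nonneg_pos)
  have 1: "((t - x)\<^sup>2 + 1) / (t\<^sup>2 + 1) \<le> 2 * x\<^sup>2 + 2"
    using sq_plus_1_shift[of t x] by (simp add: pos_divide_le_eq)
  have "((t - x) - (-x))\<^sup>2 + 1 \<le> (2 * (-x)\<^sup>2 + 2) * ((t - x)\<^sup>2 + 1)" by (rule sq_plus_1_shift)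
  then have 2: "1 / (2 * x\<^sup>2 + 2) \<le> ((t - x)\<^sup>2 + 1) / (t\<^sup>2 + 1)"
    using c by (simp add: divide_simps mult.commute)
  have "ln (((t - x)\<^sup>2 + 1) / (t\<^sup>2 + 1)) \<le> ln (2 * x\<^sup>2 + 2)"
    using 1 by (intro ln_mono divide_pos_pos) auto
  moreover have "ln (1 / (2 * x\<^sup>2 + 2)) \<le> ln (((t - x)\<^sup>2 + 1) / (t\<^sup>2 + 1))"
    using 2 c by (intro ln_mono divide_pos_pos) auto
  moreover have "ln (1 / (2 * x\<^sup>2 + 2)) = - ln (2 * x\<^sup>2 + 2)" using c by (simp add: ln_div)
  ultimately show ?thesis unfolding log_factor_def log_factor_bound_def t_def by linarith
qed

text \<open>\<open>u\<close> falls until \<open>P\<close> first holds and rises afterwards, so its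
  variation is the first value plus the last minus twice the least. The invariant of the rising
  phase keeps the last value \<open>u K\<close> and estimates the rest by
  \<open>3 * L\<close>.\<close>

lemma unimodal_variation_le:
  fixes u :: "nat \<Rightarrow> real"
  assumes b: "\<And>k. \<bar>u k\<bar> \<le> L" and mono: "\<And>k. P k \<Longrightarrow> P (Suc k)"
    and up: "\<And>k. P k \<Longrightarrow> u k \<le> u (Suc k)" and dn: "\<And>k. \<not> P k \<Longrightarrow> u (Suc k) \<le> u k"
  shows "(\<Sum>k<K. \<bar>u (Suc k) - u k\<bar>) \<le> 4 * L"
proof -
  define V where "V K = (\<Sum>k<K. \<bar>u (Suc k) - u k\<bar>)" for K
  have "if (\<exists>k<K. P k) then P K \<and> V K \<le> 3 * L + u K else V K = u 0 - u K"
  proof (induction K)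
    case (Suc K)
    have V: "V (Suc K) = V K + \<bar>u (Suc K) - u K\<bar>" by (simp add: V_def)
    show ?case
    proof (cases "\<exists>k<K. P k")
      case True
      then have "P K" "V K \<le> 3 * L + u K" using Suc by auto
      then show ?thesis using V up[of K] mono[of K] True by (auto intro: less_SucI)
    next
      case False
      then have VK: "V K = u 0 - u K" using Suc by auto
      show ?thesis
      proof (cases "P K")
        case True
        then show ?thesis using V VK up[of K] mono[of K] b[of 0] b[of K] by auto
      next
        case nP: False
        then show ?thesis using V VK dn[of K] False by (auto simp: less_Suc_eq)
      qed
    qed
  qed (simp add: V_def)
  then show ?thesis using b[of 0] b[of K] unfolding V_def by (auto split: if_splits)
qed

text \<open>Cross-multiplying the two quotients leaves \<open>x * (s - t) * c k\<close>, so the sign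
  of \<open>c k\<close> decides the direction.\<close>

lemma log_factor_step_sign:
  assumes x: "x \<ge> 0"
  defines "c \<equiv> \<lambda>k. 2 + x * ((real k)\<^sup>2 + (real (Suc k))\<^sup>2) - 2 * (real k)\<^sup>2 * (real (Suc k))\<^sup>2"
  shows "c k \<le> 0 \<Longrightarrow> log_factor x k \<le> log_factor x (Suc k)" "c k \<ge> 0 \<Longrightarrow> log_factor x (Suc k) \<le> log_factor x k"
proof -
  define t s where "t = (real k)\<^sup>2" and "s = (real (Suc k))\<^sup>2"
  have ts: "t \<le> s" unfolding t_def s_def by (intro power_mono) auto
  have id: "((t - x)\<^sup>2 + 1) * (s\<^sup>2 + 1) - ((s - x)\<^sup>2 + 1) * (t\<^sup>2 + 1) = x * (s - t) * (2 + x * (t + s) - 2 * t * s)"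
    by (simp add: power2_eq_square algebra_simps)
  have ck: "c k = 2 + x * (t + s) - 2 * t * s" by (simp add: c_def t_def s_def)
  have p: "((t - x)\<^sup>2 + 1) / (t\<^sup>2 + 1) > 0" "((s - x)\<^sup>2 + 1) / (s\<^sup>2 + 1) > 0"
    by (intro divide_pos_pos sq_plus_1_pos)+
  { assume "c k \<le> 0"
    then have "x * (s - t) * (2 + x * (t + s) - 2 * t * s) \<le> 0"
      using x ts unfolding ck by (intro mult_nonneg_nonpos) auto
    then have "((t - x)\<^sup>2 + 1) * (s\<^sup>2 + 1) \<le> ((s - x)\<^sup>2 + 1) * (t\<^sup>2 + 1)" using id by linarith
    then have "((t - x)\<^sup>2 + 1) / (t\<^sup>2 + 1) \<le> ((s - x)\<^sup>2 + 1) / (s\<^sup>2 + 1)"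
      by (subst frac_le_eq) (auto simp: divide_le_0_iff mult.commute less_imp_neq[symmetric])
    then show "log_factor x k \<le> log_factor x (Suc k)" using p unfolding log_factor_def t_def s_def by (simp add: ln_mono) }
  { assume "c k \<ge> 0"
    then have "x * (s - t) * (2 + x * (t + s) - 2 * t * s) \<ge> 0"
      using x ts unfolding ck by (intro mult_nonneg_nonneg) auto
    then have "((s - x)\<^sup>2 + 1) * (t\<^sup>2 + 1) \<le> ((t - x)\<^sup>2 + 1) * (s\<^sup>2 + 1)" using id by linarith
    then have "((s - x)\<^sup>2 + 1) / (s\<^sup>2 + 1) \<le> ((t - x)\<^sup>2 + 1) / (t\<^sup>2 + 1)"
      by (subst frac_le_eq) (auto simp: divide_le_0_iff mult.commute less_imp_neq[symmetric])
    then show "log_factor x (Suc k) \<le> log_factor x k" using p unfolding log_factor_def t_def s_def by (simp add: ln_mono) }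
qed

text \<open>For fixed \<open>x \<ge> 0\<close> the quotient
  \<open>((t - x)\<^sup>2 + 1) / (t\<^sup>2 + 1)\<close> first falls and then rises on
  \<open>t \<ge> 0\<close>; in discrete form, the sign condition of
  \<open>log_factor_step_sign\<close> persists once it holds.\<close>

lemma log_factor_variation:
  assumes x: "x \<ge> 0"
  shows "(\<Sum>k<K. \<bar>log_factor x (Suc k) - log_factor x k\<bar>) \<le> 4 * log_factor_bound x"
proof (rule unimodal_variation_le[where P="\<lambda>k. 2 + x * ((real k)\<^sup>2 + (real (Suc k))\<^sup>2) - 2 * (real k)\<^sup>2 * (real (Suc k))\<^sup>2 \<le> 0"])
  fix k assume a: "2 + x * ((real k)\<^sup>2 + (real (Suc k))\<^sup>2) - 2 * (real k)\<^sup>2 * (real (Suc k))\<^sup>2 \<le> 0"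
  define t s r where "t = (real k)\<^sup>2" and "s = (real (Suc k))\<^sup>2" and "r = (real (Suc (Suc k)))\<^sup>2"
  have o: "0 \<le> t" "t \<le> s" "s \<le> r" "0 < s" unfolding t_def s_def r_def by (auto intro!: power_mono)
  have h: "2 + x * (t + s) \<le> 2 * t * s" using a by (simp add: t_def s_def)
  \<comment> \<open>After multiplication by \<open>t + s\<close> the hypothesis, which bounds
    \<open>2 + x * (t + s)\<close>, can be inserted; what remains are nonnegative multiples of
    \<open>r - t\<close>.\<close>
  have "(2 + x * (s + r)) * (t + s) \<le> (2 * s * r) * (t + s)"
  proof -
    have "(2 * s * r) * (t + s) - (2 + x * (s + r)) * (t + s) =
      (2 * t * s - (2 + x * (t + s))) * (s + r) + 2 * (s * s) * (r - t) + 2 * (r - t)"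
      by (simp add: algebra_simps)
    moreover have "(2 * t * s - (2 + x * (t + s))) * (s + r) \<ge> 0" using h o by (intro mult_nonneg_nonneg) auto
    moreover have "2 * (s * s) * (r - t) \<ge> 0" using o by (intro mult_nonneg_nonneg) auto
    moreover have "2 * (r - t) \<ge> 0" using o by simp
    ultimately show ?thesis by linarith
  qed
  then have "2 + x * (s + r) \<le> 2 * s * r" using o by (simp add: mult_le_cancel_right)
  then show "2 + x * ((real (Suc k))\<^sup>2 + (real (Suc (Suc k)))\<^sup>2) - 2 * (real (Suc k))\<^sup>2 * (real (Suc (Suc k)))\<^sup>2 \<le> 0"
    by (simp only: s_def r_def)
next
  fix k assume "2 + x * ((real k)\<^sup>2 + (real (Suc k))\<^sup>2) - 2 * (real k)\<^sup>2 * (real (Suc k))\<^sup>2 \<le> 0"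
  then show "log_factor x k \<le> log_factor x (Suc k)" by (rule log_factor_step_sign(1)[OF x])
next
  fix k assume "\<not> 2 + x * ((real k)\<^sup>2 + (real (Suc k))\<^sup>2) - 2 * (real k)\<^sup>2 * (real (Suc k))\<^sup>2 \<le> 0"
  then show "log_factor x (Suc k) \<le> log_factor x k" by (intro log_factor_step_sign(2)[OF x]) linarith
qed (rule abs_log_factor_le)

text \<open>The modulus of the sine is at least \<open>sinh \<bar>Im z\<bar>\<close>, and
  \<open>sinh b \<ge> b\<close> for \<open>b \<ge> 0\<close>.\<close>

lemma cmod_sin_ge: "\<bar>Im z\<bar> \<le> cmod (sin z)"
proof -
  define b where "b = \<bar>Im z\<bar>"
  have "exp (2 * Im z) + inverse (exp (2 * Im z)) = exp (2 * b) + inverse (exp (2 * b))"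
    by (cases "Im z \<ge> 0") (auto simp: b_def exp_minus)
  then have "(cmod (sin z))\<^sup>2 = (exp (2 * b) + inverse (exp (2 * b)) - 2 * cos (2 * Re z)) / 4"
    by (simp add: norm_sin_squared)
  also have "\<dots> \<ge> (exp (2 * b) + inverse (exp (2 * b)) - 2) / 4" by simp
  also have "(exp (2 * b) + inverse (exp (2 * b)) - 2) / 4 = ((exp b - exp (- b)) / 2)\<^sup>2"
  proof -
    have "exp b * exp (- b) = 1" by (simp flip: exp_add)
    moreover have "exp (2 * b) = (exp b)\<^sup>2" "inverse (exp (2 * b)) = (exp (- b))\<^sup>2"
      by (simp_all add: exp_double exp_minus power_inverse)
    ultimately show ?thesis by (simp add: power_divide power2_diff)
  qed
  finally have "((exp b - exp (- b)) / 2)\<^sup>2 \<le> (cmod (sin z))\<^sup>2" .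
  then have 1: "(exp b - exp (- b)) / 2 \<le> cmod (sin z)" by (rule power2_le_imp_le) simp
  have "b \<le> (exp b - exp (- b)) / 2"
  proof -
    have "b \<le> sinh b"
    proof -
      have "sinh 0 - 0 \<le> sinh b - b"
      proof (rule DERIV_nonneg_imp_nondecreasing[of 0 b "\<lambda>x. sinh x - x"])
        fix y :: real
        have "cosh y \<ge> 1" by (rule cosh_real_ge_1)
        then show "\<exists>d. ((\<lambda>x. sinh x - x) has_real_derivative d) (at y) \<and> 0 \<le> d"
          by (intro exI[of _ "cosh y - 1"]) (auto intro!: derivative_eq_intros)
      qed (simp add: b_def)
      then show ?thesis by simp
    qed
    then show ?thesis by (simp add: sinh_def)
  qed
  with 1 show ?thesis by (simp add: b_def)
qed

lemma sin_product_norm: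
  assumes z: "z \<noteq> 0"
  shows "(\<lambda>n. \<Prod>k=1..n. cmod (1 - z\<^sup>2 / (of_nat k)\<^sup>2)) \<longlonglongrightarrow> cmod (sin (of_real pi * z)) / (pi * cmod z)"
proof -
  have "(\<lambda>n. cmod (of_real pi * z * (\<Prod>k=1..n. 1 - z^2 / of_nat k^2)) / (pi * cmod z)) \<longlonglongrightarrow> cmod (sin (of_real pi * z)) / (pi * cmod z)"
    by (intro tendsto_intros sin_product_formula_complex) (use z in auto)
  moreover have "cmod (of_real pi * z * (\<Prod>k=1..n. 1 - z^2 / of_nat k^2)) / (pi * cmod z) = (\<Prod>k=1..n. cmod (1 - z\<^sup>2 / (of_nat k)\<^sup>2))" for n
    using z by (simp add: norm_mult prod_norm)
  ultimately show ?thesis by simp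
qed

text \<open>\<open>1 - x / (k\<^sup>2 - \<i>) = (1 - \<zeta>\<^sup>2 / k\<^sup>2) / (1 - \<omega>\<^sup>2 / k\<^sup>2)\<close> for \<open>\<zeta>\<^sup>2 = x + \<i>\<close> and \<open>\<omega>\<^sup>2 = \<i>\<close>.\<close>

lemma log_factor_sum_limit:
  obtains C0 where "C0 \<ge> 0" "\<And>x. x \<ge> 0 \<Longrightarrow> \<exists>T. (\<lambda>M. \<Sum>k=1..M. log_factor x k) \<longlonglongrightarrow> T \<and> T \<ge> - (C0 + ln (x\<^sup>2 + 1) / 2)"
proof -
  define \<omega> where "\<omega> = csqrt \<i>"
  have \<omega>2: "\<omega>\<^sup>2 = \<i>" by (simp only: \<omega>_def power2_csqrt)
  have Im_csqrt: "2 * Re (csqrt z) * Im (csqrt z) = Im z" for z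
    using arg_cong[OF power2_csqrt[of z], of Im] by (simp add: power2_eq_square mult_ac del: csqrt.simps)
  \<comment> \<open>\<open>2 * Re \<zeta> * Im \<zeta> = 1\<close> keeps \<open>\<zeta>\<close> at
    height at least \<open>1 / (2 * cmod \<zeta>)\<close> above the real zeros of the sine, so the
    loss is only polynomial in \<open>x\<close>.\<close>
  have lower: "cmod (sin (of_real pi * csqrt (of_real x + \<i>))) / (pi * cmod (csqrt (of_real x + \<i>))) \<ge> 1 / (2 * sqrt (x\<^sup>2 + 1))" for x
  proof -
    define \<zeta> where "\<zeta> = csqrt (of_real x + \<i>)"
    have \<zeta>2: "\<zeta>\<^sup>2 = of_real x + \<i>" by (simp add: \<zeta>_def del: csqrt.simps)
    have n2: "(cmod \<zeta>)\<^sup>2 = sqrt (x\<^sup>2 + 1)"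
    proof -
      have "(cmod \<zeta>)\<^sup>2 = cmod (of_real x + \<i>)" unfolding \<zeta>2[symmetric] by (rule norm_power[symmetric])
      then show ?thesis by (simp add: cmod_def)
    qed
    have n0: "cmod \<zeta> > 0"
    proof -
      have "(cmod \<zeta>)\<^sup>2 > 0" unfolding n2 by simp
      then show ?thesis by (cases "\<zeta> = 0") auto
    qed
    have im: "2 * Re \<zeta> * Im \<zeta> = 1" using Im_csqrt[of "of_real x + \<i>"] by (simp add: \<zeta>_def del: csqrt.simps)
    have "1 = \<bar>2 * Re \<zeta> * Im \<zeta>\<bar>" by (simp add: im)
    also have "\<dots> = 2 * \<bar>Re \<zeta>\<bar> * \<bar>Im \<zeta>\<bar>" by (simp add: abs_mult)
    also have "\<dots> \<le> 2 * cmod \<zeta> * \<bar>Im \<zeta>\<bar>" by (intro mult_right_mono mult_left_mono abs_Re_le_cmod) auto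
    finally have "1 / (2 * cmod \<zeta>) \<le> \<bar>Im \<zeta>\<bar>" using n0 by (simp add: divide_le_eq mult_ac)
    moreover have "pi * \<bar>Im \<zeta>\<bar> \<le> cmod (sin (of_real pi * \<zeta>))"
      using cmod_sin_ge[of "of_real pi * \<zeta>"] by (simp add: abs_mult)
    ultimately have "pi * (1 / (2 * cmod \<zeta>)) \<le> cmod (sin (of_real pi * \<zeta>))"
      by (meson mult_left_mono order_trans pi_ge_zero)
    then have "pi * (1 / (2 * cmod \<zeta>)) / (pi * cmod \<zeta>) \<le> cmod (sin (of_real pi * \<zeta>)) / (pi * cmod \<zeta>)"
      using n0 by (intro divide_right_mono) auto
    moreover have "pi * (1 / (2 * cmod \<zeta>)) / (pi * cmod \<zeta>) = 1 / (2 * (cmod \<zeta>)\<^sup>2)"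
      by (simp add: power2_eq_square)
    ultimately have "1 / (2 * sqrt (x\<^sup>2 + 1)) \<le> cmod (sin (of_real pi * \<zeta>)) / (pi * cmod \<zeta>)"
      by (simp only: n2)
    then show ?thesis unfolding \<zeta>_def .
  qed
  define c1 where "c1 = cmod (sin (of_real pi * \<omega>)) / (pi * cmod \<omega>)"
  have "1 / (2 * sqrt (0\<^sup>2 + 1)) \<le> c1"
    using lower[of 0] by (simp only: c1_def \<omega>_def of_real_0 add_0)
  then have c1: "c1 > 0" by (rule order.strict_trans2[rotated]) simp
  define C0 where "C0 = ln 2 + \<bar>ln c1\<bar>"
  have "\<exists>T. (\<lambda>M. \<Sum>k=1..M. log_factor x k) \<longlonglongrightarrow> T \<and> T \<ge> - (C0 + ln (x\<^sup>2 + 1) / 2)" if x: "x \<ge> 0" for x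
  proof -
    define \<zeta> where "\<zeta> = csqrt (of_real x + \<i>)"
    have \<zeta>2: "\<zeta>\<^sup>2 = of_real x + \<i>" by (simp add: \<zeta>_def del: csqrt.simps)
    define c2 where "c2 = cmod (sin (of_real pi * \<zeta>)) / (pi * cmod \<zeta>)"
    have c2': "c2 \<ge> 1 / (2 * sqrt (x\<^sup>2 + 1))" unfolding c2_def \<zeta>_def by (rule lower)
    have c2: "c2 > 0" using c2' by (rule order.strict_trans2[rotated]) simp
    have nz: "\<zeta> \<noteq> 0" "\<omega> \<noteq> 0" using \<zeta>2 \<omega>2 by (auto simp: complex_eq_iff)
    have "(\<lambda>n. (\<Prod>k=1..n. cmod (1 - \<zeta>\<^sup>2 / (of_nat k)\<^sup>2)) / (\<Prod>k=1..n. cmod (1 - \<omega>\<^sup>2 / (of_nat k)\<^sup>2))) \<longlonglongrightarrow> c2 / c1"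
      unfolding c1_def c2_def by (intro tendsto_divide sin_product_norm nz) (use c1 in \<open>auto simp: c1_def\<close>)
    then have "(\<lambda>n. ln ((\<Prod>k=1..n. cmod (1 - \<zeta>\<^sup>2 / (of_nat k)\<^sup>2)) / (\<Prod>k=1..n. cmod (1 - \<omega>\<^sup>2 / (of_nat k)\<^sup>2)))) \<longlonglongrightarrow> ln (c2 / c1)"
      using c1 c2 by (intro tendsto_ln) auto
    moreover have "ln ((\<Prod>k=1..n. cmod (1 - \<zeta>\<^sup>2 / (of_nat k)\<^sup>2)) / (\<Prod>k=1..n. cmod (1 - \<omega>\<^sup>2 / (of_nat k)\<^sup>2))) = (\<Sum>k=1..n. log_factor x k)" for n
    proof -
      have trm: "cmod (1 - \<zeta>\<^sup>2 / (of_nat k)\<^sup>2) / cmod (1 - \<omega>\<^sup>2 / (of_nat k)\<^sup>2) = exp (log_factor x k)" if k: "k \<ge> 1" for k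
      proof -
        have k0: "(of_nat k)\<^sup>2 \<noteq> (0::complex)" using k by simp
        have e1: "1 - \<zeta>\<^sup>2 / (of_nat k)\<^sup>2 = ((of_nat k)\<^sup>2 - of_real x - \<i>) / (of_nat k)\<^sup>2" unfolding \<zeta>2 using k0 by (simp add: diff_divide_distrib add_divide_distrib)
        have e2: "1 - \<omega>\<^sup>2 / (of_nat k)\<^sup>2 = ((of_nat k)\<^sup>2 - \<i>) / (of_nat k)\<^sup>2" unfolding \<omega>2 using k0 by (simp add: diff_divide_distrib)
        have cc: "(of_nat k)\<^sup>2 - of_real x - \<i> = Complex ((real k)\<^sup>2 - x) (-1)" "(of_nat k)\<^sup>2 - \<i> = Complex ((real k)\<^sup>2) (-1)"
          by (simp_all add: complex_eq_iff flip: of_nat_power)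
        have "cmod (1 - \<zeta>\<^sup>2 / (of_nat k)\<^sup>2) / cmod (1 - \<omega>\<^sup>2 / (of_nat k)\<^sup>2) = cmod ((of_nat k)\<^sup>2 - of_real x - \<i>) / cmod ((of_nat k)\<^sup>2 - \<i>)"
          unfolding e1 e2 norm_divide using k0 by simp
        also have "\<dots> = sqrt ((((real k)\<^sup>2 - x)\<^sup>2 + 1) / (((real k)\<^sup>2)\<^sup>2 + 1))"
          unfolding cc by (simp add: cmod_def real_sqrt_divide)
        also have "\<dots> = exp (log_factor x k)"
        proof -
          have p: "(((real k)\<^sup>2 - x)\<^sup>2 + 1) / (((real k)\<^sup>2)\<^sup>2 + 1) > 0" by (intro divide_pos_pos sq_plus_1_pos)
          then show ?thesis unfolding log_factor_def ln_sqrt[OF less_imp_le[OF p], symmetric]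
            by (intro exp_ln[symmetric]) (simp only: real_sqrt_gt_0_iff)
        qed
        finally show ?thesis .
      qed
      have "(\<Prod>k=1..n. cmod (1 - \<zeta>\<^sup>2 / (of_nat k)\<^sup>2)) / (\<Prod>k=1..n. cmod (1 - \<omega>\<^sup>2 / (of_nat k)\<^sup>2)) = (\<Prod>k=1..n. exp (log_factor x k))"
        unfolding prod_dividef[symmetric] by (intro prod.cong trm) auto
      also have "\<dots> = exp (\<Sum>k=1..n. log_factor x k)" by (simp add: exp_sum)
      finally show ?thesis by simp
    qed
    ultimately have lim: "(\<lambda>n. \<Sum>k=1..n. log_factor x k) \<longlonglongrightarrow> ln (c2 / c1)" by simp
    have "ln (1 / (2 * sqrt (x\<^sup>2 + 1))) \<le> ln c2" using c2' by (intro ln_mono) auto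
    moreover have "ln (1 / (2 * sqrt (x\<^sup>2 + 1))) = - (ln 2 + ln (x\<^sup>2 + 1) / 2)"
    proof -
      have "ln (1 / (2 * sqrt (x\<^sup>2 + 1))) = - ln (2 * sqrt (x\<^sup>2 + 1))" by (simp add: ln_div add_nonneg_eq_0_iff)
      also have "ln (2 * sqrt (x\<^sup>2 + 1)) = ln 2 + ln (sqrt (x\<^sup>2 + 1))" by (rule ln_mult_pos) auto
      also have "ln (sqrt (x\<^sup>2 + 1)) = ln (x\<^sup>2 + 1) / 2" by (rule ln_sqrt) simp
      finally show ?thesis .
    qed
    moreover have "ln (c2 / c1) = ln c2 - ln c1" using c1 c2 by (simp add: ln_div)
    ultimately have "ln (c2 / c1) \<ge> - (C0 + ln (x\<^sup>2 + 1) / 2)" unfolding C0_def by linarith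
    with lim show ?thesis by blast
  qed
  moreover have "C0 \<ge> 0" by (simp add: C0_def)
  ultimately show ?thesis using that by blast
qed

text \<open>The modulus of the factor crosses 1 at \<open>x = 2 * k\<^sup>2\<close>, which is as far
  from \<open>k\<^sup>2\<close> as 0 is.\<close>

lemma log_factor_nonneg:
  assumes "2 * (real k)\<^sup>2 \<le> x" shows "log_factor x k \<ge> 0"
proof -
  define t where "t = (real k)\<^sup>2"
  have "t * (2 * t) \<le> t * x" using assms by (intro mult_left_mono) (auto simp: t_def)
  moreover have "0 \<le> (x - 2 * t) * x" using assms by (intro mult_nonneg_nonneg) (auto simp: t_def intro: order.trans[rotated])
  ultimately have "t\<^sup>2 + 1 \<le> (t - x)\<^sup>2 + 1" by (simp add: power2_eq_square algebra_simps)
  then have "1 \<le> ((t - x)\<^sup>2 + 1) / (t\<^sup>2 + 1)" by (simp add: pos_le_divide_eq)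
  then show ?thesis unfolding log_factor_def t_def by simp
qed

lemma log_factor_nonpos:
  assumes "x \<ge> 0" "x \<le> 2 * (real k)\<^sup>2" shows "log_factor x k \<le> 0"
proof -
  define t where "t = (real k)\<^sup>2"
  have "0 \<le> (2 * t - x) * x" using assms by (intro mult_nonneg_nonneg) (auto simp: t_def)
  then have "(t - x)\<^sup>2 + 1 \<le> t\<^sup>2 + 1" by (simp add: power2_eq_square algebra_simps)
  then have "((t - x)\<^sup>2 + 1) / (t\<^sup>2 + 1) \<le> 1" by (simp add: pos_divide_le_eq)
  moreover have "((t - x)\<^sup>2 + 1) / (t\<^sup>2 + 1) > 0" by (intro divide_pos_pos sq_plus_1_pos)
  ultimately have "ln (((t - x)\<^sup>2 + 1) / (t\<^sup>2 + 1)) \<le> 0" by (simp only: ln_le_zero_iff)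
  then show ?thesis unfolding log_factor_def t_def by simp
qed

lemma log_factor_tail:
  assumes x: "x \<ge> 0" "x \<le> (real k)\<^sup>2" and k: "k \<ge> 1" shows "log_factor x k \<le> - (x / 4) / (real k)\<^sup>2"
proof -
  define t where "t = (real k)\<^sup>2"
  have t: "t \<ge> 1" "x \<le> t" using k x by (auto simp: t_def)
  define r where "r = (2 * t * x - x\<^sup>2) / (t\<^sup>2 + 1)"
  have p: "((t - x)\<^sup>2 + 1) / (t\<^sup>2 + 1) > 0" by (intro divide_pos_pos sq_plus_1_pos)
  have t1: "t\<^sup>2 + 1 \<noteq> 0" using sq_plus_1_pos[of t] by linarith
  have "(t - x)\<^sup>2 + 1 = (t\<^sup>2 + 1) - (2 * t * x - x\<^sup>2)" by (simp add: power2_eq_square algebra_simps)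
  then have eq: "((t - x)\<^sup>2 + 1) / (t\<^sup>2 + 1) = 1 - r" unfolding r_def using t1 by (simp only: diff_divide_distrib divide_self_if if_False)
  have "ln (((t - x)\<^sup>2 + 1) / (t\<^sup>2 + 1)) \<le> (1 - r) - 1" unfolding eq by (rule ln_le_minus_one) (use p eq in simp)
  moreover have "r \<ge> (x / 2) / t"
  proof -
    have "x * x \<le> t * x" using t x by (intro mult_right_mono) auto
    then have a: "t * x \<le> 2 * t * x - x\<^sup>2" by (simp add: power2_eq_square)
    have "0 \<le> t * x" using t x by (intro mult_nonneg_nonneg) auto
    with a have nn: "0 \<le> 2 * t * x - x\<^sup>2" by linarith
    have "1 * 1 \<le> t * t" using t by (intro mult_mono) auto
    then have b: "t\<^sup>2 + 1 \<le> 2 * t\<^sup>2" by (simp add: power2_eq_square)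
    have "(x / 2) / t = (t * x) / (2 * t\<^sup>2)" using t by (simp add: power2_eq_square)
    also have "\<dots> \<le> (2 * t * x - x\<^sup>2) / (t\<^sup>2 + 1)" by (rule frac_le[OF nn a _ b]) simp
    finally show ?thesis by (simp add: r_def)
  qed
  ultimately have "log_factor x k \<le> - ((x / 2) / t) / 2" unfolding log_factor_def t_def by argo
  then show ?thesis by (simp add: t_def)
qed

text \<open>If \<open>2 * K\<^sup>2 \<le> x\<close>, all factors kept have modulus at least 1;
  otherwise all factors removed have modulus at most 1, so the segment is bounded below by the full
  product. When even \<open>x \<le> K\<^sup>2\<close>, the removed logarithms sum to at most
  \<open>- x / 4\<close> times the sum of \<open>1 / k\<^sup>2\<close> over \<open>k > K\<close>,
  which is at least \<open>1 / (K + 1)\<close>.\<close>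

lemma log_factor_partial_sums:
  obtains C0 where "C0 \<ge> 0"
    "\<And>x K. x \<ge> 0 \<Longrightarrow> (\<Sum>k=1..K. log_factor x k) \<ge> - (C0 + ln (x\<^sup>2 + 1) / 2)"
    "\<And>x K. x \<ge> 0 \<Longrightarrow> x \<le> (real K)\<^sup>2 \<Longrightarrow> (\<Sum>k=1..K. log_factor x k) \<ge> x / (4 * (real K + 1)) - (C0 + ln (x\<^sup>2 + 1) / 2)"
proof -
  obtain C0 where C0: "C0 \<ge> 0" "\<And>x. x \<ge> 0 \<Longrightarrow> \<exists>T. (\<lambda>M. \<Sum>k=1..M. log_factor x k) \<longlonglongrightarrow> T \<and> T \<ge> - (C0 + ln (x\<^sup>2 + 1) / 2)"
    using log_factor_sum_limit by blast
  have split: "(\<Sum>k=1..M. log_factor x k) = (\<Sum>k=1..K. log_factor x k) + (\<Sum>k=Suc K..M. log_factor x k)" if "K \<le> M" for x K M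
    using sum.ub_add_nat[where m=1 and n=K and p="M - K" and g="log_factor x"] that by simp
  have A: "(\<Sum>k=1..K. log_factor x k) \<ge> - (C0 + ln (x\<^sup>2 + 1) / 2)" if x: "x \<ge> 0" for x K
  proof (cases "2 * (real K)\<^sup>2 \<le> x")
    case True
    have "(\<Sum>k=1..K. log_factor x k) \<ge> 0"
    proof (intro sum_nonneg log_factor_nonneg)
      fix k assume "k \<in> {1..K}"
      then have "(real k)\<^sup>2 \<le> (real K)\<^sup>2" by (intro power_mono) auto
      then show "2 * (real k)\<^sup>2 \<le> x" using True by linarith
    qed
    moreover have "ln (x\<^sup>2 + 1) \<ge> 0" by simp
    ultimately show ?thesis using C0(1) by linarith
  next
    case False
    obtain T where T: "(\<lambda>M. \<Sum>k=1..M. log_factor x k) \<longlonglongrightarrow> T" "T \<ge> - (C0 + ln (x\<^sup>2 + 1) / 2)" using C0(2)[OF x] by blast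
    have "\<forall>\<^sub>F M in sequentially. (\<Sum>k=1..M. log_factor x k) \<le> (\<Sum>k=1..K. log_factor x k)"
      using eventually_ge_at_top[of K]
    proof eventually_elim
      case (elim M)
      have "(\<Sum>k=Suc K..M. log_factor x k) \<le> 0"
      proof (intro sum_nonpos log_factor_nonpos x)
        fix k assume "k \<in> {Suc K..M}"
        then have "(real K)\<^sup>2 \<le> (real k)\<^sup>2" by (intro power_mono) auto
        then show "x \<le> 2 * (real k)\<^sup>2" using False by linarith
      qed
      then show ?case using split[OF elim, of x] by linarith
    qed
    then have "T \<le> (\<Sum>k=1..K. log_factor x k)" using T(1) by (intro tendsto_upperbound) auto
    then show ?thesis using T(2) by linarith
  qed
  have B: "(\<Sum>k=1..K. log_factor x k) \<ge> x / (4 * (real K + 1)) - (C0 + ln (x\<^sup>2 + 1) / 2)" if x: "x \<ge> 0" "x \<le> (real K)\<^sup>2" for x K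
  proof -
    obtain T where T: "(\<lambda>M. \<Sum>k=1..M. log_factor x k) \<longlonglongrightarrow> T" "T \<ge> - (C0 + ln (x\<^sup>2 + 1) / 2)" using C0(2)[OF x(1)] by blast
    have tel: "(\<Sum>k=Suc K..M. 1 / (real k)\<^sup>2) \<ge> 1 / (real K + 1) - 1 / (real M + 1)" if "K \<le> M" for M
      using that
    proof (induction M rule: dec_induct)
      case (step M)
      have "1 / (real M + 1) - 1 / (real (Suc M) + 1) = 1 / ((real M + 1) * (real M + 2))" by (simp add: field_simps)
      also have "\<dots> \<le> 1 / (real (Suc M))\<^sup>2"
        unfolding power2_eq_square by (intro divide_left_mono mult_mono mult_pos_pos) auto
      finally show ?case using step by simp
    qed simp
    have "\<forall>\<^sub>F M in sequentially. (\<Sum>k=1..M. log_factor x k) + (x / 4) * (1 / (real K + 1) - 1 / (real M + 1)) \<le> (\<Sum>k=1..K. log_factor x k)"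
      using eventually_ge_at_top[of K]
    proof eventually_elim
      case (elim M)
      have "(\<Sum>k=Suc K..M. log_factor x k) \<le> (\<Sum>k=Suc K..M. - (x / 4) / (real k)\<^sup>2)"
      proof (intro sum_mono log_factor_tail x(1))
        fix k assume k: "k \<in> {Suc K..M}"
        then have "(real K)\<^sup>2 \<le> (real k)\<^sup>2" by (intro power_mono) auto
        then show "x \<le> (real k)\<^sup>2" using x by linarith
        show "k \<ge> 1" using k by simp
      qed
      also have "\<dots> = - ((x / 4) * (\<Sum>k=Suc K..M. 1 / (real k)\<^sup>2))" by (simp add: sum_distrib_left sum_negf)
      also have "\<dots> \<le> - ((x / 4) * (1 / (real K + 1) - 1 / (real M + 1)))"
        using tel[OF elim] x(1) by (intro le_imp_neg_le mult_left_mono) auto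
      finally show ?case using split[OF elim, of x] by linarith
    qed
    moreover have "(\<lambda>M. (\<Sum>k=1..M. log_factor x k) + (x / 4) * (1 / (real K + 1) - 1 / (real M + 1))) \<longlonglongrightarrow> T + (x / 4) * (1 / (real K + 1) - 0)"
    proof -
      have "(\<lambda>M. 1 / (real M + 1)) \<longlonglongrightarrow> 0" by real_asymp
      then show ?thesis by (intro tendsto_intros T(1))
    qed
    ultimately have "T + (x / 4) * (1 / (real K + 1) - 0) \<le> (\<Sum>k=1..K. log_factor x k)" by (intro tendsto_upperbound) auto
    moreover have "(x / 4) * (1 / (real K + 1) - 0) = x / (4 * (real K + 1))" by simp
    ultimately show ?thesis using T(2) by linarith
  qed
  show ?thesis using that[OF C0(1) A B] by blast
qed

section \<open>The choice of the set of zeros\<close>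

lemma sum_Abel:
  fixes e u :: "nat \<Rightarrow> real"
  defines "E \<equiv> \<lambda>K. \<Sum>k=1..K. e k"
  shows "(\<Sum>k=1..K. e k * u k) = E K * u K - (\<Sum>k<K. E k * (u (Suc k) - u k))"
proof (induction K)
  case (Suc K)
  have "E (Suc K) = E K + e (Suc K)" by (simp add: E_def)
  then show ?case using Suc by (simp add: algebra_simps)
qed (simp add: E_def)

text \<open>\<open>A\<close> collects the places where the integer part of the partial sums of
  \<open>m\<close> increases; as \<open>m \<le> 1\<close>, it increases by at most 1 at a time. The
  discrepancy is minus the fractional part of a partial sum.\<close>

lemma rounded_weights:
  fixes m :: "nat \<Rightarrow> real"
  assumes m: "\<And>k. 0 \<le> m k" "\<And>k. m k \<le> 1"
  obtains A :: "nat set" where "\<And>K. \<bar>(\<Sum>k=1..K. (if k \<in> A then 1 else 0) - m k)\<bar> \<le> 1"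
proof -
  define S where "S K = (\<Sum>k=1..K. m k)" for K
  have S: "S (Suc K) = S K + m (Suc K)" for K by (simp add: S_def)
  define A where "A = {k. k \<ge> 1 \<and> \<lfloor>S (k - 1)\<rfloor> < \<lfloor>S k\<rfloor>}"
  have step: "(if Suc K \<in> A then 1 else 0) = real_of_int \<lfloor>S (Suc K)\<rfloor> - real_of_int \<lfloor>S K\<rfloor>" for K
  proof -
    have "\<lfloor>S K\<rfloor> \<le> \<lfloor>S (Suc K)\<rfloor>" using S[of K] m(1)[of "Suc K"] by (intro floor_mono) simp
    moreover have "\<lfloor>S (Suc K)\<rfloor> \<le> \<lfloor>S K + 1\<rfloor>" using S[of K] m(2)[of "Suc K"] by (intro floor_mono) simp
    ultimately have "\<lfloor>S (Suc K)\<rfloor> = \<lfloor>S K\<rfloor> \<or> \<lfloor>S (Suc K)\<rfloor> = \<lfloor>S K\<rfloor> + 1" by simp linarith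
    then show ?thesis by (auto simp: A_def)
  qed
  have "(\<Sum>k=1..K. (if k \<in> A then 1 else 0) - m k) = real_of_int \<lfloor>S K\<rfloor> - S K" for K
  proof (induction K)
    case (Suc K)
    then show ?case using step[of K] S[of K] by simp
  qed (simp add: S_def)
  moreover have "\<bar>real_of_int \<lfloor>s\<rfloor> - s\<bar> \<le> 1" for s by linarith
  ultimately show ?thesis using that by metis
qed

text \<open>Giving each initial segment \<open>1..i\<close> the weight \<open>\<delta> i\<close>
  assigns to factor \<open>k\<close> the tail sum \<open>m k\<close>. The segments with
  \<open>y \<le> i \<le> 2 * y\<close> bring the gain of \<open>log_factor_partial_sums\<close>, all
  others are estimated by \<open>- err\<close>, and total weight at most 1 bounds the total loss by
  \<open>err\<close>.\<close>

lemma weighted_log_factor_sum: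
  fixes \<delta> :: "nat \<Rightarrow> real"
  assumes d: "\<And>i. 0 \<le> \<delta> i" "summable \<delta>" "(\<Sum>i. \<delta> i) \<le> 1"
  shows "\<exists>(A :: nat set) C0. C0 \<ge> 0 \<and>
    (\<forall>x y K. x \<ge> 0 \<longrightarrow> x \<le> (real y)\<^sup>2 \<longrightarrow> y \<ge> 1 \<longrightarrow> 2 * y < K \<longrightarrow>
      (\<Sum>k=1..K. if k \<in> A then log_factor x k else 0) \<ge> (\<Sum>i=y..2*y. \<delta> i * (x / (4 * (real i + 1)))) - (C0 + ln (x\<^sup>2 + 1) / 2) - 5 * log_factor_bound x)"
proof -
  obtain C0 where C0: "C0 \<ge> 0"
    "\<And>x K. x \<ge> 0 \<Longrightarrow> (\<Sum>k=1..K. log_factor x k) \<ge> - (C0 + ln (x\<^sup>2 + 1) / 2)"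
    "\<And>x K. x \<ge> 0 \<Longrightarrow> x \<le> (real K)\<^sup>2 \<Longrightarrow> (\<Sum>k=1..K. log_factor x k) \<ge> x / (4 * (real K + 1)) - (C0 + ln (x\<^sup>2 + 1) / 2)"
    using log_factor_partial_sums by blast
  define m where "m k = (\<Sum>i. \<delta> (i + k))" for k
  have sm: "summable (\<lambda>i. \<delta> (i + k))" for k using d(2) by (rule summable_ignore_initial_segment)
  have m0: "m k \<ge> 0" for k unfolding m_def using d(1) sm by (intro suminf_nonneg) auto
  have m_eq: "m k + (\<Sum>i<k. \<delta> i) = (\<Sum>i. \<delta> i)" for k unfolding m_def using suminf_split_initial_segment[OF d(2), of k] by simp
  have m1: "m k \<le> 1" for k using m_eq[of k] d(3) sum_nonneg[of "{..<k}" \<delta>] d(1) by simp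
  have m_step: "m (Suc k) = m k - \<delta> k" for k using m_eq[of k] m_eq[of "Suc k"] by simp
  obtain A where A: "\<And>K. \<bar>(\<Sum>k=1..K. (if k \<in> A then 1 else 0) - m k)\<bar> \<le> 1"
    using rounded_weights[of m] m0 m1 by blast
  have main: "(\<Sum>k=1..K. if k \<in> A then log_factor x k else 0) \<ge> (\<Sum>i=y..2*y. \<delta> i * (x / (4 * (real i + 1)))) - (C0 + ln (x\<^sup>2 + 1) / 2) - 5 * log_factor_bound x"
    if x: "x \<ge> 0" "x \<le> (real y)\<^sup>2" and y: "y \<ge> 1" "2 * y < K" for x y K
  proof -
    define err where "err = C0 + ln (x\<^sup>2 + 1) / 2"
    have err: "err \<ge> 0" using C0(1) by (simp add: err_def)
    define e where "e k = (if k \<in> A then 1 else 0) - m k" for k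
    define Es where "Es K = (\<Sum>k=1..K. e k)" for K
    have Es: "\<bar>Es K\<bar> \<le> 1" for K using A[of K] by (simp add: Es_def e_def)
    define Q where "Q K = (\<Sum>k=1..K. log_factor x k)" for K
    have Q0: "Q K \<ge> - err" for K unfolding Q_def err_def by (rule C0(2)[OF x(1)])
    have Qb: "Q i \<ge> x / (4 * (real i + 1)) - err" if "i \<ge> y" for i
    proof -
      have "(real y)\<^sup>2 \<le> (real i)\<^sup>2" using that by (intro power_mono) auto
      then show ?thesis unfolding Q_def err_def by (intro C0(3)[OF x(1)] order.trans[OF x(2)])
    qed
    \<comment> \<open>Summation by parts moves the rounding error onto the differences of
      \<open>log_factor x\<close>: one boundary term and a variation of at most 4 make up the 5
      times \<open>log_factor_bound x\<close>.\<close>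
    have "(\<Sum>k=1..K. e k * log_factor x k) = Es K * log_factor x K - (\<Sum>k<K. Es k * (log_factor x (Suc k) - log_factor x k))"
      unfolding Es_def by (rule sum_Abel)
    moreover have "\<bar>Es K * log_factor x K\<bar> \<le> 1 * log_factor_bound x" unfolding abs_mult by (intro mult_mono Es abs_log_factor_le) auto
    moreover have "\<bar>\<Sum>k<K. Es k * (log_factor x (Suc k) - log_factor x k)\<bar> \<le> 4 * log_factor_bound x"
    proof -
      have "\<bar>\<Sum>k<K. Es k * (log_factor x (Suc k) - log_factor x k)\<bar> \<le> (\<Sum>k<K. \<bar>Es k * (log_factor x (Suc k) - log_factor x k)\<bar>)" by (rule sum_abs)
      also have "\<dots> \<le> (\<Sum>k<K. 1 * \<bar>log_factor x (Suc k) - log_factor x k\<bar>)" unfolding abs_mult by (intro sum_mono mult_right_mono Es) auto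
      also have "\<dots> \<le> 4 * log_factor_bound x" using log_factor_variation[OF x(1), of K] by simp
      finally show ?thesis .
    qed
    ultimately have 1: "(\<Sum>k=1..K. e k * log_factor x k) \<ge> - (5 * log_factor_bound x)" by linarith
    have "(\<Sum>k=1..K. m k * log_factor x k) = (\<Sum>k=1..K. log_factor x k * m k)" by (simp add: mult.commute)
    also have "\<dots> = Q K * m K - (\<Sum>k<K. Q k * (m (Suc k) - m k))" unfolding Q_def by (rule sum_Abel)
    also have "\<dots> = Q K * m K + (\<Sum>k<K. \<delta> k * Q k)" by (simp add: m_step sum_negf mult.commute)
    also have "\<dots> \<ge> - err * m K + (\<Sum>k<K. \<delta> k * ((if k \<in> {y..2*y} then x / (4 * (real k + 1)) else 0) - err))"
      using Q0 Qb d(1) m0 by (intro add_mono sum_mono mult_left_mono mult_right_mono) auto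
    also have "- err * m K + (\<Sum>k<K. \<delta> k * ((if k \<in> {y..2*y} then x / (4 * (real k + 1)) else 0) - err))
      = (\<Sum>k<K. \<delta> k * (if k \<in> {y..2*y} then x / (4 * (real k + 1)) else 0)) - err * (m K + (\<Sum>k<K. \<delta> k))"
      by (simp add: right_diff_distrib sum_subtractf distrib_left sum_distrib_left mult.commute)
    also have "(\<Sum>k<K. \<delta> k * (if k \<in> {y..2*y} then x / (4 * (real k + 1)) else 0)) = (\<Sum>k\<in>{..<K} \<inter> {y..2*y}. \<delta> k * (x / (4 * (real k + 1))))"
      by (subst sum.inter_restrict) (auto intro!: sum.cong)
    also have "{..<K} \<inter> {y..2*y} = {y..2*y}" using y by auto
    finally have "(\<Sum>k=1..K. m k * log_factor x k) \<ge> (\<Sum>k=y..2*y. \<delta> k * (x / (4 * (real k + 1)))) - err * (m K + (\<Sum>k<K. \<delta> k))" .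
    moreover have "err * (m K + (\<Sum>k<K. \<delta> k)) \<le> err * 1" unfolding m_eq using d(3) err by (intro mult_left_mono)
    ultimately have 2: "(\<Sum>k=1..K. m k * log_factor x k) \<ge> (\<Sum>k=y..2*y. \<delta> k * (x / (4 * (real k + 1)))) - err" by linarith
    have "(\<Sum>k=1..K. if k \<in> A then log_factor x k else 0) = (\<Sum>k=1..K. e k * log_factor x k) + (\<Sum>k=1..K. m k * log_factor x k)"
      unfolding e_def sum.distrib[symmetric] by (intro sum.cong) (auto simp: algebra_simps)
    then show ?thesis using 1 2 unfolding err_def by linarith
  qed
  show ?thesis by (intro exI[of _ A] exI[of _ C0] conjI allI impI C0(1) main)
qed

text \<open>As \<open>y\<close> is comparable to \<open>sqrt x\<close>, each of the
  \<open>y + 1\<close> terms is at least \<open>D x / (4 * y\<^sup>2)\<close> times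
  \<open>(y\<^sup>2 / 4) / (4 * (2 * y + 1))\<close>, that is
  \<open>D x / (64 * (2 * y + 1))\<close>.\<close>

lemma sum_block_lower:
  fixes D :: "real \<Rightarrow> real"
  assumes x: "x \<ge> 1" and D: "\<And>i. i \<ge> y \<Longrightarrow> \<delta> i \<ge> D x / (real i)\<^sup>2" "D x \<ge> 0" and y: "y = nat \<lceil>sqrt x\<rceil>"
  shows "(\<Sum>i=y..2*y. \<delta> i * (x / (4 * (real i + 1)))) \<ge> D x / 128"
proof -
  have sx: "sqrt x \<ge> 1" using x by simp
  have yy: "sqrt x \<le> real y" "real y \<le> sqrt x + 1" using y sx by (auto simp: of_nat_ceiling)
  then have y1: "real y \<ge> 1" using sx by linarith
  have "real y / 2 \<le> sqrt x" using yy sx by linarith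
  then have "(real y / 2)\<^sup>2 \<le> (sqrt x)\<^sup>2" using y1 by (intro power_mono) auto
  then have xy: "(real y)\<^sup>2 / 4 \<le> x" using x by (simp add: power_divide)
  have trm: "\<delta> i * (x / (4 * (real i + 1))) \<ge> D x / (64 * (2 * real y + 1))" if i: "i \<in> {y..2*y}" for i
  proof -
    have ir: "real y \<le> real i" "real i \<le> 2 * real y" using i by (auto simp flip: of_nat_mult)
    have i0: "real i > 0" using ir y1 by linarith
    have "(real i)\<^sup>2 \<le> (2 * real y)\<^sup>2" using ir by (intro power_mono) auto
    then have "D x / (2 * real y)\<^sup>2 \<le> D x / (real i)\<^sup>2" using D(2) i0 y1 by (intro divide_left_mono) auto
    then have a: "D x / (2 * real y)\<^sup>2 \<le> \<delta> i" using D(1)[of i] i by auto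
    have b: "((real y)\<^sup>2 / 4) / (4 * (2 * real y + 1)) \<le> x / (4 * (real i + 1))"
      using xy ir x i0 by (intro frac_le) auto
    have "D x / (64 * (2 * real y + 1)) = D x / (2 * real y)\<^sup>2 * (((real y)\<^sup>2 / 4) / (4 * (2 * real y + 1)))"
      using y1 by (simp add: power2_eq_square field_simps)
    also have "\<dots> \<le> \<delta> i * (x / (4 * (real i + 1)))"
      using a b D(2) order.trans[OF _ a] by (intro mult_mono) auto
    finally show ?thesis .
  qed
  have "D x / 128 \<le> real (card {y..2*y}) * (D x / (64 * (2 * real y + 1)))"
  proof -
    have "real (card {y..2*y}) = real y + 1" by (simp add: of_nat_diff)
    moreover have "D x * (2 * real y + 1) \<le> D x * (2 * (real y + 1))" using D(2) by (intro mult_left_mono) auto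
    ultimately show ?thesis using y1 D(2) by (simp add: divide_simps algebra_simps)
  qed
  also have "\<dots> \<le> (\<Sum>i=y..2*y. \<delta> i * (x / (4 * (real i + 1))))"
    using sum_bounded_below[of "{y..2*y}" "D x / (64 * (2 * real y + 1))" "\<lambda>i. \<delta> i * (x / (4 * (real i + 1)))"] trm by simp
  finally show ?thesis .
qed

lemma summable_ln_squares: "summable (\<lambda>i. ln (((real i)\<^sup>2)\<^sup>2 + 1) / (real i)\<^sup>2)"
proof (rule summable_comparison_test_bigo)
  show "summable (\<lambda>i. norm (real i powr (-3/2)))"
    using summable_real_powr_iff[of "-3/2"] by simp
  show "(\<lambda>i. ln (((real i)\<^sup>2)\<^sup>2 + 1) / (real i)\<^sup>2) \<in> O(\<lambda>i. real i powr (-3/2))"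
    by real_asymp
qed

lemma zero_selection:
  fixes Om :: "real \<Rightarrow> real"
  assumes Om: "\<And>x. 0 \<le> x \<Longrightarrow> 0 \<le> Om x" "\<And>x y. 0 \<le> x \<Longrightarrow> x \<le> y \<Longrightarrow> Om x \<le> Om y"
    and sum: "summable (\<lambda>i. Om ((real i)\<^sup>2) / (real i)\<^sup>2)"
  shows "\<exists>(A :: nat set) C. \<forall>x\<ge>0. \<forall>\<^sub>F K in sequentially.
    (\<Sum>k=1..K. if k \<in> A then log_factor x k else 0) \<ge> Om x + ln (x\<^sup>2 + 1) - C"
proof -
  \<comment> \<open>128 undoes the constant of \<open>sum_block_lower\<close>. Of the 4 logarithms,
    3 repay the loss computed in \<open>loss\<close> below; the fourth remains as the quadratic
    decay that puts \<open>f\<close> into \<open>H2\<close>.\<close>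
  define D where "D t = 128 * (Om t + 4 * ln (t\<^sup>2 + 1))" for t
  have D0: "D t \<ge> 0" if "t \<ge> 0" for t using Om(1)[OF that] by (simp add: D_def)
  have Dmono: "D s \<le> D t" if "0 \<le> s" "s \<le> t" for s t
  proof -
    have "s\<^sup>2 \<le> t\<^sup>2" using that by (intro power_mono) auto
    then have "ln (s\<^sup>2 + 1) \<le> ln (t\<^sup>2 + 1)" by (intro ln_mono) auto
    then show ?thesis using Om(2)[OF that] unfolding D_def by argo
  qed
  define \<delta>0 where "\<delta>0 i = D ((real i)\<^sup>2) / (real i)\<^sup>2" for i
  have \<delta>0: "\<delta>0 i \<ge> 0" for i unfolding \<delta>0_def by (intro divide_nonneg_nonneg D0) auto
  have eq: "\<delta>0 = (\<lambda>i. 128 * (Om ((real i)\<^sup>2) / (real i)\<^sup>2) + 512 * (ln (((real i)\<^sup>2)\<^sup>2 + 1) / (real i)\<^sup>2))"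
    by (simp add: \<delta>0_def D_def fun_eq_iff add_divide_distrib ring_distribs)
  have s0: "summable \<delta>0" unfolding eq by (intro summable_add summable_mult sum summable_ln_squares)
  obtain i0 where i0: "norm (\<Sum>i. \<delta>0 (i + i0)) < 1" using suminf_exist_split[of 1 \<delta>0] s0 by auto
  define i1 where "i1 = Suc i0"
  \<comment> \<open>Rounding needs total weight at most 1, so the first terms are dropped; the
    points \<open>x < x0\<close> that lose their gain are paid for by the constant
    \<open>C\<close>.\<close>
  define \<delta> where "\<delta> i = (if i \<ge> i0 then \<delta>0 i else 0)" for i
  have d0: "\<delta> i \<ge> 0" for i using \<delta>0 by (simp add: \<delta>_def)
  have ds: "summable \<delta>" by (rule summable_comparison_test'[OF s0, of 0]) (use \<delta>0 in \<open>auto simp: \<delta>_def\<close>)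
  have d1: "(\<Sum>i. \<delta> i) \<le> 1"
  proof -
    have "(\<Sum>i. \<delta> i) = (\<Sum>i. \<delta> (i + i0)) + (\<Sum>i<i0. \<delta> i)" by (rule suminf_split_initial_segment[OF ds])
    then show ?thesis using i0 by (simp add: \<delta>_def)
  qed
  obtain A C0 where C0: "C0 \<ge> 0" and A':
    "\<forall>x y K. x \<ge> 0 \<longrightarrow> x \<le> (real y)\<^sup>2 \<longrightarrow> y \<ge> 1 \<longrightarrow> 2 * y < K \<longrightarrow>
      (\<Sum>k=1..K. if k \<in> A then log_factor x k else 0) \<ge> (\<Sum>i=y..2*y. \<delta> i * (x / (4 * (real i + 1)))) - (C0 + ln (x\<^sup>2 + 1) / 2) - 5 * log_factor_bound x"
    using weighted_log_factor_sum[OF d0 ds d1] by (elim exE conjE) (rule that)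
  note A = A'[rule_format]
  define x0 where "x0 = (real i1)\<^sup>2"
  have x0: "x0 \<ge> 1" unfolding x0_def i1_def by (intro one_le_power) simp
  have log_factor_bound: "log_factor_bound x = ln 2 / 2 + ln (x\<^sup>2 + 1) / 2" for x
  proof -
    have "2 * x\<^sup>2 + 2 = 2 * (x\<^sup>2 + 1)" by simp
    then have "ln (2 * x\<^sup>2 + 2) = ln 2 + ln (x\<^sup>2 + 1)" by (simp only: ln_mult_pos sq_plus_1_pos zero_less_numeral)
    then show ?thesis by (simp add: log_factor_bound_def)
  qed
  define C1 where "C1 = C0 + 5 * ln 2 / 2"
  have loss: "(C0 + ln (x\<^sup>2 + 1) / 2) + 5 * log_factor_bound x = C1 + 3 * ln (x\<^sup>2 + 1)" for x
    unfolding C1_def log_factor_bound by (simp add: field_simps)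
  define C where "C = C1 + Om x0 + 4 * ln (x0\<^sup>2 + 1)"
  have C: "C \<ge> C1" using Om(1)[of x0] x0 by (simp add: C_def)
  have "\<forall>\<^sub>F K in sequentially. (\<Sum>k=1..K. if k \<in> A then log_factor x k else 0) \<ge> Om x + ln (x\<^sup>2 + 1) - C" if x: "x \<ge> 0" for x
  proof -
    \<comment> \<open>At least 1, so that \<open>y \<ge> 1\<close> even for
      \<open>x = 0\<close>.\<close>
    define x' where "x' = max x 1"
    define y where "y = nat \<lceil>sqrt x'\<rceil>"
    have x': "x' \<ge> 1" "x \<le> x'" by (auto simp: x'_def)
    have sy: "sqrt x' \<le> real y" unfolding y_def by (simp add: of_nat_ceiling)
    have "1 \<le> sqrt x'" using x' by simp
    then have y1: "y \<ge> 1" using sy by linarith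
    have "(sqrt x')\<^sup>2 \<le> (real y)\<^sup>2" using sy x' by (intro power_mono) auto
    then have xy: "x \<le> (real y)\<^sup>2" using x' by simp
    have bl: "(\<Sum>i=y..2*y. \<delta> i * (x / (4 * (real i + 1)))) - C1 - 3 * ln (x\<^sup>2 + 1) \<ge> Om x + ln (x\<^sup>2 + 1) - C"
    proof (cases "x \<ge> x0")
      case True
      then have x1: "x \<ge> 1" using x0 by simp
      then have xx: "x' = x" by (simp add: x'_def)
      have "sqrt x0 \<le> sqrt x" using True by simp
      then have "real i1 \<le> real y" using sy unfolding xx by (simp add: x0_def)
      then have iy: "i0 \<le> y" by (simp add: i1_def)
      have "(\<Sum>i=y..2*y. \<delta> i * (x / (4 * (real i + 1)))) \<ge> D x / 128"
      proof (rule sum_block_lower[OF x1])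
        fix i assume i: "i \<ge> y"
        then have "(real y)\<^sup>2 \<le> (real i)\<^sup>2" by (intro power_mono) auto
        then have "D x \<le> D ((real i)\<^sup>2)" by (intro Dmono[OF x] order.trans[OF xy])
        then show "D x / (real i)\<^sup>2 \<le> \<delta> i" using i iy by (simp add: \<delta>_def \<delta>0_def divide_right_mono)
      qed (use D0[OF x] in \<open>auto simp: y_def xx\<close>)
      then show ?thesis using C by (simp add: D_def)
    next
      case False
      have "(\<Sum>i=y..2*y. \<delta> i * (x / (4 * (real i + 1)))) \<ge> 0" using d0 x by (intro sum_nonneg mult_nonneg_nonneg) auto
      moreover have "Om x \<le> Om x0" using False x by (intro Om) auto
      moreover have "ln (x\<^sup>2 + 1) \<le> ln (x0\<^sup>2 + 1)"
      proof -
        have "x\<^sup>2 \<le> x0\<^sup>2" using False x by (intro power_mono) auto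
        then show ?thesis by (intro ln_mono) auto
      qed
      ultimately show ?thesis unfolding C_def by linarith
    qed
    show ?thesis
      using eventually_gt_at_top[of "2 * y"]
    proof eventually_elim
      case (elim K)
      show ?case using A[OF x xy y1 elim] bl loss[of x] by linarith
    qed
  qed
  then show ?thesis by (intro exI[of _ A] exI[of _ C]) simp
qed

text \<open>On the block from \<open>i\<^sup>2\<close> to \<open>(i + 1)\<^sup>2\<close>, of length
  \<open>2 * i + 1\<close>, monotonicity bounds the integrand below by
  \<open>Om (i\<^sup>2) / (i + 1)^3\<close>. So the block carries at least a quarter of
  \<open>Om (i\<^sup>2) / i\<^sup>2\<close>, as \<open>(i + 1)^3 \<le> 8 * i^3\<close>.\<close>

lemma summable_of_log_integral:
  fixes w :: "real \<Rightarrow> real"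
  assumes pos: "\<And>x. 0 \<le> x \<Longrightarrow> 0 < w x" and dec: "\<And>x y. 0 \<le> x \<Longrightarrow> x \<le> y \<Longrightarrow> w y \<le> w x"
    and fin: "(\<integral>\<^sup>+ t\<in>{1..}. log_integrand w t \<partial>lborel) < \<infinity>"
  shows "summable (\<lambda>i. max 0 (- ln (w ((real i)\<^sup>2))) / (real i)\<^sup>2)"
proof -
  define Om where "Om t = max 0 (- ln (w t))" for t
  have Om0: "Om t \<ge> 0" for t by (simp add: Om_def)
  have Om_mono: "Om s \<le> Om t" if "0 \<le> s" "s \<le> t" for s t
    using dec[OF that] pos[of s] pos[of t] that unfolding Om_def by (intro max.mono) auto
  define c where "c i = Om ((real i)\<^sup>2) / (real i + 1) ^ 3" for i
  have c0: "c i \<ge> 0" for i using Om0 by (simp add: c_def)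
  define I where "I = (\<integral>\<^sup>+ t. log_integrand w t * indicator {1..} t \<partial>lborel)"
  have blk: "(\<Sum>i=1..N. ennreal (c i) * indicator {(real i)\<^sup>2..<(real i + 1)\<^sup>2} t) \<le> log_integrand w t * indicator {1..} t" for N t
  proof (cases "\<exists>j\<in>{1..N}. t \<in> {(real j)\<^sup>2..<(real j + 1)\<^sup>2}")
    case True
    then obtain j where j: "j \<in> {1..N}" "(real j)\<^sup>2 \<le> t" "t < (real j + 1)\<^sup>2" by auto
    have other: "indicator {(real i)\<^sup>2..<(real i + 1)\<^sup>2} t = (0::ennreal)" if "i \<noteq> j" for i
    proof (cases "i < j")
      case True
      then have "(real i + 1)\<^sup>2 \<le> (real j)\<^sup>2" by (intro power_mono) auto
      then have "\<not> t < (real i + 1)\<^sup>2" using j(2) by linarith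
      then show ?thesis by simp
    next
      case False
      then have "(real j + 1)\<^sup>2 \<le> (real i)\<^sup>2" using that by (intro power_mono) auto
      then have "\<not> (real i)\<^sup>2 \<le> t" using j(3) by linarith
      then show ?thesis by simp
    qed
    have "(\<Sum>i=1..N. ennreal (c i) * indicator {(real i)\<^sup>2..<(real i + 1)\<^sup>2} t) = (\<Sum>i=1..N. if i = j then ennreal (c j) else 0)"
      using j by (intro sum.cong) (auto simp: other)
    also have "\<dots> = ennreal (c j)" using j(1) by simp
    also have "\<dots> \<le> log_integrand w t"
    proof -
      have j1: "(1::real) \<le> (real j)\<^sup>2" using j(1) by (intro one_le_power) auto
      then have t1: "t \<ge> 1" using j by linarith
      have "((real j + 1)\<^sup>2) powr (-3/2) \<le> t powr (-3/2)" using j t1 by (intro powr_mono2') auto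
      moreover have "((real j + 1)\<^sup>2) powr (-3/2) = 1 / (real j + 1) ^ 3"
      proof -
        have "((real j + 1)\<^sup>2) powr (-3/2) = ((real j + 1) powr 2) powr (-3/2)" by (simp add: powr_numeral)
        also have "\<dots> = (real j + 1) powr (-3)" by (subst powr_powr) simp
        also have "\<dots> = 1 / (real j + 1) ^ 3" by (simp add: powr_minus_divide powr_numeral)
        finally show ?thesis .
      qed
      ultimately have a: "1 / (real j + 1) ^ 3 \<le> t powr (-3/2)" by simp
      have "(1 / (real j + 1) ^ 3) * Om ((real j)\<^sup>2) \<le> t powr (-3/2) * Om t"
        using a Om0 j by (intro mult_mono Om_mono) auto
      moreover have "\<not> w t \<le> 0" using pos[of t] t1 by simp
      ultimately show ?thesis unfolding log_integrand_def Om_def[symmetric] by (simp add: c_def ennreal_leI)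
    qed
    also have "\<dots> = log_integrand w t * indicator {1..} t"
    proof -
      have "(1::real) \<le> (real j)\<^sup>2" using j(1) by (intro one_le_power) auto
      then have "t \<ge> 1" using j(2) by linarith
      then show ?thesis by simp
    qed
    finally show ?thesis .
  next
    case False
    then have "(\<Sum>i=1..N. ennreal (c i) * indicator {(real i)\<^sup>2..<(real i + 1)\<^sup>2} t) = (\<Sum>i=1..N. 0)"
      by (intro sum.cong) (auto simp: indicator_def)
    then show ?thesis by simp
  qed
  have psum: "ennreal (\<Sum>i=1..N. Om ((real i)\<^sup>2) / (real i)\<^sup>2) \<le> 4 * I" for N
  proof -
    have t: "Om ((real i)\<^sup>2) / (real i)\<^sup>2 \<le> 4 * (c i * (2 * real i + 1))" if "i \<ge> 1" for i
    proof -
      have "(real i + 1) ^ 3 \<le> (2 * real i) ^ 3" using that by (intro power_mono) auto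
      also have "\<dots> = 8 * real i ^ 3" by (simp add: power_mult_distrib)
      finally have "(2 * real i + 1) / (8 * real i ^ 3) \<le> (2 * real i + 1) / (real i + 1) ^ 3"
        using that by (intro divide_left_mono) auto
      moreover have "(2 * real i) / (8 * real i ^ 3) \<le> (2 * real i + 1) / (8 * real i ^ 3)" by (intro divide_right_mono) auto
      moreover have "(2 * real i) / (8 * real i ^ 3) = 1 / (4 * (real i)\<^sup>2)" using that by (simp add: power2_eq_square power3_eq_cube)
      ultimately have "1 / (4 * (real i)\<^sup>2) \<le> (2 * real i + 1) / (real i + 1) ^ 3" by linarith
      then have "4 * Om ((real i)\<^sup>2) * (1 / (4 * (real i)\<^sup>2)) \<le> 4 * Om ((real i)\<^sup>2) * ((2 * real i + 1) / (real i + 1) ^ 3)"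
        using Om0 by (intro mult_left_mono) auto
      then show ?thesis by (simp add: c_def)
    qed
    have "ennreal (\<Sum>i=1..N. Om ((real i)\<^sup>2) / (real i)\<^sup>2) \<le> ennreal (\<Sum>i=1..N. 4 * (c i * (2 * real i + 1)))"
      using t by (intro ennreal_leI sum_mono) auto
    also have "\<dots> = 4 * (\<Sum>i=1..N. ennreal (c i) * ennreal (2 * real i + 1))"
      using c0 by (simp add: sum_ennreal[symmetric] sum_distrib_left[symmetric] ennreal_mult sum_nonneg)
    also have "(\<Sum>i=1..N. ennreal (c i) * ennreal (2 * real i + 1)) = (\<Sum>i=1..N. (\<integral>\<^sup>+ t. ennreal (c i) * indicator {(real i)\<^sup>2..<(real i + 1)\<^sup>2} t \<partial>lborel))"
    proof (intro sum.cong refl)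
      fix i
      have "(real i)\<^sup>2 \<le> (real i + 1)\<^sup>2" by (intro power_mono) auto
      moreover have "(real i + 1)\<^sup>2 - (real i)\<^sup>2 = 2 * real i + 1" by (simp add: power2_eq_square algebra_simps)
      ultimately show "ennreal (c i) * ennreal (2 * real i + 1) = (\<integral>\<^sup>+ t. ennreal (c i) * indicator {(real i)\<^sup>2..<(real i + 1)\<^sup>2} t \<partial>lborel)"
        by (subst nn_integral_cmult_indicator) auto
    qed
    also have "\<dots> = (\<integral>\<^sup>+ t. (\<Sum>i=1..N. ennreal (c i) * indicator {(real i)\<^sup>2..<(real i + 1)\<^sup>2} t) \<partial>lborel)"
      by (rule nn_integral_sum[symmetric]) simp
    also have "\<dots> \<le> I" unfolding I_def by (intro nn_integral_mono blk)
    finally show ?thesis by (simp add: mult_left_mono)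
  qed
  have "4 * I < \<infinity>" using fin by (simp add: I_def ennreal_mult_less_top)
  then obtain B where B: "4 * I = ennreal B" "B \<ge> 0" by (cases "4 * I") auto
  have "summable (\<lambda>i. Om ((real i)\<^sup>2) / (real i)\<^sup>2)"
  proof (rule summableI_nonneg_bounded)
    fix n
    have "(\<Sum>i<n. Om ((real i)\<^sup>2) / (real i)\<^sup>2) \<le> (\<Sum>i=0..n. Om ((real i)\<^sup>2) / (real i)\<^sup>2)"
      using Om0 by (intro sum_mono2) auto
    \<comment> \<open>The term at 0 vanishes because division by 0 is 0.\<close>
    also have "\<dots> = (\<Sum>i=1..n. Om ((real i)\<^sup>2) / (real i)\<^sup>2)" by (subst sum.atLeast_Suc_atMost) auto
    also have "\<dots> \<le> B" using psum[of n] B Om0 by (subst (asm) B(1), subst (asm) ennreal_le_iff) auto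
    finally show "(\<Sum>i<n. Om ((real i)\<^sup>2) / (real i)\<^sup>2) \<le> B" .
  qed (use Om0 in auto)
  then show ?thesis by (simp add: Om_def)
qed

section \<open>The entire function with zeros \<open>k\<^sup>2 - \<i>\<close> and its
  reciprocal\<close>

definition partial_square_prod :: "nat set \<Rightarrow> nat \<Rightarrow> complex \<Rightarrow> complex" where
  "partial_square_prod A N z = (\<Prod>k\<in>{1..N}. if k \<in> A then 1 - z / (of_nat (k\<^sup>2) - \<i>) else 1)"

definition square_prod :: "nat set \<Rightarrow> complex \<Rightarrow> complex" where
  "square_prod A z = lim (\<lambda>N. partial_square_prod A N z)"

lemma pole_nonzero: "of_nat n - \<i> \<noteq> 0"
  by (simp add: complex_eq_iff)

lemma partial_square_prod_uniform_limit:
  assumes K: "compact K"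
  shows "uniform_limit K (partial_square_prod A) (square_prod A) sequentially"
proof -
  define f where "f n z = (if Suc n \<in> A then 1 - z / (of_nat ((Suc n)\<^sup>2) - \<i>) else 1)" for n z
  obtain \<rho> where \<rho>: "\<rho> > 0" "\<And>z. z \<in> K \<Longrightarrow> cmod z \<le> \<rho>" using compact_imp_bounded[OF K] bounded_pos by blast
  have eq: "partial_square_prod A N z = (\<Prod>n<N. f n z)" for N z
    unfolding partial_square_prod_def f_def by (induction N) (auto simp: mult.commute)
  have "uniformly_convergent_on K (\<lambda>N z. \<Prod>n<N. f n z)"
  proof (rule uniformly_convergent_on_prod'[OF _ K])
    have "c \<noteq> 0 \<Longrightarrow> continuous_on K (\<lambda>z. 1 - z / c)" for c by (intro continuous_intros) auto
    then show "continuous_on K (f n)" for n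
      unfolding f_def using pole_nonzero by (cases "Suc n \<in> A") (simp_all only: if_True if_False continuous_on_const not_False_eq_True)
    have "uniform_limit K (\<lambda>N z. \<Sum>n<N. cmod (f n z - 1)) (\<lambda>z. \<Sum>n. cmod (f n z - 1)) sequentially"
    proof (rule Weierstrass_m_test)
      fix n z assume z: "z \<in> K"
      have "(real (Suc n))\<^sup>2 \<le> cmod (of_nat ((Suc n)\<^sup>2) - \<i>)"
        using abs_Re_le_cmod[of "of_nat ((Suc n)\<^sup>2) - \<i>"] by simp
      then have "cmod z / cmod (of_nat ((Suc n)\<^sup>2) - \<i>) \<le> \<rho> / (real (Suc n))\<^sup>2"
        using \<rho> z by (intro frac_le) auto
      then show "norm (cmod (f n z - 1)) \<le> \<rho> * (1 / (real (Suc n))\<^sup>2)"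
        using \<rho> by (simp add: f_def norm_divide)
    next
      have "summable (\<lambda>n. 1 / (real (Suc n))\<^sup>2)"
        using inverse_power_summable[of 2, where 'a=real] by (subst summable_Suc_iff) (simp add: inverse_eq_divide)
      then show "summable (\<lambda>n. \<rho> * (1 / (real (Suc n))\<^sup>2))" by (rule summable_mult)
    qed
    then show "uniformly_convergent_on K (\<lambda>N z. \<Sum>n<N. cmod (f n z - 1))" by (rule uniformly_convergentI)
  qed
  then have "uniform_limit K (\<lambda>N z. partial_square_prod A N z) (\<lambda>z. lim (\<lambda>N. partial_square_prod A N z)) sequentially"
    unfolding eq by (rule uniformly_convergent_uniform_limit_iff[THEN iffD1])
  then show ?thesis by (simp add: square_prod_def[abs_def])
qed

lemma partial_square_prod_tendsto: "(\<lambda>N. partial_square_prod A N z) \<longlonglongrightarrow> square_prod A z"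
  using tendsto_uniform_limitI[OF partial_square_prod_uniform_limit[of "{z}" A], of z] by simp

lemma partial_square_prod_holomorphic: "partial_square_prod A N holomorphic_on UNIV"
proof -
  have "(if k \<in> A then 1 - z / (of_nat (k\<^sup>2) - \<i>) else 1) = (1 - (if k \<in> A then 1 else 0) * z / (of_nat (k\<^sup>2) - \<i>))" for k z by simp
  then show ?thesis unfolding partial_square_prod_def[abs_def]
    by (simp only:) (intro holomorphic_intros pole_nonzero)
qed

lemma square_prod_holomorphic: "square_prod A holomorphic_on UNIV"
proof (rule holomorphic_uniform_sequence[OF open_UNIV partial_square_prod_holomorphic])
  show "\<exists>d>0. cball x d \<subseteq> UNIV \<and> uniform_limit (cball x d) (partial_square_prod A) (square_prod A) sequentially" for x
    using partial_square_prod_uniform_limit[OF compact_cball] zero_less_one by blast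
qed

text \<open>A point of the closed upper half-plane is at least as far from
  \<open>k\<^sup>2 - \<i>\<close> as the real point \<open>\<bar>x\<bar>\<close>: negative
  \<open>x\<close> is farther from \<open>k\<^sup>2\<close> than \<open>\<bar>x\<bar>\<close>, and
  raising \<open>y\<close> moves away from the zero. This yields both the bound in the half-plane
  and its evenness in \<open>x\<close>.\<close>

lemma factor_lower_bound:
  assumes y: "y \<ge> 0"
  shows "exp (log_factor \<bar>x\<bar> k) \<le> cmod (1 - Complex x y / (of_nat (k\<^sup>2) - \<i>))"
proof -
  define t where "t = (real k)\<^sup>2"
  have t: "t \<ge> 0" by (simp add: t_def)
  have kt: "of_nat (k\<^sup>2) - \<i> = Complex t (-1)" by (simp add: complex_eq_iff t_def)
  have p: "((t - \<bar>x\<bar>)\<^sup>2 + 1) / (t\<^sup>2 + 1) > 0" by (intro divide_pos_pos sq_plus_1_pos)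
  have "1 - Complex x y / Complex t (-1) = Complex (t - x) (- 1 - y) / Complex t (-1)"
  proof -
    have "Complex t (-1) \<noteq> 0" by (simp add: complex_eq_iff)
    then have "1 - Complex x y / Complex t (-1) = (Complex t (-1) - Complex x y) / Complex t (-1)" by (simp add: diff_divide_distrib)
    also have "Complex t (-1) - Complex x y = Complex (t - x) (- 1 - y)" by (simp add: complex_eq_iff)
    finally show ?thesis .
  qed
  then have "cmod (1 - Complex x y / (of_nat (k\<^sup>2) - \<i>)) = sqrt ((t - x)\<^sup>2 + (- 1 - y)\<^sup>2) / sqrt (t\<^sup>2 + 1)"
    unfolding kt by (simp only: norm_divide) (simp add: cmod_def)
  also have "\<dots> \<ge> sqrt ((t - \<bar>x\<bar>)\<^sup>2 + 1) / sqrt (t\<^sup>2 + 1)"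
  proof (intro divide_right_mono real_sqrt_le_mono add_mono)
    show "(t - \<bar>x\<bar>)\<^sup>2 \<le> (t - x)\<^sup>2" using t abs_ge_self[of x] mult_left_mono[of x "\<bar>x\<bar>" "2 * t"] by (simp add: power2_diff)
    have "1\<^sup>2 \<le> (1 + y)\<^sup>2" using y by (intro power_mono) auto
    moreover have "(- 1 - y)\<^sup>2 = (1 + y)\<^sup>2" by (simp add: power2_eq_square algebra_simps)
    ultimately show "1 \<le> (- 1 - y)\<^sup>2" by simp
  qed auto
  also have "sqrt ((t - \<bar>x\<bar>)\<^sup>2 + 1) / sqrt (t\<^sup>2 + 1) = exp (log_factor \<bar>x\<bar> k)"
    unfolding real_sqrt_divide[symmetric] log_factor_def t_def[symmetric] ln_sqrt[OF less_imp_le[OF p], symmetric]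
    by (intro exp_ln[symmetric]) (simp only: real_sqrt_gt_0_iff p)
  finally show ?thesis .
qed

lemma partial_square_prod_lower_bound:
  assumes y: "y \<ge> 0"
  shows "exp (\<Sum>k=1..N. if k \<in> A then log_factor \<bar>x\<bar> k else 0) \<le> cmod (partial_square_prod A N (Complex x y))"
proof -
  have "exp (\<Sum>k=1..N. if k \<in> A then log_factor \<bar>x\<bar> k else 0) = (\<Prod>k=1..N. exp (if k \<in> A then log_factor \<bar>x\<bar> k else 0))"
    by (rule exp_sum) simp
  also have "\<dots> \<le> (\<Prod>k=1..N. cmod (if k \<in> A then 1 - Complex x y / (of_nat (k\<^sup>2) - \<i>) else 1))"
    using factor_lower_bound[OF y] by (intro prod_mono) auto
  also have "\<dots> = cmod (partial_square_prod A N (Complex x y))" unfolding partial_square_prod_def by (rule prod_norm)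
  finally show ?thesis .
qed

definition squares_of :: "nat set \<Rightarrow> nat set" where
  "squares_of A = (\<lambda>k. k\<^sup>2) ` {k \<in> A. k \<ge> 1}"

text \<open>Truncating the Blaschke product at \<open>N\<^sup>2\<close> matches truncating the
  square product at \<open>N\<close>, so the reflection can be checked factor by factor.\<close>

lemma partial_subproduct_squares:
  "partial_subproduct (squares_of A) (N\<^sup>2) z = (\<Prod>k\<in>{1..N}. if k \<in> A then node_factor (k\<^sup>2) z else 1)"
proof -
  have inj: "inj_on (\<lambda>k::nat. k\<^sup>2) B" for B by (rule inj_onI) simp
  have "partial_subproduct (squares_of A) (N\<^sup>2) z = (\<Prod>n\<in>{1..N\<^sup>2} \<inter> squares_of A. node_factor n z)"
    unfolding partial_subproduct_def by (rule prod.inter_restrict[symmetric]) simp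
  also have "{1..N\<^sup>2} \<inter> squares_of A = (\<lambda>k. k\<^sup>2) ` ({1..N} \<inter> A)"
    by (auto simp: squares_of_def power_mono_iff intro!: image_eqI)
  also have "(\<Prod>n\<in>\<dots>. node_factor n z) = (\<Prod>k\<in>{1..N} \<inter> A. node_factor (k\<^sup>2) z)"
    by (subst prod.reindex[OF inj]) simp
  also have "\<dots> = (\<Prod>k\<in>{1..N}. if k \<in> A then node_factor (k\<^sup>2) z else 1)"
    by (rule prod.inter_restrict) simp
  finally show ?thesis .
qed

text \<open>For real \<open>x\<close> the Blaschke factor turns \<open>x - (n - \<i>)\<close> into
  its conjugate; the constant collects the normalisations.\<close>

lemma node_factor_times_factor:
  assumes n: "n \<ge> 1"
  obtains c where "\<And>x::real. node_factor n (of_real x) * (1 - of_real x / (of_nat n - \<i>)) = c * cnj (1 - of_real x / (of_nat n - \<i>))"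
proof -
  define d where "d = of_real (cmod ((of_nat n + \<i>)\<^sup>2 + 1)) / ((of_nat n + \<i>)\<^sup>2 + 1)"
  have "node_factor n (of_real x) * (1 - of_real x / (of_nat n - \<i>)) = (d * (of_nat n + \<i>) / (of_nat n - \<i>)) * cnj (1 - of_real x / (of_nat n - \<i>))" for x :: real
  proof -
    have nz: "of_nat n - \<i> \<noteq> 0" "of_nat n + \<i> \<noteq> 0" "of_real x - (of_nat n - \<i>) \<noteq> 0" by (simp_all add: complex_eq_iff)
    have b: "node_factor n (of_real x) = d * ((of_real x - (of_nat n + \<i>)) / (of_real x - (of_nat n - \<i>)))"
      by (simp add: node_factor_def blaschke_factor_def d_def)
    have f: "1 - of_real x / (of_nat n - \<i>) = - (of_real x - (of_nat n - \<i>)) / (of_nat n - \<i>)"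
      using nz by (simp add: field_simps)
    have g: "cnj (1 - of_real x / (of_nat n - \<i>)) = - (of_real x - (of_nat n + \<i>)) / (of_nat n + \<i>)"
      unfolding f by simp
    show ?thesis unfolding g unfolding b f using nz by (simp add: divide_simps) (simp add: algebra_simps)
  qed
  then show ?thesis using that by blast
qed

text \<open>The constants of the finite products converge because they can be read off at
  \<open>x = 0\<close>, where the limit product does not vanish.\<close>

lemma subproduct_square_prod_reflection:
  assumes nz: "\<And>x::real. square_prod A (of_real x) \<noteq> 0"
  obtains \<kappa> where "\<And>x::real. subproduct (squares_of A) (of_real x) * square_prod A (of_real x) = \<kappa> * cnj (square_prod A (of_real x))"
proof -
  have "\<exists>c. \<forall>x::real. k \<ge> 1 \<longrightarrow> node_factor (k\<^sup>2) (of_real x) * (1 - of_real x / (of_nat (k\<^sup>2) - \<i>)) = c * cnj (1 - of_real x / (of_nat (k\<^sup>2) - \<i>))" for k :: nat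
    using node_factor_times_factor[of "k\<^sup>2"] by (metis one_le_power)
  then obtain c where c: "\<And>k x. k \<ge> 1 \<Longrightarrow> node_factor (k\<^sup>2) (complex_of_real x) * (1 - of_real x / (of_nat (k\<^sup>2) - \<i>)) = c k * cnj (1 - of_real x / (of_nat (k\<^sup>2) - \<i>))"
    by metis
  define cc where "cc N = (\<Prod>k\<in>{1..N}. if k \<in> A then c k else 1)" for N
  have fin: "partial_subproduct (squares_of A) (N\<^sup>2) (of_real x) * partial_square_prod A N (of_real x) = cc N * cnj (partial_square_prod A N (of_real x))" for N and x :: real
  proof -
    have "partial_subproduct (squares_of A) (N\<^sup>2) (of_real x) * partial_square_prod A N (of_real x)
       = (\<Prod>k\<in>{1..N}. (if k \<in> A then node_factor (k\<^sup>2) (of_real x) else 1) * (if k \<in> A then 1 - of_real x / (of_nat (k\<^sup>2) - \<i>) else 1))"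
      unfolding partial_subproduct_squares partial_square_prod_def by (rule prod.distrib[symmetric])
    also have "\<dots> = (\<Prod>k\<in>{1..N}. (if k \<in> A then c k else 1) * cnj (if k \<in> A then 1 - of_real x / (of_nat (k\<^sup>2) - \<i>) else 1))"
      using c by (intro prod.cong refl) (simp split: if_splits)
    also have "\<dots> = cc N * cnj (partial_square_prod A N (of_real x))"
      unfolding cc_def partial_square_prod_def prod.distrib cnj_prod ..
    finally show ?thesis .
  qed
  have sq: "filterlim (\<lambda>N::nat. N\<^sup>2) sequentially sequentially"
    by (rule filterlim_subseq) (auto simp: strict_mono_def power_strict_mono)
  have lim: "(\<lambda>N. partial_subproduct (squares_of A) (N\<^sup>2) (of_real x) * partial_square_prod A N (of_real x)) \<longlonglongrightarrow> subproduct (squares_of A) (of_real x) * square_prod A (of_real x)" for x :: real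
    by (intro tendsto_mult partial_square_prod_tendsto filterlim_compose[OF partial_subproduct_tendsto sq] pole_free_upper) simp
  have lim2: "(\<lambda>N. cnj (partial_square_prod A N (of_real x))) \<longlonglongrightarrow> cnj (square_prod A (of_real x))" for x :: real
    by (intro tendsto_cnj partial_square_prod_tendsto)
  have nz': "\<forall>\<^sub>F N in sequentially. cnj (partial_square_prod A N (of_real 0)) \<noteq> 0"
    by (rule tendsto_imp_eventually_ne[OF lim2[of 0]]) (use nz[of 0] in simp)
  define \<kappa> where "\<kappa> = subproduct (squares_of A) (of_real 0) * square_prod A (of_real 0) / cnj (square_prod A (of_real 0))"
  have "(\<lambda>N. partial_subproduct (squares_of A) (N\<^sup>2) (of_real 0) * partial_square_prod A N (of_real 0) / cnj (partial_square_prod A N (of_real 0))) \<longlonglongrightarrow> \<kappa>"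
    unfolding \<kappa>_def by (intro tendsto_divide lim lim2) (use nz[of 0] in simp)
  moreover have "\<forall>\<^sub>F N in sequentially. partial_subproduct (squares_of A) (N\<^sup>2) (of_real 0) * partial_square_prod A N (of_real 0) / cnj (partial_square_prod A N (of_real 0)) = cc N"
    using nz' by eventually_elim (simp only: fin, simp)
  ultimately have cc: "cc \<longlonglongrightarrow> \<kappa>" by (rule Lim_transform_eventually)
  have "subproduct (squares_of A) (of_real x) * square_prod A (of_real x) = \<kappa> * cnj (square_prod A (of_real x))" for x :: real
  proof -
    have "(\<lambda>N. cc N * cnj (partial_square_prod A N (of_real x))) \<longlonglongrightarrow> \<kappa> * cnj (square_prod A (of_real x))"
      by (intro tendsto_mult cc lim2)
    then show ?thesis using lim[of x] unfolding fin by (rule LIMSEQ_unique[rotated])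
  qed
  then show ?thesis using that by blast
qed

lemma H2_of_quadratic_decay:
  assumes hol: "h holomorphic_on upper_half"
    and le: "\<And>x y. y > 0 \<Longrightarrow> cmod (h (Complex x y)) \<le> 1 / (x\<^sup>2 + 1)"
  shows "h \<in> H2"
proof (rule H2_I[OF hol])
  fix y :: real assume y: "y > 0"
  have "l2sq (\<lambda>x. h (Complex x y)) \<le> (\<integral>\<^sup>+ x. ennreal (1 / ((x - 0)\<^sup>2 + 1\<^sup>2)) \<partial>lborel)"
    unfolding l2sq_def
  proof (intro nn_integral_mono ennreal_leI)
    fix x :: real
    have r: "1 / (x\<^sup>2 + 1) \<le> 1" by (simp add: divide_le_eq_1_pos)
    have "(cmod (h (Complex x y)))\<^sup>2 \<le> (1 / (x\<^sup>2 + 1))\<^sup>2" using le[OF y, of x] by (intro power_mono) auto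
    also have "\<dots> \<le> (1 / (x\<^sup>2 + 1)) * 1" unfolding power2_eq_square[of "1 / (x\<^sup>2 + 1)"] using r by (intro mult_left_mono) auto
    finally show "(cmod (h (Complex x y)))\<^sup>2 \<le> 1 / ((x - 0)\<^sup>2 + 1\<^sup>2)" by simp
  qed
  also have "\<dots> = ennreal (pi / 1)" by (rule nn_integral_inverse_quadratic) simp
  finally show "l2sq (\<lambda>x. h (Complex x y)) \<le> ennreal (pi / 1)" .
qed

text \<open>The reflection removes the conjugate from the pairing of \<open>f\<close> with
  \<open>B1 * g\<close>: up to conjugation it becomes the integral of
  \<open>\<kappa> * h * g\<close> with both \<open>h\<close> and \<open>g\<close> in
  \<open>H2\<close>, to which \<open>H2_trace_product_zero\<close> applies.\<close>

lemma model_space_small_function: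
  fixes Om :: "real \<Rightarrow> real"
  assumes Om: "\<And>x. 0 \<le> x \<Longrightarrow> 0 \<le> Om x" "\<And>x y. 0 \<le> x \<Longrightarrow> x \<le> y \<Longrightarrow> Om x \<le> Om y"
    and sum: "summable (\<lambda>i. Om ((real i)\<^sup>2) / (real i)\<^sup>2)"
  obtains f where "f \<in> model_space B1" "nonzero_on_upper f" "\<And>x. cmod (bv f x) \<le> exp (- Om \<bar>x\<bar>)"
proof -
  have "\<exists>(A :: nat set) C. \<forall>x\<ge>0. \<forall>\<^sub>F K in sequentially.
    (\<Sum>k=1..K. if k \<in> A then log_factor x k else 0) \<ge> Om x + ln (x\<^sup>2 + 1) - C"
    by (rule zero_selection[OF Om sum])
  then obtain A :: "nat set" and C where AC':
    "\<forall>x\<ge>0. \<forall>\<^sub>F K in sequentially. (\<Sum>k=1..K. if k \<in> A then log_factor x k else 0) \<ge> Om x + ln (x\<^sup>2 + 1) - C"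
    by (elim exE)
  note AC = AC'[rule_format]
  \<comment> \<open>The factor \<open>x\<^sup>2 + 1\<close> is the spare logarithm of
    \<open>zero_selection\<close>. Valid on the closed half-plane, the bound excludes zeros there
    and makes \<open>f\<close> square integrable on all lines.\<close>
  have lower: "exp (Om \<bar>x\<bar> - C) * (x\<^sup>2 + 1) \<le> cmod (square_prod A (Complex x y))" if y: "y \<ge> 0" for x y
  proof (rule tendsto_lowerbound[OF tendsto_norm[OF partial_square_prod_tendsto]])
    have "\<forall>\<^sub>F K in sequentially. (\<Sum>k=1..K. if k \<in> A then log_factor \<bar>x\<bar> k else 0) \<ge> Om \<bar>x\<bar> + ln (\<bar>x\<bar>\<^sup>2 + 1) - C"
      by (rule AC) simp
    then show "\<forall>\<^sub>F K in sequentially. exp (Om \<bar>x\<bar> - C) * (x\<^sup>2 + 1) \<le> cmod (partial_square_prod A K (Complex x y))"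
    proof eventually_elim
      case (elim K)
      have "exp (Om \<bar>x\<bar> - C) * (x\<^sup>2 + 1) = exp (Om \<bar>x\<bar> - C) * exp (ln (x\<^sup>2 + 1))" by simp
      also have "\<dots> = exp (Om \<bar>x\<bar> + ln (\<bar>x\<bar>\<^sup>2 + 1) - C)" by (simp flip: exp_add add: algebra_simps)
      also have "\<dots> \<le> exp (\<Sum>k=1..K. if k \<in> A then log_factor \<bar>x\<bar> k else 0)" using elim by simp
      also have "\<dots> \<le> cmod (partial_square_prod A K (Complex x y))" by (rule partial_square_prod_lower_bound[OF y])
      finally show ?case .
    qed
  qed simp
  have PAnz: "square_prod A z \<noteq> 0" if "Im z \<ge> 0" for z
  proof -
    have "0 < exp (Om \<bar>Re z\<bar> - C) * ((Re z)\<^sup>2 + 1)" by (intro mult_pos_pos) auto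
    also have "\<dots> \<le> cmod (square_prod A z)" using lower[OF that, of "Re z"] by simp
    finally show ?thesis by simp
  qed
  define f where "f z = of_real (exp (- C)) / square_prod A z" for z
  have f_le: "cmod (f (Complex x y)) \<le> exp (- Om \<bar>x\<bar>) * (1 / (x\<^sup>2 + 1))" if "y \<ge> 0" for x y
  proof -
    have "cmod (f (Complex x y)) \<le> exp (- C) / (exp (Om \<bar>x\<bar> - C) * (x\<^sup>2 + 1))"
      unfolding f_def norm_divide using lower[OF that, of x] by (intro frac_le) (auto intro!: mult_pos_pos)
    also have "\<dots> = exp (- Om \<bar>x\<bar>) * (1 / (x\<^sup>2 + 1))"
      by (simp add: exp_diff exp_minus field_simps)
    finally show ?thesis .
  qed
  have f_le2: "cmod (f (Complex x y)) \<le> 1 / (x\<^sup>2 + 1)" if "y \<ge> 0" for x y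
  proof -
    have "exp (- Om \<bar>x\<bar>) * (1 / (x\<^sup>2 + 1)) \<le> 1 * (1 / (x\<^sup>2 + 1))" using Om(1)[of "\<bar>x\<bar>"] by (intro mult_right_mono) auto
    then show ?thesis using f_le[OF that, of x] by simp
  qed
  have f_hol: "f holomorphic_on upper_half"
    unfolding f_def using PAnz holomorphic_on_subset[OF square_prod_holomorphic] by (intro holomorphic_intros) (auto simp: upper_half_def)
  have fH: "f \<in> H2" by (rule H2_of_quadratic_decay[OF f_hol]) (simp add: f_le2)
  have f_lim: "((\<lambda>y. f (Complex x y)) \<longlongrightarrow> f (of_real x)) (at_right 0)" for x
  proof -
    have "isCont (square_prod A) (of_real x)"
      using continuous_on_interior[OF holomorphic_on_imp_continuous_on[OF square_prod_holomorphic]] by simp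
    then have "isCont f (of_real x)" unfolding f_def using PAnz[of "of_real x"] by (intro continuous_intros) auto
    then have "isCont (\<lambda>y. f (of_real x + \<i> * of_real y)) 0"
      using isCont_o2[of 0 "\<lambda>y. of_real x + \<i> * of_real y" f] by (auto intro!: continuous_intros)
    then have "((\<lambda>y. f (of_real x + \<i> * of_real y)) \<longlongrightarrow> f (of_real x + \<i> * of_real 0)) (at 0)"
      by (simp add: isCont_def)
    then show ?thesis by (auto simp: Complex_eq intro: tendsto_mono[OF at_le])
  qed
  then have bvf: "bv f x = f (of_real x)" for x unfolding bv_def by (intro tendsto_Lim) auto
  define S where "S = squares_of A"
  define h where "h z = subproduct (- S) z * f z" for z
  have h_hol: "h holomorphic_on upper_half"
    unfolding h_def by (intro holomorphic_intros f_hol holomorphic_on_subset[OF subproduct_holomorphic]) (auto simp: upper_half_def pole_free_def)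
  have hH: "h \<in> H2"
  proof (rule H2_of_quadratic_decay[OF h_hol])
    fix x y :: real assume y: "y > 0"
    have "cmod (h (Complex x y)) \<le> 1 * cmod (f (Complex x y))"
      unfolding h_def norm_mult using y by (intro mult_right_mono subproduct_upper) auto
    then show "cmod (h (Complex x y)) \<le> 1 / (x\<^sup>2 + 1)" using f_le2[of y x] y by simp
  qed
  have f_real_cont: "continuous_on UNIV (\<lambda>x. f (complex_of_real x))"
    unfolding f_def using PAnz
    by (intro continuous_intros continuous_on_compose2[OF holomorphic_on_imp_continuous_on[OF square_prod_holomorphic]]) auto
  have h_trace: "H2_trace h (\<lambda>x. h (of_real x))"
    unfolding H2_trace_def
  proof (intro conjI AE_I2)
    show "(\<lambda>x. h (complex_of_real x)) \<in> borel_measurable borel"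
      unfolding h_def by (intro borel_measurable_continuous_onI continuous_intros f_real_cont continuous_on_real_line subproduct_holomorphic)
    show "((\<lambda>y. h (Complex x y)) \<longlongrightarrow> h (of_real x)) (at_right 0)" for x
      unfolding h_def by (intro tendsto_mult vertical_limit_real subproduct_holomorphic f_lim)
  qed
  obtain \<kappa> where \<kappa>: "\<And>x::real. subproduct S (of_real x) * square_prod A (of_real x) = \<kappa> * cnj (square_prod A (of_real x))"
    using subproduct_square_prod_reflection[of A] PAnz unfolding S_def by auto
  have refl: "B1 (of_real x) * cnj (f (of_real x)) = \<kappa> * h (of_real x)" for x :: real
  proof -
    have nz: "square_prod A (of_real x) \<noteq> 0" "cnj (square_prod A (of_real x)) \<noteq> 0" using PAnz[of "of_real x"] by auto
    have "subproduct S (of_real x) / cnj (square_prod A (of_real x)) = \<kappa> / square_prod A (of_real x)"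
      using \<kappa>[of x] nz by (simp add: frac_eq_eq)
    then have "subproduct S (of_real x) / cnj (square_prod A (of_real x)) * (subproduct (- S) (of_real x) * of_real (exp (- C)))
      = \<kappa> / square_prod A (of_real x) * (subproduct (- S) (of_real x) * of_real (exp (- C)))" by simp
    then show ?thesis using B1_split[of "of_real x" S] pole_free_upper[of "of_real x"]
      by (simp add: h_def f_def mult_ac)
  qed
  have "f \<in> model_space B1"
    unfolding model_space_def
  proof (intro CollectI conjI ballI fH)
    fix g assume g: "g \<in> H2"
    obtain G where G: "H2_trace g G" using H2_trace_exists[OF g] by blast
    note [measurable] = H2_trace_measurable[OF G] H2_trace_measurable[OF h_trace]
    have "AE x in lborel. ((\<lambda>y. g (Complex x y)) \<longlongrightarrow> G x) (at_right 0)" using G by (simp add: H2_trace_def)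
    then have ae: "AE x in lborel. bv f x * cnj (bv (\<lambda>z. B1 z * g z) x) = cnj (\<kappa> * (h (of_real x) * G x))"
    proof eventually_elim
      case (elim x)
      have "((\<lambda>y. B1 (Complex x y) * g (Complex x y)) \<longlongrightarrow> B1 (of_real x) * G x) (at_right 0)"
        by (intro tendsto_mult vertical_limit_real B1_holomorphic elim)
      then have "bv (\<lambda>z. B1 z * g z) x = B1 (of_real x) * G x" unfolding bv_def by (intro tendsto_Lim) auto
      then have "bv f x * cnj (bv (\<lambda>z. B1 z * g z) x) = cnj (B1 (of_real x) * cnj (f (of_real x)) * G x)"
        unfolding bvf by simp
      also have "\<dots> = cnj (\<kappa> * (h (of_real x) * G x))" unfolding refl by simp
      finally show ?case .
    qed
    have "(LINT x|lebesgue. bv f x * cnj (bv (\<lambda>z. B1 z * g z) x)) = (LBINT x. cnj (\<kappa> * (h (of_real x) * G x)))"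
      by (rule lebesgue_integral_AE_borel[OF _ ae]) measurable
    also have "\<dots> = cnj (LBINT x. \<kappa> * (h (of_real x) * G x))" by (rule Bochner_Integration.integral_cnj)
    also have "(LBINT x. \<kappa> * (h (of_real x) * G x)) = \<kappa> * (LBINT x. h (of_real x) * G x)" by (rule integral_mult_right_zero)
    also have "(LBINT x. h (of_real x) * G x) = 0" by (rule H2_trace_product_zero[OF hH g h_trace G])
    finally show "(LINT x|lebesgue. bv f x * cnj (bv (\<lambda>z. B1 z * g z) x)) = 0" by simp
  qed
  moreover have "nonzero_on_upper f"
    unfolding nonzero_on_upper_def using PAnz[of \<i>] by (intro bexI[of _ \<i>]) (auto simp: f_def upper_half_def)
  moreover have "cmod (bv f x) \<le> exp (- Om \<bar>x\<bar>)" for x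
  proof -
    have "exp (- Om \<bar>x\<bar>) * (1 / (x\<^sup>2 + 1)) \<le> exp (- Om \<bar>x\<bar>) * 1" by (intro mult_left_mono) (auto simp: divide_le_eq_1_pos)
    moreover have "Complex x 0 = of_real x" by (simp add: complex_eq_iff)
    ultimately show ?thesis unfolding bvf using f_le[of 0 x] by simp
  qed
  ultimately show ?thesis by (rule that)
qed

theorem theorem1p1:
  fixes w :: "real \<Rightarrow> real"
  assumes nonneg: "\<forall>x\<ge>0. 0 \<le> w x"
  shows "(w \<in> Adm_plus B1 \<longrightarrow>
            (\<integral>\<^sup>+ t\<in>{1..}. log_integrand w t \<partial>lborel) < \<infinity>)
       \<and> ((\<forall>x\<ge>0. 0 < w x) \<and> (\<forall>x y. 0 \<le> x \<and> x \<le> y \<longrightarrow> w y \<le> w x) \<and>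
            (\<integral>\<^sup>+ t\<in>{1..}. log_integrand w t \<partial>lborel) < \<infinity>
          \<longrightarrow> w \<in> Adm_plus B1 \<and> (\<lambda>x. w \<bar>x\<bar>) \<in> Adm B1)"
proof (intro conjI impI)
  assume "w \<in> Adm_plus B1"
  then show "(\<integral>\<^sup>+ t\<in>{1..}. log_integrand w t \<partial>lborel) < \<infinity>" by (rule Adm_plus_log_integrable)
next
  assume a: "(\<forall>x\<ge>0. 0 < w x) \<and> (\<forall>x y. 0 \<le> x \<and> x \<le> y \<longrightarrow> w y \<le> w x) \<and>
            (\<integral>\<^sup>+ t\<in>{1..}. log_integrand w t \<partial>lborel) < \<infinity>"
  then have pos: "\<And>x. 0 \<le> x \<Longrightarrow> 0 < w x" and dec: "\<And>x y. 0 \<le> x \<Longrightarrow> x \<le> y \<Longrightarrow> w y \<le> w x"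
    and fin: "(\<integral>\<^sup>+ t\<in>{1..}. log_integrand w t \<partial>lborel) < \<infinity>" by blast+
  \<comment> \<open>The positive part keeps \<open>Om\<close> nonnegative, and
    \<open>exp (- Om t)\<close> is still at most \<open>w t\<close>.\<close>
  define Om where "Om t = max 0 (- ln (w t))" for t
  have "summable (\<lambda>i. Om ((real i)\<^sup>2) / (real i)\<^sup>2)"
    unfolding Om_def by (rule summable_of_log_integral[OF pos dec fin])
  moreover have "Om s \<le> Om t" if "0 \<le> s" "s \<le> t" for s t
    using dec[OF that] pos[of s] pos[of t] that unfolding Om_def by (intro max.mono) auto
  ultimately obtain f where f: "f \<in> model_space B1" "nonzero_on_upper f" "\<And>x. cmod (bv f x) \<le> exp (- Om \<bar>x\<bar>)"
    using model_space_small_function[of Om] unfolding Om_def by auto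
  have le: "cmod (bv f x) \<le> w \<bar>x\<bar>" for x
  proof -
    have "exp (- Om \<bar>x\<bar>) \<le> exp (ln (w \<bar>x\<bar>))" by (simp only: exp_le_cancel_iff) (simp add: Om_def)
    also have "\<dots> = w \<bar>x\<bar>" using pos[of "\<bar>x\<bar>"] by simp
    finally show ?thesis using f(3)[of x] by linarith
  qed
  have "AE x in lebesgue. 0 < x \<longrightarrow> cmod (bv f x) \<le> w x"
    using le by (intro AE_I2) (metis abs_of_pos)
  then show "w \<in> Adm_plus B1" using nonneg f unfolding Adm_plus_def by blast
  have "AE x in lebesgue. cmod (bv f x) \<le> w \<bar>x\<bar>" using le by (intro AE_I2) auto
  then show "(\<lambda>x. w \<bar>x\<bar>) \<in> Adm B1" using nonneg f unfolding Adm_def by auto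
qed

end
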